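(* Let $G$ be a second-countable locally compact Hausdorff étale groupoid with interior of the isotropy $\mathrm{Iso}(G)^\circ$, and suppose that $\mathrm{Iso}(G)^\circ$ is abelian. Let $\iota_r : C^*_r(\mathrm{Iso}(G)^\circ)\to C^*_r(G)$ be the injective homomorphism induced by extension of functions by zero, and let $M_r := \iota_r(C^*_r(\mathrm{Iso}(G)^\circ))$. Let $j:C^*_r(G)\to C_0(G)$ be the injective norm-decreasing linear map that extends the inclusion $C_c(G)\to C_0(G)$. Then $M_r$ is maximal abelian in $C^*_r(G)$ if and only if $$\{a \in C^*_r(G) : j(a) \in C_0(\mathrm{Iso}(G)^\circ)\} \subseteq M_r.$$
   Context: A groupoid $G$ is étale if $r,s:G\to G^{(0)}$ are local homeomorphisms. Write $G_u=s^{-1}(u)$ for $u\in G^{(0)}$. $\mathrm{Iso}(G)=\{\gamma\in G: r(\gamma)=s(\gamma)\}$ and $\mathrm{Iso}(G)^\circ$ is its interior in $G$; it is an open étale subgroupoid containing $G^{(0)}$. It is abelian if it is a bundle of abelian groups, i.e. each group $\mathrm{Iso}(G)^\circ\cap G_u$ is abelian. $C^*_r(G)$ is the completion of the convolution $*$-algebra $C_c(G)$ in the norm $\|f\|_r=\sup_{u\in G^{(0)}}\|L^u(f)\|$, where $L^u(f)\delta_\gamma=\sum_{s(\alpha)=r(\gamma)}f(\alpha)\delta_{\alpha\gamma}$ on $\ell^2(G_u)$. It is a known fact (Renault) that the identity map on $C_c(G)$ extends to an injective norm-decreasing linear map $j:C^*_r(G)\to C_0(G)$. $C_0(\mathrm{Iso}(G)^\circ)$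 is regarded as the set of functions in $C_0(G)$ that vanish off the open set $\mathrm{Iso}(G)^\circ$. *)

theory Defs
  imports "HOL-Analysis.Analysis"
begin

section \<open>Etale groupoids\<close>

text \<open>The set of arrows is the carrier of the topology; the operations are only constrained on
  arrows (and \<open>mult\<close> only on composable pairs). Units are identified with identity arrows.\<close>

record 'g top_groupoid =
  gtop :: "'g topology"
  src :: "'g \<Rightarrow> 'g"
  rng :: "'g \<Rightarrow> 'g"
  mult :: "'g \<Rightarrow> 'g \<Rightarrow> 'g"
  ginv :: "'g \<Rightarrow> 'g"

definition arrows :: "'g top_groupoid \<Rightarrow> 'g set" where
  "arrows G = topspace (gtop G)"

definition units :: "'g top_groupoid \<Rightarrow> 'g set" where
  "units G = src G ` arrows G"

definition composable :: "'g top_groupoid \<Rightarrow> ('g \<times> 'g) set" where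
  "composable G = {(\<alpha>, \<beta>). \<alpha> \<in> arrows G \<and> \<beta> \<in> arrows G \<and> src G \<alpha> = rng G \<beta>}"

definition src_fibre :: "'g top_groupoid \<Rightarrow> 'g \<Rightarrow> 'g set" where
  "src_fibre G u = {\<gamma> \<in> arrows G. src G \<gamma> = u}"

definition algebraic_groupoid :: "'g top_groupoid \<Rightarrow> bool" where
  "algebraic_groupoid G \<longleftrightarrow>
     (\<forall>\<gamma>\<in>arrows G.
        src G \<gamma> \<in> arrows G \<and> rng G \<gamma> \<in> arrows G \<and> ginv G \<gamma> \<in> arrows G \<and>
        src G (src G \<gamma>) = src G \<gamma> \<and> rng G (src G \<gamma>) = src G \<gamma> \<and>
        src G (rng G \<gamma>) = rng G \<gamma> \<and> rng G (rng G \<gamma>) = rng G \<gamma> \<and>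
        mult G \<gamma> (src G \<gamma>) = \<gamma> \<and> mult G (rng G \<gamma>) \<gamma> = \<gamma> \<and>
        src G (ginv G \<gamma>) = rng G \<gamma> \<and> rng G (ginv G \<gamma>) = src G \<gamma> \<and>
        mult G (ginv G \<gamma>) \<gamma> = src G \<gamma> \<and> mult G \<gamma> (ginv G \<gamma>) = rng G \<gamma>) \<and>
     (\<forall>(\<alpha>, \<beta>)\<in>composable G.
        mult G \<alpha> \<beta> \<in> arrows G \<and>
        src G (mult G \<alpha> \<beta>) = src G \<beta> \<and> rng G (mult G \<alpha> \<beta>) = rng G \<alpha>) \<and>
     (\<forall>\<alpha> \<beta> \<gamma>. (\<alpha>, \<beta>) \<in> composable G \<longrightarrow> (\<beta>, \<gamma>) \<in> composable G \<longrightarrow>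
        mult G (mult G \<alpha> \<beta>) \<gamma> = mult G \<alpha> (mult G \<beta> \<gamma>))"

definition topological_groupoid :: "'g top_groupoid \<Rightarrow> bool" where
  "topological_groupoid G \<longleftrightarrow>
     algebraic_groupoid G \<and>
     continuous_map (subtopology (prod_topology (gtop G) (gtop G)) (composable G)) (gtop G)
       (\<lambda>(\<alpha>, \<beta>). mult G \<alpha> \<beta>) \<and>
     continuous_map (gtop G) (gtop G) (ginv G)"

definition local_homeomorphism :: "'a topology \<Rightarrow> 'b topology \<Rightarrow> ('a \<Rightarrow> 'b) \<Rightarrow> bool" where
  "local_homeomorphism X Y f \<longleftrightarrow>
     (\<forall>x\<in>topspace X. \<exists>U. openin X U \<and> x \<in> U \<and> openin Y (f ` U) \<and>
        homeomorphic_map (subtopology X U) (subtopology Y (f ` U)) f)"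

definition etale_groupoid :: "'g top_groupoid \<Rightarrow> bool" where
  "etale_groupoid G \<longleftrightarrow>
     topological_groupoid G \<and>
     local_homeomorphism (gtop G) (subtopology (gtop G) (units G)) (rng G) \<and>
     local_homeomorphism (gtop G) (subtopology (gtop G) (units G)) (src G)"

definition isotropy :: "'g top_groupoid \<Rightarrow> 'g set" where
  "isotropy G = {\<gamma> \<in> arrows G. rng G \<gamma> = src G \<gamma>}"

definition iso_interior :: "'g top_groupoid \<Rightarrow> 'g set" where
  "iso_interior G = gtop G interior_of isotropy G"

definition iso_groupoid :: "'g top_groupoid \<Rightarrow> 'g top_groupoid" where
  "iso_groupoid G = G\<lparr>gtop := subtopology (gtop G) (iso_interior G)\<rparr>"

definition abelian_iso_interior :: "'g top_groupoid \<Rightarrow> bool" where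
  "abelian_iso_interior G \<longleftrightarrow>
     (\<forall>u\<in>units G. \<forall>\<alpha>\<in>iso_interior G \<inter> src_fibre G u. \<forall>\<beta>\<in>iso_interior G \<inter> src_fibre G u.
        mult G \<alpha> \<beta> = mult G \<beta> \<alpha>)"

section \<open>Function spaces on a groupoid\<close>

text \<open>A function on the arrows is represented by a function on the whole type which is zero
  off the arrows, so that pointwise equality is equality.\<close>

definition Cc :: "'g top_groupoid \<Rightarrow> ('g \<Rightarrow> complex) set" where
  "Cc G = {f. continuous_map (gtop G) euclidean f \<and> (\<forall>\<gamma>. \<gamma> \<notin> arrows G \<longrightarrow> f \<gamma> = 0) \<and>
              compactin (gtop G) (gtop G closure_of {\<gamma> \<in> arrows G. f \<gamma> \<noteq> 0})}"

definition C0 :: "'g top_groupoid \<Rightarrow> ('g \<Rightarrow> complex) set" where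
  "C0 G = {f. continuous_map (gtop G) euclidean f \<and> (\<forall>\<gamma>. \<gamma> \<notin> arrows G \<longrightarrow> f \<gamma> = 0) \<and>
              (\<forall>\<epsilon>>0. compactin (gtop G) {\<gamma> \<in> arrows G. cmod (f \<gamma>) \<ge> \<epsilon>})}"

definition C0_on :: "'g top_groupoid \<Rightarrow> 'g set \<Rightarrow> ('g \<Rightarrow> complex) set" where
  "C0_on G S = {f \<in> C0 G. \<forall>\<gamma>. \<gamma> \<notin> S \<longrightarrow> f \<gamma> = 0}"

definition conv :: "'g top_groupoid \<Rightarrow> ('g \<Rightarrow> complex) \<Rightarrow> ('g \<Rightarrow> complex) \<Rightarrow> 'g \<Rightarrow> complex" where
  "conv G f g = (\<lambda>\<gamma>. \<Sum>\<^sub>\<infinity>(\<alpha>, \<beta>)\<in>{(\<alpha>, \<beta>) \<in> composable G. mult G \<alpha> \<beta> = \<gamma>}. f \<alpha> * g \<beta>)"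

definition invol :: "'g top_groupoid \<Rightarrow> ('g \<Rightarrow> complex) \<Rightarrow> 'g \<Rightarrow> complex" where
  "invol G f = (\<lambda>\<gamma>. if \<gamma> \<in> arrows G then cnj (f (ginv G \<gamma>)) else 0)"

section \<open>Regular representations and the reduced norm\<close>

definition ell2 :: "'g set \<Rightarrow> ('g \<Rightarrow> complex) set" where
  "ell2 S = {\<xi>. (\<forall>x. x \<notin> S \<longrightarrow> \<xi> x = 0) \<and> (\<lambda>x. (cmod (\<xi> x))\<^sup>2) summable_on S}"

definition ell2_norm :: "'g set \<Rightarrow> ('g \<Rightarrow> complex) \<Rightarrow> real" where
  "ell2_norm S \<xi> = sqrt (\<Sum>\<^sub>\<infinity>x\<in>S. (cmod (\<xi> x))\<^sup>2)"

definition point_mass :: "'g \<Rightarrow> 'g \<Rightarrow> complex" where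
  "point_mass \<gamma> = (\<lambda>\<beta>. if \<beta> = \<gamma> then 1 else 0)"

definition regular_rep_basis :: "'g top_groupoid \<Rightarrow> ('g \<Rightarrow> complex) \<Rightarrow> 'g \<Rightarrow> 'g \<Rightarrow> complex" where
  "regular_rep_basis G f \<gamma> =
     (\<lambda>\<beta>. \<Sum>\<^sub>\<infinity>\<alpha>\<in>src_fibre G (rng G \<gamma>). f \<alpha> * point_mass (mult G \<alpha> \<gamma>) \<beta>)"

text \<open>The operator with \<open>L\<^sup>u(f) \<delta>\<^sub>\<gamma> = regular_rep_basis G f \<gamma>\<close>, in coordinates: for \<open>f\<close> in \<open>Cc G\<close> of
  an etale groupoid, each coordinate is a finite sum.\<close>

definition regular_rep ::
  "'g top_groupoid \<Rightarrow> 'g \<Rightarrow> ('g \<Rightarrow> complex) \<Rightarrow> ('g \<Rightarrow> complex) \<Rightarrow> 'g \<Rightarrow> complex" where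
  "regular_rep G u f \<xi> = (\<lambda>\<beta>. \<Sum>\<^sub>\<infinity>\<gamma>\<in>src_fibre G u. \<xi> \<gamma> * regular_rep_basis G f \<gamma> \<beta>)"

definition regular_rep_norm :: "'g top_groupoid \<Rightarrow> 'g \<Rightarrow> ('g \<Rightarrow> complex) \<Rightarrow> real" where
  "regular_rep_norm G u f =
     (SUP \<xi>\<in>{\<xi> \<in> ell2 (src_fibre G u). ell2_norm (src_fibre G u) \<xi> \<le> 1}.
        ell2_norm (src_fibre G u) (regular_rep G u f \<xi>))"

text \<open>The inserted 0 only matters for the empty groupoid, as a real supremum of the empty set is
  unspecified.\<close>

definition reduced_norm :: "'g top_groupoid \<Rightarrow> ('g \<Rightarrow> complex) \<Rightarrow> real" where
  "reduced_norm G f = Sup (insert 0 ((\<lambda>u. regular_rep_norm G u f) ` units G))"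

section \<open>The reduced C*-algebra\<close>

text \<open>The completion of \<open>Cc G\<close> in the reduced norm: Cauchy sequences modulo null sequences,
  with operations induced by those on representatives.\<close>

type_synonym 'g cstar_elt = "(nat \<Rightarrow> 'g \<Rightarrow> complex) set"

definition cauchy_seqs :: "'g top_groupoid \<Rightarrow> (nat \<Rightarrow> 'g \<Rightarrow> complex) set" where
  "cauchy_seqs G = {X. (\<forall>n. X n \<in> Cc G) \<and>
     (\<forall>\<epsilon>>0. \<exists>N. \<forall>m\<ge>N. \<forall>n\<ge>N. reduced_norm G (\<lambda>\<gamma>. X m \<gamma> - X n \<gamma>) < \<epsilon>)}"

definition null_rel ::
  "'g top_groupoid \<Rightarrow> ((nat \<Rightarrow> 'g \<Rightarrow> complex) \<times> (nat \<Rightarrow> 'g \<Rightarrow> complex)) set" where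
  "null_rel G = {(X, Y). X \<in> cauchy_seqs G \<and> Y \<in> cauchy_seqs G \<and>
     (\<lambda>n. reduced_norm G (\<lambda>\<gamma>. X n \<gamma> - Y n \<gamma>)) \<longlonglongrightarrow> 0}"

definition Cred :: "'g top_groupoid \<Rightarrow> 'g cstar_elt set" where
  "Cred G = cauchy_seqs G // null_rel G"

definition Cred_class :: "'g top_groupoid \<Rightarrow> (nat \<Rightarrow> 'g \<Rightarrow> complex) \<Rightarrow> 'g cstar_elt" where
  "Cred_class G X = null_rel G `` {X}"

definition Cred_incl :: "'g top_groupoid \<Rightarrow> ('g \<Rightarrow> complex) \<Rightarrow> 'g cstar_elt" where
  "Cred_incl G f = Cred_class G (\<lambda>n. f)"

definition Cred_zero :: "'g top_groupoid \<Rightarrow> 'g cstar_elt" where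
  "Cred_zero G = Cred_incl G (\<lambda>\<gamma>. 0)"

definition Cred_add :: "'g top_groupoid \<Rightarrow> 'g cstar_elt \<Rightarrow> 'g cstar_elt \<Rightarrow> 'g cstar_elt" where
  "Cred_add G a b = (\<Union>X\<in>a. \<Union>Y\<in>b. Cred_class G (\<lambda>n \<gamma>. X n \<gamma> + Y n \<gamma>))"

definition Cred_scale :: "'g top_groupoid \<Rightarrow> complex \<Rightarrow> 'g cstar_elt \<Rightarrow> 'g cstar_elt" where
  "Cred_scale G c a = (\<Union>X\<in>a. Cred_class G (\<lambda>n \<gamma>. c * X n \<gamma>))"

definition Cred_mult :: "'g top_groupoid \<Rightarrow> 'g cstar_elt \<Rightarrow> 'g cstar_elt \<Rightarrow> 'g cstar_elt" where
  "Cred_mult G a b = (\<Union>X\<in>a. \<Union>Y\<in>b. Cred_class G (\<lambda>n. conv G (X n) (Y n)))"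

definition Cred_star :: "'g top_groupoid \<Rightarrow> 'g cstar_elt \<Rightarrow> 'g cstar_elt" where
  "Cred_star G a = (\<Union>X\<in>a. Cred_class G (\<lambda>n. invol G (X n)))"

definition Cred_norm :: "'g top_groupoid \<Rightarrow> 'g cstar_elt \<Rightarrow> real" where
  "Cred_norm G a = (THE l. \<exists>X\<in>a. (\<lambda>n. reduced_norm G (X n)) \<longlonglongrightarrow> l)"

definition Cred_dist :: "'g top_groupoid \<Rightarrow> 'g cstar_elt \<Rightarrow> 'g cstar_elt \<Rightarrow> real" where
  "Cred_dist G a b = Cred_norm G (Cred_add G a (Cred_scale G (- 1) b))"

section \<open>Maximal abelian subalgebras\<close>

definition Cstar_subalgebra :: "'g top_groupoid \<Rightarrow> 'g cstar_elt set \<Rightarrow> bool" where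
  "Cstar_subalgebra G B \<longleftrightarrow>
     B \<subseteq> Cred G \<and> Cred_zero G \<in> B \<and>
     (\<forall>a\<in>B. \<forall>b\<in>B. Cred_add G a b \<in> B \<and> Cred_mult G a b \<in> B) \<and>
     (\<forall>a\<in>B. Cred_star G a \<in> B \<and> (\<forall>c. Cred_scale G c a \<in> B)) \<and>
     (\<forall>a\<in>Cred G. (\<forall>\<epsilon>>0. \<exists>b\<in>B. Cred_dist G a b < \<epsilon>) \<longrightarrow> a \<in> B)"

definition abelian_Cstar_subalgebra :: "'g top_groupoid \<Rightarrow> 'g cstar_elt set \<Rightarrow> bool" where
  "abelian_Cstar_subalgebra G B \<longleftrightarrow>
     Cstar_subalgebra G B \<and> (\<forall>a\<in>B. \<forall>b\<in>B. Cred_mult G a b = Cred_mult G b a)"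

definition maximal_abelian :: "'g top_groupoid \<Rightarrow> 'g cstar_elt set \<Rightarrow> bool" where
  "maximal_abelian G M \<longleftrightarrow>
     abelian_Cstar_subalgebra G M \<and>
     (\<forall>B. abelian_Cstar_subalgebra G B \<and> M \<subseteq> B \<longrightarrow> B = M)"

section \<open>The subalgebra of the interior of the isotropy\<close>

definition extend_by_zero :: "'g set \<Rightarrow> ('g \<Rightarrow> complex) \<Rightarrow> 'g \<Rightarrow> complex" where
  "extend_by_zero S f = (\<lambda>\<gamma>. if \<gamma> \<in> S then f \<gamma> else 0)"

text \<open>The map between the completions induced by extension by zero, which is isometric for the
  reduced norms.\<close>

definition iota_r :: "'g top_groupoid \<Rightarrow> 'g cstar_elt \<Rightarrow> 'g cstar_elt" where
  "iota_r G a = (\<Union>X\<in>a. Cred_class G (\<lambda>n. extend_by_zero (iso_interior G) (X n)))"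

definition M_r :: "'g top_groupoid \<Rightarrow> 'g cstar_elt set" where
  "M_r G = iota_r G ` Cred (iso_groupoid G)"

end

theory Submission
  imports Defs
begin

text \<open>Let \<open>A\<close> be the set of \<open>a\<close> with \<open>j a\<close> vanishing off the interior of the isotropy. It contains \<open>M\<^sub>r\<close>, and it is
  itself an abelian C*-subalgebra: \<open>j (a * b)\<close> at an arrow \<open>\<gamma>\<close> is the inner product of a row of \<open>j a\<close> and a
  column of \<open>j b\<close>, both square-summable, so only factorisations of \<open>\<gamma>\<close> inside the interior of the isotropy
  contribute, and there the fibres are commutative. Hence \<open>A = M\<^sub>r\<close> if \<open>M\<^sub>r\<close> is maximal abelian. Conversely an
  element commuting with \<open>M\<^sub>r\<close> commutes with the functions on the unit space; testing this on a function that
  separates \<open>rng \<gamma>\<close> from \<open>src \<gamma>\<close> gives \<open>j a \<gamma> = 0\<close> off the isotropy, and then off its interior because \<open>j a\<close> is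
  continuous. So the commutant of \<open>M\<^sub>r\<close> lies in \<open>A\<close>.

  The reduced norm of \<open>f\<close> is the supremum of the norms of the finite submatrices of the kernels
  \<open>(\<beta>, \<gamma>) \<mapsto> f (\<beta> \<gamma>\<^sup>-\<^sup>1)\<close> on the source fibres, which keeps all sums finite.\<close>

section \<open>Infinite matrices and their operator norms\<close>

text \<open>An element of \<open>Cred G\<close> is only a class of Cauchy sequences, and
  \<open>j\<close> is known only through its properties. \<open>j_lim\<close> removes both
  abstractions: \<open>j a\<close> is the pointwise limit of every representative of
  \<open>a\<close>, and since \<open>j\<close> is injective an identity in \<open>Cred G\<close> can
  be checked on such limits. The obstacle is multiplication: pointwise convergence of
  \<open>X n\<close> and \<open>Y n\<close> says nothing about sums of products whose index sets
  grow with \<open>n\<close>. Convergence in norm does, because it controls every row and column in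
  the square-summable sense with a bound that does not depend on the finite index set.
  Cauchy-Schwarz then makes the difference between the convolution and the truncated sum
  \<open>iso_conv\<close> tend to zero. A second obstacle is that \<open>M_r G\<close> has to be
  shown closed. Extension by zero is isometric (\<open>reduced_norm_Iso\<close>, by a coset
  decomposition of the source fibres), so the elements of \<open>M_r G\<close> are exactly the
  classes of Cauchy sequences with terms in \<open>Cc (iso_groupoid G)\<close>, and a diagonal
  choice of approximants stays inside this description.\<close>

definition mat_bounded :: "'a set \<Rightarrow> ('a \<Rightarrow> 'a \<Rightarrow> complex) \<Rightarrow> real \<Rightarrow> bool" where
  "mat_bounded S K c \<longleftrightarrow>
     (\<forall>F T \<xi>. finite F \<longrightarrow> F \<subseteq> S \<longrightarrow> finite T \<longrightarrow> T \<subseteq> S \<longrightarrow>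
        L2_set (\<lambda>\<beta>. cmod (\<Sum>\<gamma>\<in>T. K \<beta> \<gamma> * \<xi> \<gamma>)) F \<le> c * L2_set (\<lambda>\<gamma>. cmod (\<xi> \<gamma>)) T)"

lemma mat_boundedD:
  assumes "mat_bounded S K c" "finite F" "F \<subseteq> S" "finite T" "T \<subseteq> S"
  shows "L2_set (\<lambda>\<beta>. cmod (\<Sum>\<gamma>\<in>T. K \<beta> \<gamma> * \<xi> \<gamma>)) F \<le> c * L2_set (\<lambda>\<gamma>. cmod (\<xi> \<gamma>)) T"
  using assms unfolding mat_bounded_def by blast

lemma mat_bounded_cong:
  assumes "mat_bounded S K c" "\<And>\<beta> \<gamma>. \<beta> \<in> S \<Longrightarrow> \<gamma> \<in> S \<Longrightarrow> K \<beta> \<gamma> = K' \<beta> \<gamma>"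
  shows "mat_bounded S K' c"
  unfolding mat_bounded_def
proof (intro allI impI)
  fix F T :: "'a set" and \<xi> :: "'a \<Rightarrow> complex"
  assume *: "finite F" "F \<subseteq> S" "finite T" "T \<subseteq> S"
  have "L2_set (\<lambda>\<beta>. cmod (\<Sum>\<gamma>\<in>T. K' \<beta> \<gamma> * \<xi> \<gamma>)) F = L2_set (\<lambda>\<beta>. cmod (\<Sum>\<gamma>\<in>T. K \<beta> \<gamma> * \<xi> \<gamma>)) F"
    using * by (intro L2_set_cong refl arg_cong[where f=cmod] sum.cong) (auto simp: assms(2) subset_iff)
  then show "L2_set (\<lambda>\<beta>. cmod (\<Sum>\<gamma>\<in>T. K' \<beta> \<gamma> * \<xi> \<gamma>)) F \<le> c * L2_set (\<lambda>\<gamma>. cmod (\<xi> \<gamma>)) T"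
    using mat_boundedD[OF assms(1) *] by simp
qed

lemma mat_bounded_add:
  assumes "mat_bounded S K c" "mat_bounded S L d"
  shows "mat_bounded S (\<lambda>\<beta> \<gamma>. K \<beta> \<gamma> + L \<beta> \<gamma>) (c + d)"
  unfolding mat_bounded_def
proof (intro allI impI)
  fix F T :: "'a set" and \<xi> :: "'a \<Rightarrow> complex"
  assume *: "finite F" "F \<subseteq> S" "finite T" "T \<subseteq> S"
  have "L2_set (\<lambda>\<beta>. cmod (\<Sum>\<gamma>\<in>T. (K \<beta> \<gamma> + L \<beta> \<gamma>) * \<xi> \<gamma>)) F
     \<le> L2_set (\<lambda>\<beta>. cmod (\<Sum>\<gamma>\<in>T. K \<beta> \<gamma> * \<xi> \<gamma>) + cmod (\<Sum>\<gamma>\<in>T. L \<beta> \<gamma> * \<xi> \<gamma>)) F"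
    by (intro L2_set_mono) (auto simp: distrib_right sum.distrib norm_triangle_ineq)
  also have "\<dots> \<le> L2_set (\<lambda>\<beta>. cmod (\<Sum>\<gamma>\<in>T. K \<beta> \<gamma> * \<xi> \<gamma>)) F + L2_set (\<lambda>\<beta>. cmod (\<Sum>\<gamma>\<in>T. L \<beta> \<gamma> * \<xi> \<gamma>)) F"
    by (rule L2_set_triangle_ineq)
  also have "\<dots> \<le> (c + d) * L2_set (\<lambda>\<gamma>. cmod (\<xi> \<gamma>)) T"
    using mat_boundedD[OF assms(1) *, of \<xi>] mat_boundedD[OF assms(2) *, of \<xi>]
    by (simp add: distrib_right)
  finally show "L2_set (\<lambda>\<beta>. cmod (\<Sum>\<gamma>\<in>T. (K \<beta> \<gamma> + L \<beta> \<gamma>) * \<xi> \<gamma>)) F \<le> (c + d) * L2_set (\<lambda>\<gamma>. cmod (\<xi> \<gamma>)) T" .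
qed

lemma mat_bounded_scale:
  assumes "mat_bounded S K c"
  shows "mat_bounded S (\<lambda>\<beta> \<gamma>. a * K \<beta> \<gamma>) (cmod a * c)"
  unfolding mat_bounded_def
proof (intro allI impI)
  fix F T :: "'a set" and \<xi> :: "'a \<Rightarrow> complex"
  assume *: "finite F" "F \<subseteq> S" "finite T" "T \<subseteq> S"
  have "L2_set (\<lambda>\<beta>. cmod (\<Sum>\<gamma>\<in>T. a * K \<beta> \<gamma> * \<xi> \<gamma>)) F = cmod a * L2_set (\<lambda>\<beta>. cmod (\<Sum>\<gamma>\<in>T. K \<beta> \<gamma> * \<xi> \<gamma>)) F"
    by (simp add: L2_set_right_distrib mult.assoc norm_mult flip: sum_distrib_left)
  then show "L2_set (\<lambda>\<beta>. cmod (\<Sum>\<gamma>\<in>T. a * K \<beta> \<gamma> * \<xi> \<gamma>)) F \<le> cmod a * c * L2_set (\<lambda>\<gamma>. cmod (\<xi> \<gamma>)) T"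
    using mat_boundedD[OF assms *, of \<xi>] by (simp add: mult.assoc mult_left_mono)
qed

lemma cmod_sum_mult_le_L2:
  "cmod (\<Sum>i\<in>A. f i * g i) \<le> L2_set (\<lambda>i. cmod (f i)) A * L2_set (\<lambda>i. cmod (g i)) A"
proof -
  have "cmod (\<Sum>i\<in>A. f i * g i) \<le> (\<Sum>i\<in>A. cmod (f i * g i))" by (rule norm_sum)
  also have "\<dots> = (\<Sum>i\<in>A. \<bar>cmod (f i)\<bar> * \<bar>cmod (g i)\<bar>)" by (simp add: norm_mult)
  also have "\<dots> \<le> L2_set (\<lambda>i. cmod (f i)) A * L2_set (\<lambda>i. cmod (g i)) A"
    by (rule L2_set_mult_ineq)
  finally show ?thesis .
qed

text \<open>With \<eta> the image of \<xi> under the adjoint, the square of the norm of \<eta> is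
  the pairing of \<xi> with the image of \<eta> under \<open>K\<close>. By Cauchy-Schwarz this is at
  most \<open>c\<close> times the product of the two norms; divide by the norm of \<eta>.\<close>

lemma mat_bounded_adjoint:
  assumes "mat_bounded S K c"
  shows "mat_bounded S (\<lambda>\<beta> \<gamma>. cnj (K \<gamma> \<beta>)) c"
  unfolding mat_bounded_def
proof (intro allI impI)
  fix F T :: "'a set" and \<xi> :: "'a \<Rightarrow> complex"
  assume *: "finite F" "F \<subseteq> S" "finite T" "T \<subseteq> S"
  define \<eta> where "\<eta> = (\<lambda>\<beta>. \<Sum>\<gamma>\<in>T. cnj (K \<gamma> \<beta>) * \<xi> \<gamma>)"
  define A where "A = L2_set (\<lambda>\<beta>. cmod (\<eta> \<beta>)) F"
  have A0: "0 \<le> A" by (simp add: A_def)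
  have expand: "cnj (\<eta> \<beta>) * \<eta> \<beta> = (\<Sum>\<gamma>\<in>T. cnj (K \<gamma> \<beta> * \<eta> \<beta>) * \<xi> \<gamma>)" for \<beta>
    by (subst (2) \<eta>_def) (simp add: sum_distrib_left mult_ac)
  have "complex_of_real (A^2) = (\<Sum>\<beta>\<in>F. cnj (\<eta> \<beta>) * \<eta> \<beta>)"
    by (simp add: A_def L2_set_def sum_nonneg complex_norm_square mult.commute del: of_real_power)
  also have "\<dots> = (\<Sum>\<beta>\<in>F. \<Sum>\<gamma>\<in>T. cnj (K \<gamma> \<beta> * \<eta> \<beta>) * \<xi> \<gamma>)"
    by (simp only: expand)
  also have "\<dots> = (\<Sum>\<gamma>\<in>T. (\<Sum>\<beta>\<in>F. cnj (K \<gamma> \<beta> * \<eta> \<beta>)) * \<xi> \<gamma>)"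
    by (subst sum.swap) (simp add: sum_distrib_right)
  also have "\<dots> = (\<Sum>\<gamma>\<in>T. cnj (\<Sum>\<beta>\<in>F. K \<gamma> \<beta> * \<eta> \<beta>) * \<xi> \<gamma>)"
    by simp
  finally have "A^2 = cmod (\<Sum>\<gamma>\<in>T. cnj (\<Sum>\<beta>\<in>F. K \<gamma> \<beta> * \<eta> \<beta>) * \<xi> \<gamma>)"
    by (metis abs_of_nonneg norm_of_real zero_le_power2)
  also have "\<dots> \<le> L2_set (\<lambda>\<gamma>. cmod (cnj (\<Sum>\<beta>\<in>F. K \<gamma> \<beta> * \<eta> \<beta>))) T * L2_set (\<lambda>\<gamma>. cmod (\<xi> \<gamma>)) T"
    by (rule cmod_sum_mult_le_L2)
  also have "\<dots> \<le> (c * A) * L2_set (\<lambda>\<gamma>. cmod (\<xi> \<gamma>)) T"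
    using mat_boundedD[OF assms *(3,4,1,2), of \<eta>] unfolding A_def complex_mod_cnj
    by (intro mult_right_mono) auto
  finally have *: "A * A \<le> A * (c * L2_set (\<lambda>\<gamma>. cmod (\<xi> \<gamma>)) T)"
    by (simp add: power2_eq_square mult_ac)
  have "A \<le> c * L2_set (\<lambda>\<gamma>. cmod (\<xi> \<gamma>)) T"
  proof (cases "A = 0")
    case False
    then show ?thesis using * A0 by (metis mult_le_cancel_left_pos order_le_less)
  next
    case True
    \<comment> \<open>Division by \<open>A\<close> is impossible here. The sign of the right-hand
      side comes from the bound itself, as \<open>c\<close> is not assumed nonnegative.\<close>
    have "0 \<le> c * L2_set (\<lambda>\<gamma>. cmod (\<xi> \<gamma>)) T"
      using mat_boundedD[OF assms, of T T \<xi>] \<open>finite T\<close> \<open>T \<subseteq> S\<close>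
      by (meson L2_set_nonneg order_trans)
    with True show ?thesis by simp
  qed
  then show "L2_set (\<lambda>\<beta>. cmod (\<Sum>\<gamma>\<in>T. cnj (K \<gamma> \<beta>) * \<xi> \<gamma>)) F \<le> c * L2_set (\<lambda>\<gamma>. cmod (\<xi> \<gamma>)) T"
    by (simp add: A_def \<eta>_def)
qed

text \<open>The hypothesis \<open>fin\<close> says that \<open>M\<close> is the product of
  \<open>K\<close> and \<open>L\<close>, with one finite set of intermediate indices that serves all
  columns in \<open>T\<close> and all rows at once. The two finite bounds can then be composed
  through \<open>D\<close>.\<close>

lemma mat_bounded_mult:
  assumes K: "mat_bounded S K c" and L: "mat_bounded S L d" and "0 \<le> c"
    and fin: "\<And>T. finite T \<Longrightarrow> T \<subseteq> S \<Longrightarrow>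
      \<exists>D. finite D \<and> D \<subseteq> S \<and> (\<forall>\<beta>\<in>S. \<forall>\<gamma>\<in>T. M \<beta> \<gamma> = (\<Sum>\<delta>\<in>D. K \<beta> \<delta> * L \<delta> \<gamma>))"
  shows "mat_bounded S M (c * d)"
  unfolding mat_bounded_def
proof (intro allI impI)
  fix F T :: "'a set" and \<xi> :: "'a \<Rightarrow> complex"
  assume *: "finite F" "F \<subseteq> S" "finite T" "T \<subseteq> S"
  obtain D where D: "finite D" "D \<subseteq> S" "\<forall>\<beta>\<in>S. \<forall>\<gamma>\<in>T. M \<beta> \<gamma> = (\<Sum>\<delta>\<in>D. K \<beta> \<delta> * L \<delta> \<gamma>)"
    using fin * by meson
  define \<eta> where "\<eta> = (\<lambda>\<delta>. \<Sum>\<gamma>\<in>T. L \<delta> \<gamma> * \<xi> \<gamma>)"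
  have "(\<Sum>\<gamma>\<in>T. M \<beta> \<gamma> * \<xi> \<gamma>) = (\<Sum>\<delta>\<in>D. K \<beta> \<delta> * \<eta> \<delta>)" if "\<beta> \<in> F" for \<beta>
  proof -
    have "(\<Sum>\<gamma>\<in>T. M \<beta> \<gamma> * \<xi> \<gamma>) = (\<Sum>\<gamma>\<in>T. \<Sum>\<delta>\<in>D. K \<beta> \<delta> * L \<delta> \<gamma> * \<xi> \<gamma>)"
      using that * D(3) by (intro sum.cong) (auto simp: sum_distrib_right)
    also have "\<dots> = (\<Sum>\<delta>\<in>D. K \<beta> \<delta> * \<eta> \<delta>)"
      by (subst sum.swap) (simp add: \<eta>_def sum_distrib_left mult.assoc)
    finally show ?thesis .
  qed
  then have "L2_set (\<lambda>\<beta>. cmod (\<Sum>\<gamma>\<in>T. M \<beta> \<gamma> * \<xi> \<gamma>)) F = L2_set (\<lambda>\<beta>. cmod (\<Sum>\<delta>\<in>D. K \<beta> \<delta> * \<eta> \<delta>)) F"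
    by (intro L2_set_cong) auto
  also have "\<dots> \<le> c * L2_set (\<lambda>\<delta>. cmod (\<eta> \<delta>)) D"
    by (rule mat_boundedD[OF K *(1,2) D(1,2)])
  also have "\<dots> \<le> c * (d * L2_set (\<lambda>\<gamma>. cmod (\<xi> \<gamma>)) T)"
    unfolding \<eta>_def by (intro mult_left_mono mat_boundedD[OF L D(1,2) *(3,4)] \<open>0 \<le> c\<close>)
  finally show "L2_set (\<lambda>\<beta>. cmod (\<Sum>\<gamma>\<in>T. M \<beta> \<gamma> * \<xi> \<gamma>)) F \<le> c * d * L2_set (\<lambda>\<gamma>. cmod (\<xi> \<gamma>)) T"
    by (simp add: mult.assoc)
qed

text \<open>The Schur test with constant weights and the same bound for rows and columns:
  Cauchy-Schwarz in each row uses the row sums, and exchanging the two sums uses the column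
  sums.\<close>

lemma mat_bounded_Schur:
  assumes rows: "\<And>\<beta> T. \<beta> \<in> S \<Longrightarrow> finite T \<Longrightarrow> T \<subseteq> S \<Longrightarrow> (\<Sum>\<gamma>\<in>T. cmod (K \<beta> \<gamma>)) \<le> a"
    and cols: "\<And>\<gamma> F. \<gamma> \<in> S \<Longrightarrow> finite F \<Longrightarrow> F \<subseteq> S \<Longrightarrow> (\<Sum>\<beta>\<in>F. cmod (K \<beta> \<gamma>)) \<le> a"
    and "0 \<le> a"
  shows "mat_bounded S K a"
  unfolding mat_bounded_def
proof (intro allI impI)
  fix F T :: "'a set" and \<xi> :: "'a \<Rightarrow> complex"
  assume *: "finite F" "F \<subseteq> S" "finite T" "T \<subseteq> S"
  have row: "(cmod (\<Sum>\<gamma>\<in>T. K \<beta> \<gamma> * \<xi> \<gamma>))\<^sup>2 \<le> a * (\<Sum>\<gamma>\<in>T. cmod (K \<beta> \<gamma>) * (cmod (\<xi> \<gamma>))\<^sup>2)" if "\<beta> \<in> F" for \<beta>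
  proof -
    have "cmod (\<Sum>\<gamma>\<in>T. K \<beta> \<gamma> * \<xi> \<gamma>) \<le> (\<Sum>\<gamma>\<in>T. cmod (K \<beta> \<gamma>) * cmod (\<xi> \<gamma>))"
      by (rule order_trans[OF norm_sum]) (simp add: norm_mult)
    \<comment> \<open>Each modulus is split into two square roots, so that one factor of
      Cauchy-Schwarz sees only the row of \<open>K\<close>.\<close>
    also have "\<dots> = (\<Sum>\<gamma>\<in>T. \<bar>sqrt (cmod (K \<beta> \<gamma>))\<bar> * \<bar>sqrt (cmod (K \<beta> \<gamma>)) * cmod (\<xi> \<gamma>)\<bar>)"
      by (intro sum.cong) (auto simp: abs_mult simp flip: mult.assoc)
    also have "\<dots> \<le> L2_set (\<lambda>\<gamma>. sqrt (cmod (K \<beta> \<gamma>))) T * L2_set (\<lambda>\<gamma>. sqrt (cmod (K \<beta> \<gamma>)) * cmod (\<xi> \<gamma>)) T"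
      by (rule L2_set_mult_ineq)
    also have "\<dots> = sqrt ((\<Sum>\<gamma>\<in>T. cmod (K \<beta> \<gamma>)) * (\<Sum>\<gamma>\<in>T. cmod (K \<beta> \<gamma>) * (cmod (\<xi> \<gamma>))\<^sup>2))"
      by (simp add: L2_set_def power_mult_distrib real_sqrt_mult)
    finally have "(cmod (\<Sum>\<gamma>\<in>T. K \<beta> \<gamma> * \<xi> \<gamma>))\<^sup>2 \<le> (\<Sum>\<gamma>\<in>T. cmod (K \<beta> \<gamma>)) * (\<Sum>\<gamma>\<in>T. cmod (K \<beta> \<gamma>) * (cmod (\<xi> \<gamma>))\<^sup>2)"
      by (metis norm_ge_zero real_sqrt_le_iff real_sqrt_pow2_iff real_sqrt_unique sqrt_le_D)
    also have "\<dots> \<le> a * (\<Sum>\<gamma>\<in>T. cmod (K \<beta> \<gamma>) * (cmod (\<xi> \<gamma>))\<^sup>2)"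
      using that * by (intro mult_right_mono rows) (auto intro!: sum_nonneg)
    finally show ?thesis .
  qed
  have "(\<Sum>\<beta>\<in>F. (cmod (\<Sum>\<gamma>\<in>T. K \<beta> \<gamma> * \<xi> \<gamma>))\<^sup>2) \<le> (\<Sum>\<beta>\<in>F. a * (\<Sum>\<gamma>\<in>T. cmod (K \<beta> \<gamma>) * (cmod (\<xi> \<gamma>))\<^sup>2))"
    by (intro sum_mono row)
  also have "\<dots> = a * (\<Sum>\<gamma>\<in>T. (\<Sum>\<beta>\<in>F. cmod (K \<beta> \<gamma>)) * (cmod (\<xi> \<gamma>))\<^sup>2)"
    unfolding sum_distrib_left[symmetric] by (subst sum.swap) (simp add: sum_distrib_right)
  also have "\<dots> \<le> a * (\<Sum>\<gamma>\<in>T. a * (cmod (\<xi> \<gamma>))\<^sup>2)"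
    using * \<open>0 \<le> a\<close> by (intro mult_left_mono sum_mono mult_right_mono cols) auto
  also have "\<dots> = a\<^sup>2 * (\<Sum>\<gamma>\<in>T. (cmod (\<xi> \<gamma>))\<^sup>2)"
    by (simp add: sum_distrib_left power2_eq_square mult_ac)
  finally have "sqrt (\<Sum>\<beta>\<in>F. (cmod (\<Sum>\<gamma>\<in>T. K \<beta> \<gamma> * \<xi> \<gamma>))\<^sup>2) \<le> sqrt (a\<^sup>2 * (\<Sum>\<gamma>\<in>T. (cmod (\<xi> \<gamma>))\<^sup>2))"
    by (rule real_sqrt_le_mono)
  then show "L2_set (\<lambda>\<beta>. cmod (\<Sum>\<gamma>\<in>T. K \<beta> \<gamma> * \<xi> \<gamma>)) F \<le> a * L2_set (\<lambda>\<gamma>. cmod (\<xi> \<gamma>)) T"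
    using \<open>0 \<le> a\<close> by (simp add: L2_set_def real_sqrt_mult)
qed

text \<open>The test vector is a point mass. Together with the adjoint this turns a norm bound into
  square-summability of all columns and rows.\<close>

lemma mat_bounded_column:
  assumes "mat_bounded S K c" "\<gamma> \<in> S" "finite F" "F \<subseteq> S"
  shows "L2_set (\<lambda>\<beta>. cmod (K \<beta> \<gamma>)) F \<le> c"
  using mat_boundedD[OF assms(1,3,4), of "{\<gamma>}" "\<lambda>_. 1"] assms(2) by simp

lemma mat_bounded_row:
  assumes "mat_bounded S K c" "\<beta> \<in> S" "finite F" "F \<subseteq> S"
  shows "L2_set (\<lambda>\<gamma>. cmod (K \<beta> \<gamma>)) F \<le> c"
  using mat_bounded_column[OF mat_bounded_adjoint[OF assms(1)] assms(2-4)] by simp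

subsection \<open>Action on square-summable functions\<close>

lemma ell2_of_finite_bound:
  assumes "\<And>x. x \<notin> S \<Longrightarrow> \<eta> x = 0"
    and "\<And>F. finite F \<Longrightarrow> F \<subseteq> S \<Longrightarrow> L2_set (\<lambda>x. cmod (\<eta> x)) F \<le> c"
  shows "\<eta> \<in> ell2 S" "ell2_norm S \<eta> \<le> c"
proof -
  have c: "0 \<le> c" using assms(2)[of "{}"] by simp
  have fin: "(\<Sum>x\<in>F. (cmod (\<eta> x))\<^sup>2) \<le> c\<^sup>2" if "finite F" "F \<subseteq> S" for F
    using assms(2)[OF that] c by (simp add: L2_set_def sqrt_le_D)
  have s: "(\<lambda>x. (cmod (\<eta> x))\<^sup>2) summable_on S"
    by (rule nonneg_bdd_above_summable_on) (auto intro!: bdd_aboveI2[where M="c\<^sup>2"] fin)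
  then show "\<eta> \<in> ell2 S" using assms(1) by (auto simp: ell2_def)
  have "(\<Sum>\<^sub>\<infinity>x\<in>S. (cmod (\<eta> x))\<^sup>2) \<le> c\<^sup>2"
    by (rule infsum_le_finite_sums[OF s fin])
  then show "ell2_norm S \<eta> \<le> c" unfolding ell2_norm_def
    using c by (intro real_le_lsqrt) auto
qed

lemma L2_set_le_ell2_norm:
  assumes "\<xi> \<in> ell2 S" "finite F" "F \<subseteq> S"
  shows "L2_set (\<lambda>x. cmod (\<xi> x)) F \<le> ell2_norm S \<xi>"
  using assms unfolding L2_set_def ell2_norm_def ell2_def
  by (intro real_sqrt_le_mono finite_sum_le_infsum) auto

lemma ell2_finite_support:
  assumes "finite T" "T \<subseteq> S" "\<And>x. x \<notin> T \<Longrightarrow> \<xi> x = 0"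
  shows "\<xi> \<in> ell2 S" "ell2_norm S \<xi> = L2_set (\<lambda>x. cmod (\<xi> x)) T"
proof -
  have "(\<lambda>x. (cmod (\<xi> x))\<^sup>2) summable_on S"
    using assms summable_on_cong_neutral[of S T "\<lambda>x. (cmod (\<xi> x))\<^sup>2" "\<lambda>x. (cmod (\<xi> x))\<^sup>2"]
    by auto
  then show "\<xi> \<in> ell2 S" using assms by (auto simp: ell2_def)
  have "(\<Sum>\<^sub>\<infinity>x\<in>S. (cmod (\<xi> x))\<^sup>2) = (\<Sum>\<^sub>\<infinity>x\<in>T. (cmod (\<xi> x))\<^sup>2)"
    using assms by (intro infsum_cong_neutral) auto
  then show "ell2_norm S \<xi> = L2_set (\<lambda>x. cmod (\<xi> x)) T"
    using assms(1) by (simp add: ell2_norm_def L2_set_def)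
qed

lemma infsum_finite_support:
  assumes "finite T" "T \<subseteq> S" "\<And>x. x \<in> S - T \<Longrightarrow> f x = 0"
  shows "infsum f S = sum f T"
proof -
  have "infsum f S = infsum f T" using assms by (intro infsum_cong_neutral) auto
  then show ?thesis using assms(1) by simp
qed

text \<open>The value off \<open>S\<close> is set to zero so that \<open>regular_rep_eq\<close> is
  an equality of functions on the whole type.\<close>

definition mat_apply :: "'a set \<Rightarrow> ('a \<Rightarrow> 'a \<Rightarrow> complex) \<Rightarrow> ('a \<Rightarrow> complex) \<Rightarrow> 'a \<Rightarrow> complex" where
  "mat_apply S K \<xi> = (\<lambda>\<beta>. if \<beta> \<in> S then \<Sum>\<^sub>\<infinity>\<gamma>\<in>S. K \<beta> \<gamma> * \<xi> \<gamma> else 0)"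

text \<open>Rows of finite support mean that finitely many output coordinates depend on finitely
  many input coordinates, so the bound for finite submatrices applies without any limit
  argument.\<close>

lemma mat_bounded_imp_apply:
  assumes K: "mat_bounded S K c" and "0 \<le> c" and \<xi>: "\<xi> \<in> ell2 S"
    and rows: "\<And>\<beta>. \<beta> \<in> S \<Longrightarrow> finite {\<gamma> \<in> S. K \<beta> \<gamma> \<noteq> 0}"
  shows "mat_apply S K \<xi> \<in> ell2 S" "ell2_norm S (mat_apply S K \<xi>) \<le> c * ell2_norm S \<xi>"
proof -
  have "L2_set (\<lambda>\<beta>. cmod (mat_apply S K \<xi> \<beta>)) F \<le> c * ell2_norm S \<xi>" if F: "finite F" "F \<subseteq> S" for F
  proof -
    define T where "T = (\<Union>\<beta>\<in>F. {\<gamma> \<in> S. K \<beta> \<gamma> \<noteq> 0})"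
    have T: "finite T" "T \<subseteq> S" using F rows by (auto simp: T_def)
    have "mat_apply S K \<xi> \<beta> = (\<Sum>\<gamma>\<in>T. K \<beta> \<gamma> * \<xi> \<gamma>)" if "\<beta> \<in> F" for \<beta>
      using that F T unfolding mat_apply_def
      by (auto intro!: infsum_finite_support simp: T_def)
    then have "L2_set (\<lambda>\<beta>. cmod (mat_apply S K \<xi> \<beta>)) F = L2_set (\<lambda>\<beta>. cmod (\<Sum>\<gamma>\<in>T. K \<beta> \<gamma> * \<xi> \<gamma>)) F"
      by (intro L2_set_cong) auto
    also have "\<dots> \<le> c * L2_set (\<lambda>\<gamma>. cmod (\<xi> \<gamma>)) T"
      by (rule mat_boundedD[OF K F T])
    also have "\<dots> \<le> c * ell2_norm S \<xi>"
      by (intro mult_left_mono L2_set_le_ell2_norm \<xi> T \<open>0 \<le> c\<close>)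
    finally show ?thesis .
  qed
  note bound = this
  have zero: "mat_apply S K \<xi> \<beta> = 0" if "\<beta> \<notin> S" for \<beta>
    using that by (simp add: mat_apply_def)
  show "mat_apply S K \<xi> \<in> ell2 S" "ell2_norm S (mat_apply S K \<xi>) \<le> c * ell2_norm S \<xi>"
    by (rule ell2_of_finite_bound[OF zero bound]; assumption)+
qed

text \<open>The hypothesis concerns the unit ball only, because \<open>regular_rep_norm\<close> is a
  supremum over it; homogeneity gives the rest.\<close>

lemma mat_bounded_of_apply:
  assumes unit_ball: "\<And>\<xi>. \<xi> \<in> ell2 S \<Longrightarrow> ell2_norm S \<xi> \<le> 1 \<Longrightarrow>
      mat_apply S K \<xi> \<in> ell2 S \<and> ell2_norm S (mat_apply S K \<xi>) \<le> c"
  shows "mat_bounded S K c"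
  unfolding mat_bounded_def
proof (intro allI impI)
  fix F T :: "'a set" and \<xi> :: "'a \<Rightarrow> complex"
  assume *: "finite F" "F \<subseteq> S" "finite T" "T \<subseteq> S"
  define n where "n = L2_set (\<lambda>\<gamma>. cmod (\<xi> \<gamma>)) T"
  show "L2_set (\<lambda>\<beta>. cmod (\<Sum>\<gamma>\<in>T. K \<beta> \<gamma> * \<xi> \<gamma>)) F \<le> c * L2_set (\<lambda>\<gamma>. cmod (\<xi> \<gamma>)) T"
  proof (cases "n = 0")
    case True
    then have "\<forall>\<gamma>\<in>T. \<xi> \<gamma> = 0" using *(3) by (simp add: n_def L2_set_eq_0_iff)
    then show ?thesis using True by (simp add: n_def L2_set_0')
  next
    case False
    then have n: "n > 0" by (simp add: n_def less_le)
    \<comment> \<open>The restriction of \<xi> to \<open>T\<close>, normalised to length 1.\<close>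
    define \<zeta> where "\<zeta> = (\<lambda>\<gamma>. if \<gamma> \<in> T then \<xi> \<gamma> / n else 0)"
    have "L2_set (\<lambda>x. cmod (\<zeta> x)) T = L2_set (\<lambda>\<gamma>. cmod (\<xi> \<gamma>) * (1 / n)) T"
      using n by (intro L2_set_cong) (auto simp: \<zeta>_def norm_divide)
    also have "\<dots> = n * (1 / n)" unfolding n_def by (subst L2_set_left_distrib) auto
    finally have L: "L2_set (\<lambda>x. cmod (\<zeta> x)) T = 1" using n by simp
    have \<zeta>: "\<zeta> \<in> ell2 S" "ell2_norm S \<zeta> = 1"
      using ell2_finite_support[OF *(3,4), of \<zeta>] L by (auto simp: \<zeta>_def)
    have "L2_set (\<lambda>\<beta>. cmod (mat_apply S K \<zeta> \<beta>)) F \<le> c"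
      using unit_ball[of \<zeta>] \<zeta> L2_set_le_ell2_norm[of "mat_apply S K \<zeta>" S F] * by fastforce
    moreover have "mat_apply S K \<zeta> \<beta> = (\<Sum>\<gamma>\<in>T. K \<beta> \<gamma> * \<xi> \<gamma>) / n" if "\<beta> \<in> F" for \<beta>
    proof -
      have "mat_apply S K \<zeta> \<beta> = (\<Sum>\<gamma>\<in>T. K \<beta> \<gamma> * \<zeta> \<gamma>)"
        using that * infsum_finite_support[OF *(3,4), of "\<lambda>\<gamma>. K \<beta> \<gamma> * \<zeta> \<gamma>"]
        by (auto simp: mat_apply_def \<zeta>_def)
      then show ?thesis by (simp add: \<zeta>_def sum_divide_distrib)
    qed
    then have "L2_set (\<lambda>\<beta>. cmod (mat_apply S K \<zeta> \<beta>)) F = L2_set (\<lambda>\<beta>. cmod (\<Sum>\<gamma>\<in>T. K \<beta> \<gamma> * \<xi> \<gamma>) * (1 / n)) F"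
      using n by (intro L2_set_cong) (auto simp: norm_divide)
    then have "L2_set (\<lambda>\<beta>. cmod (mat_apply S K \<zeta> \<beta>)) F = L2_set (\<lambda>\<beta>. cmod (\<Sum>\<gamma>\<in>T. K \<beta> \<gamma> * \<xi> \<gamma>)) F / n"
      using n L2_set_left_distrib[of "1 / n" "\<lambda>\<beta>. cmod (\<Sum>\<gamma>\<in>T. K \<beta> \<gamma> * \<xi> \<gamma>)" F] by simp
    ultimately show ?thesis using n by (simp add: n_def divide_le_eq)
  qed
qed

section \<open>Algebra of groupoids\<close>

abbreviation dv :: "'g top_groupoid \<Rightarrow> 'g \<Rightarrow> 'g \<Rightarrow> 'g" where
  "dv G \<beta> \<gamma> \<equiv> mult G \<beta> (ginv G \<gamma>)"

text \<open>On the source fibre over \<open>u\<close> this is the matrix of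
  \<open>L\<^sup>u(f)\<close> in the basis of point masses. The formula does not mention
  \<open>u\<close>, so one function serves all fibres.\<close>

definition kern :: "'g top_groupoid \<Rightarrow> ('g \<Rightarrow> complex) \<Rightarrow> 'g \<Rightarrow> 'g \<Rightarrow> complex" where
  "kern G f = (\<lambda>\<beta> \<gamma>. f (dv G \<beta> \<gamma>))"

text \<open>Nonnegativity is demanded separately: over an empty unit space the matrix condition is
  void, whereas \<open>reduced_norm\<close> is then 0.\<close>

definition red_bounded :: "'g top_groupoid \<Rightarrow> ('g \<Rightarrow> complex) \<Rightarrow> real \<Rightarrow> bool" where
  "red_bounded G f c \<longleftrightarrow> 0 \<le> c \<and> (\<forall>u\<in>units G. mat_bounded (src_fibre G u) (kern G f) c)"

text \<open>What the norm estimates use of a function in \<open>Cc G\<close>: it is bounded, and its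
  support meets the source and range fibres in uniformly few arrows.\<close>

definition fibre_finite :: "'g top_groupoid \<Rightarrow> ('g \<Rightarrow> complex) \<Rightarrow> bool" where
  "fibre_finite G f \<longleftrightarrow> (\<forall>\<gamma>. \<gamma> \<notin> arrows G \<longrightarrow> f \<gamma> = 0) \<and> (\<exists>M. \<forall>\<gamma>. cmod (f \<gamma>) \<le> M) \<and>
     (\<exists>N. \<forall>u. finite {\<gamma> \<in> arrows G. src G \<gamma> = u \<and> f \<gamma> \<noteq> 0} \<and> card {\<gamma> \<in> arrows G. src G \<gamma> = u \<and> f \<gamma> \<noteq> 0} \<le> N \<and>
             finite {\<gamma> \<in> arrows G. rng G \<gamma> = u \<and> f \<gamma> \<noteq> 0} \<and> card {\<gamma> \<in> arrows G. rng G \<gamma> = u \<and> f \<gamma> \<noteq> 0} \<le> N)"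

lemma in_src_fibre [simp]: "\<gamma> \<in> src_fibre G u \<longleftrightarrow> \<gamma> \<in> arrows G \<and> src G \<gamma> = u"
  by (simp add: src_fibre_def)

text \<open>No topology enters here, so the results transfer to \<open>iso_groupoid G\<close> as
  soon as the interior of the isotropy is known to be closed under the operations.\<close>

locale alg_groupoid =
  fixes G :: "'g top_groupoid"
  assumes alg: "algebraic_groupoid G"
begin

lemma src_arrow [simp]: "\<gamma> \<in> arrows G \<Longrightarrow> src G \<gamma> \<in> arrows G"
  and rng_arrow [simp]: "\<gamma> \<in> arrows G \<Longrightarrow> rng G \<gamma> \<in> arrows G"
  and ginv_arrow [simp]: "\<gamma> \<in> arrows G \<Longrightarrow> ginv G \<gamma> \<in> arrows G"
  and src_src [simp]: "\<gamma> \<in> arrows G \<Longrightarrow> src G (src G \<gamma>) = src G \<gamma>"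
  and rng_src [simp]: "\<gamma> \<in> arrows G \<Longrightarrow> rng G (src G \<gamma>) = src G \<gamma>"
  and src_rng [simp]: "\<gamma> \<in> arrows G \<Longrightarrow> src G (rng G \<gamma>) = rng G \<gamma>"
  and rng_rng [simp]: "\<gamma> \<in> arrows G \<Longrightarrow> rng G (rng G \<gamma>) = rng G \<gamma>"
  and mult_src [simp]: "\<gamma> \<in> arrows G \<Longrightarrow> mult G \<gamma> (src G \<gamma>) = \<gamma>"
  and mult_rng [simp]: "\<gamma> \<in> arrows G \<Longrightarrow> mult G (rng G \<gamma>) \<gamma> = \<gamma>"
  and src_ginv [simp]: "\<gamma> \<in> arrows G \<Longrightarrow> src G (ginv G \<gamma>) = rng G \<gamma>"
  and rng_ginv [simp]: "\<gamma> \<in> arrows G \<Longrightarrow> rng G (ginv G \<gamma>) = src G \<gamma>"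
  and ginv_mult [simp]: "\<gamma> \<in> arrows G \<Longrightarrow> mult G (ginv G \<gamma>) \<gamma> = src G \<gamma>"
  and dv_self [simp]: "\<gamma> \<in> arrows G \<Longrightarrow> dv G \<gamma> \<gamma> = rng G \<gamma>"
  using alg unfolding algebraic_groupoid_def by blast+

lemma
  assumes "\<alpha> \<in> arrows G" "\<beta> \<in> arrows G" "src G \<alpha> = rng G \<beta>"
  shows mult_arrow [simp]: "mult G \<alpha> \<beta> \<in> arrows G"
    and src_mult [simp]: "src G (mult G \<alpha> \<beta>) = src G \<beta>"
    and rng_mult [simp]: "rng G (mult G \<alpha> \<beta>) = rng G \<alpha>"
  using alg assms unfolding algebraic_groupoid_def composable_def by blast+

lemma mult_assoc:
  assumes "\<alpha> \<in> arrows G" "\<beta> \<in> arrows G" "\<gamma> \<in> arrows G" "src G \<alpha> = rng G \<beta>" "src G \<beta> = rng G \<gamma>"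
  shows "mult G (mult G \<alpha> \<beta>) \<gamma> = mult G \<alpha> (mult G \<beta> \<gamma>)"
  using alg assms unfolding algebraic_groupoid_def composable_def by blast

lemma dv_mult_cancel [simp]:
  assumes "\<beta> \<in> arrows G" "\<gamma> \<in> arrows G" "src G \<beta> = src G \<gamma>"
  shows "mult G (dv G \<beta> \<gamma>) \<gamma> = \<beta>"
  using assms by (simp add: mult_assoc) (metis mult_src)

lemma mult_dv_cancel [simp]:
  assumes "\<alpha> \<in> arrows G" "\<gamma> \<in> arrows G" "src G \<alpha> = rng G \<gamma>"
  shows "dv G (mult G \<alpha> \<gamma>) \<gamma> = \<alpha>"
  using assms by (simp add: mult_assoc) (metis mult_src)

lemma mult_right_cancel:
  assumes "mult G \<alpha> \<gamma> = mult G \<beta> \<gamma>" "\<alpha> \<in> arrows G" "\<beta> \<in> arrows G" "\<gamma> \<in> arrows G"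
    "src G \<alpha> = rng G \<gamma>" "src G \<beta> = rng G \<gamma>"
  shows "\<alpha> = \<beta>"
  using assms mult_dv_cancel by metis

lemma ginv_ginv [simp]: "\<gamma> \<in> arrows G \<Longrightarrow> ginv G (ginv G \<gamma>) = \<gamma>"
  by (rule mult_right_cancel[of _ "ginv G \<gamma>"]) auto

lemma ginv_src [simp]: "\<gamma> \<in> arrows G \<Longrightarrow> ginv G (src G \<gamma>) = src G \<gamma>"
proof (rule mult_right_cancel[of _ "src G \<gamma>"])
  assume "\<gamma> \<in> arrows G"
  then show "mult G (ginv G (src G \<gamma>)) (src G \<gamma>) = mult G (src G \<gamma>) (src G \<gamma>)"
    using mult_src[of "src G \<gamma>"] by simp
qed auto

lemma ginv_dv:
  assumes "\<beta> \<in> arrows G" "\<gamma> \<in> arrows G" "src G \<beta> = src G \<gamma>"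
  shows "ginv G (dv G \<beta> \<gamma>) = dv G \<gamma> \<beta>"
proof (rule mult_right_cancel[of _ "dv G \<beta> \<gamma>"])
  have "mult G (dv G \<gamma> \<beta>) (dv G \<beta> \<gamma>) = mult G (mult G (dv G \<gamma> \<beta>) \<beta>) (ginv G \<gamma>)"
    using assms by (intro mult_assoc[symmetric]) auto
  then show "mult G (ginv G (dv G \<beta> \<gamma>)) (dv G \<beta> \<gamma>) = mult G (dv G \<gamma> \<beta>) (dv G \<beta> \<gamma>)"
    using assms by simp
qed (use assms in auto)

text \<open>Right translation by \<open>\<gamma>\<^sup>-\<^sup>1\<close> cancels in quotients, so
  \<open>kern G f\<close> is invariant under right translation. Both \<open>kern_conv\<close> and
  the coset decomposition below rest on this.\<close>

lemma dv_dv: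
  assumes "\<beta> \<in> arrows G" "\<gamma> \<in> arrows G" "\<delta> \<in> arrows G" "src G \<beta> = src G \<gamma>" "src G \<delta> = src G \<gamma>"
  shows "dv G (dv G \<beta> \<gamma>) (dv G \<delta> \<gamma>) = dv G \<beta> \<delta>"
proof -
  have "dv G (dv G \<beta> \<gamma>) (dv G \<delta> \<gamma>) = mult G (dv G \<beta> \<gamma>) (dv G \<gamma> \<delta>)"
    using assms by (simp add: ginv_dv)
  also have "\<dots> = mult G (mult G (dv G \<beta> \<gamma>) \<gamma>) (ginv G \<delta>)"
    using assms by (intro mult_assoc[symmetric]) auto
  finally show ?thesis using assms by simp
qed

lemma src_in_units [simp]: "\<gamma> \<in> arrows G \<Longrightarrow> src G \<gamma> \<in> units G"
  by (simp add: units_def)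

lemma rng_in_units [simp]: "\<gamma> \<in> arrows G \<Longrightarrow> rng G \<gamma> \<in> units G"
  unfolding units_def by (metis image_eqI rng_arrow src_rng)

lemma units_arrows: "u \<in> units G \<Longrightarrow> u \<in> arrows G"
  and src_unit: "u \<in> units G \<Longrightarrow> src G u = u"
  and rng_unit: "u \<in> units G \<Longrightarrow> rng G u = u"
  by (auto simp: units_def)

lemma bij_betw_dv:
  assumes "\<gamma> \<in> arrows G"
  shows "bij_betw (\<lambda>\<delta>. dv G \<delta> \<gamma>) (src_fibre G (src G \<gamma>)) (src_fibre G (rng G \<gamma>))"
  by (rule bij_betw_byWitness[where f'="\<lambda>\<delta>. mult G \<delta> \<gamma>"]) (use assms in auto)

lemma inj_on_dv:
  assumes "\<gamma> \<in> arrows G" "F \<subseteq> src_fibre G (src G \<gamma>)"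
  shows "inj_on (\<lambda>\<delta>. dv G \<delta> \<gamma>) F"
  using bij_betw_dv[OF assms(1)] assms(2) by (meson bij_betw_imp_inj_on inj_on_subset)

lemma inj_on_dv_left:
  assumes "\<beta> \<in> arrows G" "F \<subseteq> src_fibre G (src G \<beta>)"
  shows "inj_on (\<lambda>\<delta>. dv G \<beta> \<delta>) F"
proof (rule inj_onI)
  fix \<gamma> \<delta> assume *: "\<gamma> \<in> F" "\<delta> \<in> F" "dv G \<beta> \<gamma> = dv G \<beta> \<delta>"
  then have "\<gamma> \<in> arrows G" "\<delta> \<in> arrows G" "src G \<gamma> = src G \<beta>" "src G \<delta> = src G \<beta>"
    using assms by auto
  moreover from this have "dv G \<gamma> \<beta> = dv G \<delta> \<beta>" using *(3) assms by (metis ginv_dv)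
  ultimately show "\<gamma> = \<delta>" using assms by (metis dv_mult_cancel)
qed

subsection \<open>The regular representations as matrices\<close>

lemma regular_rep_basis_eq:
  assumes "\<gamma> \<in> arrows G"
  shows "regular_rep_basis G f \<gamma> \<beta> = (if \<beta> \<in> src_fibre G (src G \<gamma>) then f (dv G \<beta> \<gamma>) else 0)"
proof (cases "\<beta> \<in> src_fibre G (src G \<gamma>)")
  case True
  have "regular_rep_basis G f \<gamma> \<beta> = (\<Sum>\<alpha>\<in>{dv G \<beta> \<gamma>}. f \<alpha> * point_mass (mult G \<alpha> \<gamma>) \<beta>)"
    unfolding regular_rep_basis_def
    using True assms by (intro infsum_finite_support) (auto simp: point_mass_def)
  then show ?thesis using True assms by (simp add: point_mass_def)
next
  case False
  then show ?thesis unfolding regular_rep_basis_def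
    using assms by (auto intro!: infsum_0 simp: point_mass_def)
qed

lemma regular_rep_eq: "regular_rep G u f \<xi> = mat_apply (src_fibre G u) (kern G f) \<xi>"
  unfolding regular_rep_def mat_apply_def kern_def
  by (auto simp: regular_rep_basis_eq fun_eq_iff mult.commute intro!: infsum_cong infsum_0)

text \<open>Feeds the Schur test: \<open>h\<close> is a quotient map that carries a row or column of
  the matrix injectively into a range or source fibre of the support.\<close>

lemma sum_le_card_support:
  fixes g :: "'b \<Rightarrow> complex"
  assumes "finite T" "inj_on h T" "h ` {x\<in>T. g (h x) \<noteq> 0} \<subseteq> A" "finite A" "card A \<le> N" "\<And>x. cmod (g x) \<le> M"
  shows "(\<Sum>x\<in>T. cmod (g (h x))) \<le> real N * M"
proof -
  have M: "0 \<le> M" using assms(6) by (meson norm_ge_zero order_trans)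
  have "(\<Sum>x\<in>T. cmod (g (h x))) = (\<Sum>x\<in>{x\<in>T. g (h x) \<noteq> 0}. cmod (g (h x)))"
    using assms(1) by (intro sum.mono_neutral_right) auto
  also have "\<dots> \<le> real (card {x\<in>T. g (h x) \<noteq> 0}) * M"
    using sum_bounded_above[of "{x\<in>T. g (h x) \<noteq> 0}" "\<lambda>x. cmod (g (h x))" M] assms(6) by simp
  also have "card {x\<in>T. g (h x) \<noteq> 0} \<le> N"
    using card_inj_on_le[of h "{x\<in>T. g (h x) \<noteq> 0}" A] assms
    by (metis (no_types, lifting) inj_on_subset mem_Collect_eq order_trans subsetI)
  finally show ?thesis using M by (simp add: mult_right_mono)
qed

text \<open>A row indexed by \<beta> runs through arrows with range \<open>rng G \<beta>\<close>, a
  column indexed by \<gamma> through arrows with source \<open>rng G \<gamma>\<close>. In both at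
  most \<open>N\<close> entries are nonzero, each of modulus at most \<open>M\<close>.\<close>

lemma fibre_finite_imp_red_bounded:
  assumes "fibre_finite G f"
  shows "\<exists>c. red_bounded G f c"
proof -
  obtain M where M: "\<And>\<gamma>. cmod (f \<gamma>) \<le> M"
    using assms unfolding fibre_finite_def by blast
  obtain N where "\<forall>u. finite {\<gamma> \<in> arrows G. src G \<gamma> = u \<and> f \<gamma> \<noteq> 0} \<and> card {\<gamma> \<in> arrows G. src G \<gamma> = u \<and> f \<gamma> \<noteq> 0} \<le> N \<and>
      finite {\<gamma> \<in> arrows G. rng G \<gamma> = u \<and> f \<gamma> \<noteq> 0} \<and> card {\<gamma> \<in> arrows G. rng G \<gamma> = u \<and> f \<gamma> \<noteq> 0} \<le> N"
    using assms unfolding fibre_finite_def by blast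
  then have N: "finite {\<gamma> \<in> arrows G. src G \<gamma> = u \<and> f \<gamma> \<noteq> 0}" "card {\<gamma> \<in> arrows G. src G \<gamma> = u \<and> f \<gamma> \<noteq> 0} \<le> N"
      "finite {\<gamma> \<in> arrows G. rng G \<gamma> = u \<and> f \<gamma> \<noteq> 0}" "card {\<gamma> \<in> arrows G. rng G \<gamma> = u \<and> f \<gamma> \<noteq> 0} \<le> N" for u
    by auto
  have M0: "0 \<le> M" using M by (meson norm_ge_zero order_trans)
  have "mat_bounded (src_fibre G u) (kern G f) (real N * M)" for u
  proof (rule mat_bounded_Schur)
    fix \<beta> T assume *: "\<beta> \<in> src_fibre G u" "finite T" "T \<subseteq> src_fibre G u"
    show "(\<Sum>\<gamma>\<in>T. cmod (kern G f \<beta> \<gamma>)) \<le> real N * M"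
      unfolding kern_def
      by (rule sum_le_card_support[where A="{\<gamma> \<in> arrows G. rng G \<gamma> = rng G \<beta> \<and> f \<gamma> \<noteq> 0}"])
        (use * N M inj_on_dv_left[of \<beta> T] in auto)
  next
    fix \<gamma> T assume *: "\<gamma> \<in> src_fibre G u" "finite T" "T \<subseteq> src_fibre G u"
    show "(\<Sum>\<beta>\<in>T. cmod (kern G f \<beta> \<gamma>)) \<le> real N * M"
      unfolding kern_def
      by (rule sum_le_card_support[where A="{\<alpha> \<in> arrows G. src G \<alpha> = rng G \<gamma> \<and> f \<alpha> \<noteq> 0}"])
        (use * N M inj_on_dv[of \<gamma> T] in auto)
  qed (use M0 in auto)
  then show ?thesis unfolding red_bounded_def using M0 by (intro exI[of _ "real N * M"]) auto
qed

lemma finite_kern_row: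
  assumes "fibre_finite G f" "\<beta> \<in> src_fibre G u"
  shows "finite {\<gamma> \<in> src_fibre G u. kern G f \<beta> \<gamma> \<noteq> 0}"
proof (rule inj_on_finite[where f="\<lambda>\<gamma>. dv G \<beta> \<gamma>" and B="{\<gamma> \<in> arrows G. rng G \<gamma> = rng G \<beta> \<and> f \<gamma> \<noteq> 0}"])
  show "finite {\<gamma> \<in> arrows G. rng G \<gamma> = rng G \<beta> \<and> f \<gamma> \<noteq> 0}"
    using assms unfolding fibre_finite_def by blast
qed (use assms in \<open>auto intro!: inj_on_dv_left simp: kern_def\<close>)

lemma finite_kern_column:
  assumes "fibre_finite G f" "\<gamma> \<in> src_fibre G u"
  shows "finite {\<beta> \<in> src_fibre G u. kern G f \<beta> \<gamma> \<noteq> 0}"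
proof (rule inj_on_finite[where f="\<lambda>\<beta>. dv G \<beta> \<gamma>" and B="{\<alpha> \<in> arrows G. src G \<alpha> = rng G \<gamma> \<and> f \<alpha> \<noteq> 0}"])
  show "finite {\<alpha> \<in> arrows G. src G \<alpha> = rng G \<gamma> \<and> f \<alpha> \<noteq> 0}"
    using assms unfolding fibre_finite_def by blast
qed (use assms in \<open>auto intro!: inj_on_dv simp: kern_def\<close>)

text \<open>Replaces the nested suprema by a property of finite matrices; all later norm
  inequalities go through it. Finiteness on fibres guarantees that the suprema are taken over
  bounded sets, where they have their usual meaning.\<close>

lemma reduced_norm_le_iff:
  assumes f: "fibre_finite G f"
  shows "reduced_norm G f \<le> c \<longleftrightarrow> red_bounded G f c"
proof -
  let ?B = "\<lambda>u. {\<xi> \<in> ell2 (src_fibre G u). ell2_norm (src_fibre G u) \<xi> \<le> 1}"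
  have ball: "(\<lambda>_. 0) \<in> ?B u" for u
    by (simp add: ell2_def ell2_norm_def)
  have app: "regular_rep G u f \<xi> \<in> ell2 (src_fibre G u) \<and> ell2_norm (src_fibre G u) (regular_rep G u f \<xi>) \<le> d"
    if d: "red_bounded G f d" and u: "u \<in> units G" and \<xi>: "\<xi> \<in> ?B u" for d u \<xi>
  proof -
    have K: "mat_bounded (src_fibre G u) (kern G f) d" and d0: "0 \<le> d"
      using d u by (auto simp: red_bounded_def)
    have "d * ell2_norm (src_fibre G u) \<xi> \<le> d * 1" using \<xi> d0 by (intro mult_left_mono) auto
    with mat_bounded_imp_apply[OF K d0 _ finite_kern_row[OF f], of \<xi>] \<xi>
    show ?thesis by (auto simp: regular_rep_eq)
  qed
  \<comment> \<open>This preliminary bound makes both suprema bounded above and puts the images of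
    vectors in the unit ball into \<open>ell2\<close>; its size is irrelevant.\<close>
  obtain d where d: "red_bounded G f d" using fibre_finite_imp_red_bounded[OF f] by blast
  have le: "regular_rep_norm G u f \<le> e" if "red_bounded G f e" "u \<in> units G" for u e
    unfolding regular_rep_norm_def using app[OF that] ball[of u] by (intro cSUP_least) auto
  have bdd: "bdd_above (insert 0 ((\<lambda>u. regular_rep_norm G u f) ` units G))"
    using le[OF d] by (auto intro!: bdd_aboveI2[of _ _ d])
  show ?thesis
  proof
    assume c: "reduced_norm G f \<le> c"
    have upper: "x \<le> c" if "x \<in> insert 0 ((\<lambda>u. regular_rep_norm G u f) ` units G)" for x
      using cSup_upper[OF that bdd] c unfolding reduced_norm_def by linarith
    have u: "regular_rep_norm G u f \<le> c" if "u \<in> units G" for u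
      using upper that by blast
    have "0 \<le> c" using upper by blast
    moreover have "mat_bounded (src_fibre G u) (kern G f) c" if u': "u \<in> units G" for u
    proof (rule mat_bounded_of_apply)
      fix \<xi> assume "\<xi> \<in> ell2 (src_fibre G u)" "ell2_norm (src_fibre G u) \<xi> \<le> 1"
      then have \<xi>: "\<xi> \<in> ?B u" by auto
      have "ell2_norm (src_fibre G u) (regular_rep G u f \<xi>) \<le> regular_rep_norm G u f"
        unfolding regular_rep_norm_def
        by (rule cSUP_upper[OF \<xi>]) (use app[OF d u'] in \<open>auto intro!: bdd_aboveI2[of _ _ d]\<close>)
      then show "mat_apply (src_fibre G u) (kern G f) \<xi> \<in> ell2 (src_fibre G u) \<and>
        ell2_norm (src_fibre G u) (mat_apply (src_fibre G u) (kern G f) \<xi>) \<le> c"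
        using app[OF d u' \<xi>] u[OF u'] by (simp add: regular_rep_eq)
    qed
    ultimately show "red_bounded G f c" by (simp add: red_bounded_def)
  next
    assume c: "red_bounded G f c"
    then show "reduced_norm G f \<le> c"
      unfolding reduced_norm_def using le[OF c] by (intro cSup_least) (auto simp: red_bounded_def)
  qed
qed

lemma red_bounded_reduced_norm: "fibre_finite G f \<Longrightarrow> red_bounded G f (reduced_norm G f)"
  using reduced_norm_le_iff by blast

lemma reduced_norm_nonneg: "fibre_finite G f \<Longrightarrow> 0 \<le> reduced_norm G f"
  using red_bounded_reduced_norm by (auto simp: red_bounded_def)

section \<open>Bounds for sums, scalar multiples and the involution\<close>

lemma red_bounded_add:
  assumes "red_bounded G f c" "red_bounded G g d"
  shows "red_bounded G (\<lambda>\<gamma>. f \<gamma> + g \<gamma>) (c + d)"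
  using assms unfolding red_bounded_def kern_def by (auto intro: mat_bounded_add)

lemma red_bounded_scale:
  assumes "red_bounded G f c"
  shows "red_bounded G (\<lambda>\<gamma>. a * f \<gamma>) (cmod a * c)"
  using assms unfolding red_bounded_def kern_def by (auto intro: mat_bounded_scale)

lemma red_bounded_invol:
  assumes "red_bounded G f c"
  shows "red_bounded G (invol G f) c"
  unfolding red_bounded_def
proof (intro conjI ballI)
  fix u assume u: "u \<in> units G"
  show "mat_bounded (src_fibre G u) (kern G (invol G f)) c"
    by (rule mat_bounded_cong[OF mat_bounded_adjoint])
      (use assms u in \<open>auto simp: red_bounded_def kern_def invol_def ginv_dv\<close>)
qed (use assms in \<open>auto simp: red_bounded_def\<close>)

subsection \<open>Convolution\<close>

text \<open>A factorisation of \<gamma> is determined by its right factor \<beta>, any arrow with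
  the source of \<gamma>; the left factor is \<open>dv G \<gamma> \<beta>\<close>.\<close>

lemma conv_eq_infsum:
  "conv G f g \<gamma> = (if \<gamma> \<in> arrows G then \<Sum>\<^sub>\<infinity>\<beta>\<in>src_fibre G (src G \<gamma>). f (dv G \<gamma> \<beta>) * g \<beta> else 0)"
proof (cases "\<gamma> \<in> arrows G")
  case True
  let ?P = "{(\<alpha>, \<beta>) \<in> composable G. mult G \<alpha> \<beta> = \<gamma>}"
  have "bij_betw (\<lambda>\<beta>. (dv G \<gamma> \<beta>, \<beta>)) (src_fibre G (src G \<gamma>)) ?P"
    by (rule bij_betw_byWitness[where f'=snd]) (use True in \<open>auto simp: composable_def\<close>)
  from infsum_reindex_bij_betw[OF this, of "\<lambda>(\<alpha>, \<beta>). f \<alpha> * g \<beta>"]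
  show ?thesis using True by (simp add: conv_def)
next
  case False
  then have "{(\<alpha>, \<beta>) \<in> composable G. mult G \<alpha> \<beta> = \<gamma>} = {}" by (auto simp: composable_def)
  then show ?thesis using False unfolding conv_def by (simp only: infsum_empty if_False)
qed

lemma conv_eq_sum:
  assumes "\<gamma> \<in> arrows G" "finite D" "D \<subseteq> src_fibre G (src G \<gamma>)"
    "\<And>\<beta>. \<beta> \<in> src_fibre G (src G \<gamma>) - D \<Longrightarrow> f (dv G \<gamma> \<beta>) * g \<beta> = 0"
  shows "conv G f g \<gamma> = (\<Sum>\<beta>\<in>D. f (dv G \<gamma> \<beta>) * g \<beta>)"
  using infsum_finite_support[OF assms(2,3,4)] assms(1) by (simp add: conv_eq_infsum)

text \<open>Convolution becomes matrix multiplication: right translation by \<gamma> moves the index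
  set to the fibre over \<open>src G \<gamma>\<close>, and \<open>dv_dv\<close> simplifies the
  quotients.\<close>

lemma kern_conv:
  assumes "\<gamma> \<in> arrows G" "\<beta> \<in> src_fibre G (src G \<gamma>)"
  shows "kern G (conv G f g) \<beta> \<gamma> = (\<Sum>\<^sub>\<infinity>\<delta>\<in>src_fibre G (src G \<gamma>). kern G f \<beta> \<delta> * kern G g \<delta> \<gamma>)"
proof -
  have "kern G (conv G f g) \<beta> \<gamma> = (\<Sum>\<^sub>\<infinity>\<delta>\<in>src_fibre G (rng G \<gamma>). f (dv G (dv G \<beta> \<gamma>) \<delta>) * g \<delta>)"
    using assms by (simp add: kern_def conv_eq_infsum)
  also have "\<dots> = (\<Sum>\<^sub>\<infinity>\<delta>\<in>src_fibre G (src G \<gamma>). f (dv G (dv G \<beta> \<gamma>) (dv G \<delta> \<gamma>)) * g (dv G \<delta> \<gamma>))"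
    using infsum_reindex_bij_betw[OF bij_betw_dv[OF assms(1)], of "\<lambda>\<delta>. f (dv G (dv G \<beta> \<gamma>) \<delta>) * g \<delta>"]
    by (rule sym)
  also have "\<dots> = (\<Sum>\<^sub>\<infinity>\<delta>\<in>src_fibre G (src G \<gamma>). kern G f \<beta> \<delta> * kern G g \<delta> \<gamma>)"
    using assms by (intro infsum_cong) (auto simp: kern_def dv_dv)
  finally show ?thesis .
qed

lemma red_bounded_conv:
  assumes f: "red_bounded G f c" and g: "red_bounded G g d" and fin: "fibre_finite G g"
  shows "red_bounded G (conv G f g) (c * d)"
  unfolding red_bounded_def
proof (intro conjI ballI)
  show "0 \<le> c * d" using f g by (auto simp: red_bounded_def)
  fix u assume u: "u \<in> units G"
  show "mat_bounded (src_fibre G u) (kern G (conv G f g)) (c * d)"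
  proof (rule mat_bounded_mult)
    show "mat_bounded (src_fibre G u) (kern G f) c" "mat_bounded (src_fibre G u) (kern G g) d" "0 \<le> c"
      using f g u by (auto simp: red_bounded_def)
  next
    fix T assume T: "finite T" "T \<subseteq> src_fibre G u"
    \<comment> \<open>All intermediate indices where some column of \<open>kern G g\<close> indexed
      by \<open>T\<close> is nonzero. The set does not depend on the row \<beta>.\<close>
    define D where "D = (\<Union>\<gamma>\<in>T. {\<delta> \<in> src_fibre G u. kern G g \<delta> \<gamma> \<noteq> 0})"
    have "finite D"
      unfolding D_def using T(1) by (rule finite_UN_I) (use T fin in \<open>auto intro!: finite_kern_column simp del: in_src_fibre\<close>)
    moreover have "D \<subseteq> src_fibre G u" by (auto simp: D_def)
    moreover have "kern G (conv G f g) \<beta> \<gamma> = (\<Sum>\<delta>\<in>D. kern G f \<beta> \<delta> * kern G g \<delta> \<gamma>)"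
      if "\<beta> \<in> src_fibre G u" "\<gamma> \<in> T" for \<beta> \<gamma>
    proof -
      have *: "\<gamma> \<in> arrows G" "src G \<gamma> = u" using that T by auto
      show ?thesis
        using kern_conv[OF *(1), of \<beta> f g] that *
          infsum_finite_support[OF \<open>finite D\<close> \<open>D \<subseteq> src_fibre G u\<close>, of "\<lambda>\<delta>. kern G f \<beta> \<delta> * kern G g \<delta> \<gamma>"]
        by (auto simp: D_def)
    qed
    ultimately show "\<exists>D. finite D \<and> D \<subseteq> src_fibre G u \<and>
        (\<forall>\<beta>\<in>src_fibre G u. \<forall>\<gamma>\<in>T. kern G (conv G f g) \<beta> \<gamma> = (\<Sum>\<delta>\<in>D. kern G f \<beta> \<delta> * kern G g \<delta> \<gamma>))"
      by blast
  qed
qed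

text \<open>An infinite sum splits only for summable terms. The support of \<open>g\<close> on the
  source fibre is a finite index set common to all left factors.\<close>

lemma conv_add_left:
  assumes "fibre_finite G g"
  shows "conv G (\<lambda>\<gamma>. f \<gamma> + f' \<gamma>) g = (\<lambda>\<gamma>. conv G f g \<gamma> + conv G f' g \<gamma>)"
proof
  fix \<gamma>
  show "conv G (\<lambda>\<gamma>. f \<gamma> + f' \<gamma>) g \<gamma> = conv G f g \<gamma> + conv G f' g \<gamma>"
  proof (cases "\<gamma> \<in> arrows G")
    case True
    let ?D = "{\<beta> \<in> arrows G. src G \<beta> = src G \<gamma> \<and> g \<beta> \<noteq> 0}"
    have "finite ?D" using assms unfolding fibre_finite_def by blast
    then have "conv G h g \<gamma> = (\<Sum>\<beta>\<in>?D. h (dv G \<gamma> \<beta>) * g \<beta>)" for h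
      using True by (intro conv_eq_sum) auto
    then show ?thesis by (simp add: distrib_right sum.distrib)
  qed (simp add: conv_eq_infsum)
qed

lemma conv_add_right:
  assumes "fibre_finite G f"
  shows "conv G f (\<lambda>\<gamma>. g \<gamma> + g' \<gamma>) = (\<lambda>\<gamma>. conv G f g \<gamma> + conv G f g' \<gamma>)"
proof
  fix \<gamma>
  show "conv G f (\<lambda>\<gamma>. g \<gamma> + g' \<gamma>) \<gamma> = conv G f g \<gamma> + conv G f g' \<gamma>"
  proof (cases "\<gamma> \<in> arrows G")
    case True
    let ?D = "{\<beta> \<in> src_fibre G (src G \<gamma>). kern G f \<gamma> \<beta> \<noteq> 0}"
    have "finite ?D" using assms True by (intro finite_kern_row) auto
    then have "conv G f h \<gamma> = (\<Sum>\<beta>\<in>?D. f (dv G \<gamma> \<beta>) * h \<beta>)" for h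
      using True by (intro conv_eq_sum) (auto simp: kern_def)
    then show ?thesis by (simp add: distrib_left sum.distrib)
  qed (simp add: conv_eq_infsum)
qed

lemma conv_scale_left: "conv G (\<lambda>\<gamma>. a * f \<gamma>) g = (\<lambda>\<gamma>. a * conv G f g \<gamma>)"
  by (auto simp: fun_eq_iff conv_eq_infsum mult.assoc infsum_cmult_right')

lemma conv_scale_right: "conv G f (\<lambda>\<gamma>. a * g \<gamma>) = (\<lambda>\<gamma>. a * conv G f g \<gamma>)"
  by (auto simp: fun_eq_iff conv_eq_infsum mult.left_commute infsum_cmult_right')

subsection \<open>Wide subgroupoids\<close>

lemma algebraic_subgroupoid:
  assumes "topspace X \<subseteq> arrows G" "units G \<subseteq> topspace X"
    and "\<And>\<alpha> \<beta>. \<alpha> \<in> topspace X \<Longrightarrow> \<beta> \<in> topspace X \<Longrightarrow> src G \<alpha> = rng G \<beta> \<Longrightarrow> mult G \<alpha> \<beta> \<in> topspace X"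
    and "\<And>\<alpha>. \<alpha> \<in> topspace X \<Longrightarrow> ginv G \<alpha> \<in> topspace X"
  shows "algebraic_groupoid (G\<lparr>gtop := X\<rparr>)"
proof -
  have a: "\<alpha> \<in> arrows G" if "\<alpha> \<in> topspace X" for \<alpha> using that assms(1) by auto
  have u: "\<alpha> \<in> topspace X" if "\<alpha> \<in> units G" for \<alpha> using that assms(2) by auto
  show ?thesis
    unfolding algebraic_groupoid_def composable_def arrows_def top_groupoid.simps top_groupoid.update_convs
    using assms(3,4) by (auto intro!: u mult_assoc simp: a)
qed

lemma units_subgroupoid:
  assumes "topspace X \<subseteq> arrows G" "units G \<subseteq> topspace X"
  shows "units (G\<lparr>gtop := X\<rparr>) = units G"
proof -
  have "src G ` topspace X = src G ` arrows G"
  proof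
    show "src G ` arrows G \<subseteq> src G ` topspace X"
    proof
      fix u assume "u \<in> src G ` arrows G"
      then have "u \<in> units G" by (simp add: units_def)
      then show "u \<in> src G ` topspace X" using assms(2) src_unit by (metis image_eqI subsetD)
    qed
  qed (use assms in auto)
  then show ?thesis by (simp add: units_def arrows_def)
qed

text \<open>The source fibre \<open>G\<^sub>u\<close> splits into right cosets of the subgroupoid, and the matrix of a function
  supported on the subgroupoid is block diagonal. Right translation by a representative identifies each
  block with the matrix over a source fibre of the subgroupoid.\<close>

lemma red_bounded_subgroupoid_iff:
  fixes X
  defines "H \<equiv> G\<lparr>gtop := X\<rparr>"
  assumes sub: "topspace X \<subseteq> arrows G" "units G \<subseteq> topspace X"
    and mult: "\<And>\<alpha> \<beta>. \<alpha> \<in> topspace X \<Longrightarrow> \<beta> \<in> topspace X \<Longrightarrow> src G \<alpha> = rng G \<beta> \<Longrightarrow> mult G \<alpha> \<beta> \<in> topspace X"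
    and inv: "\<And>\<alpha>. \<alpha> \<in> topspace X \<Longrightarrow> ginv G \<alpha> \<in> topspace X"
    and f: "\<And>\<gamma>. \<gamma> \<notin> topspace X \<Longrightarrow> f \<gamma> = 0"
  shows "red_bounded H f c \<longleftrightarrow> red_bounded G f c"
proof -
  have kern: "kern H f = kern G f" by (simp add: kern_def H_def)
  have units: "units H = units G" unfolding H_def by (rule units_subgroupoid[OF sub])
  have fib: "src_fibre H u = {\<gamma> \<in> topspace X. src G \<gamma> = u}" for u
    by (simp add: src_fibre_def H_def arrows_def)
  have arr: "\<alpha> \<in> arrows G" if "\<alpha> \<in> topspace X" for \<alpha> using that sub by auto
  show ?thesis
  proof
    assume "red_bounded G f c"
    \<comment> \<open>Passing to the subgroupoid shrinks the fibres, so fewer finite submatrices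
      have to be bounded.\<close>
    moreover have "src_fibre H u \<subseteq> src_fibre G u" for u using sub by (auto simp: fib)
    ultimately show "red_bounded H f c"
      unfolding red_bounded_def units kern mat_bounded_def by (meson order_trans)
  next
    assume H: "red_bounded H f c"
    then have c: "0 \<le> c" by (simp add: red_bounded_def)
    have "mat_bounded (src_fibre G u) (kern G f) c" if u: "u \<in> units G" for u
      unfolding mat_bounded_def
    proof (intro allI impI)
      fix F T and \<xi> :: "'g \<Rightarrow> complex"
      assume *: "finite F" "F \<subseteq> src_fibre G u" "finite T" "T \<subseteq> src_fibre G u"
      \<comment> \<open>The coset of \<beta>, as a set, so that lying in the same coset becomes
        equality and \<open>sum.group\<close> can sort a sum by cosets.\<close>
      define Q where "Q = (\<lambda>\<beta>. {\<delta> \<in> src_fibre G u. dv G \<delta> \<beta> \<in> topspace X})"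
      have Q_self: "\<beta> \<in> Q \<beta>" if "\<beta> \<in> src_fibre G u" for \<beta>
        using that sub by (auto simp: Q_def)
      have tr: "dv G \<alpha> \<gamma> \<in> topspace X"
        if "dv G \<alpha> \<beta> \<in> topspace X" "dv G \<beta> \<gamma> \<in> topspace X" "\<alpha> \<in> src_fibre G u" "\<beta> \<in> src_fibre G u" "\<gamma> \<in> src_fibre G u" for \<alpha> \<beta> \<gamma>
      proof -
        have "mult G (dv G \<alpha> \<beta>) (dv G \<beta> \<gamma>) = mult G (mult G (dv G \<alpha> \<beta>) \<beta>) (ginv G \<gamma>)"
          using that by (intro mult_assoc[symmetric]) auto
        also have "\<dots> = dv G \<alpha> \<gamma>" using that by simp
        finally show ?thesis using mult[OF that(1,2)] that by simp
      qed
      have sy: "dv G \<beta> \<alpha> \<in> topspace X"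
        if "dv G \<alpha> \<beta> \<in> topspace X" "\<alpha> \<in> src_fibre G u" "\<beta> \<in> src_fibre G u" for \<alpha> \<beta>
        using inv[OF that(1)] that by (simp add: ginv_dv)
      have Q_iff: "Q \<beta> = Q \<gamma> \<longleftrightarrow> dv G \<beta> \<gamma> \<in> topspace X" if "\<beta> \<in> src_fibre G u" "\<gamma> \<in> src_fibre G u" for \<beta> \<gamma>
      proof
        assume "Q \<beta> = Q \<gamma>"
        with Q_self[OF that(1)] show "dv G \<beta> \<gamma> \<in> topspace X" by (auto simp: Q_def)
      next
        assume "dv G \<beta> \<gamma> \<in> topspace X"
        with that tr sy show "Q \<beta> = Q \<gamma>" unfolding Q_def by (blast intro: tr sy)
      qed
      let ?E = "Q ` (F \<union> T)"
      have finE: "finite ?E" using * by simp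
      have block: "(\<Sum>\<beta>\<in>{\<beta>\<in>F. Q \<beta> = q}. (cmod (\<Sum>\<gamma>\<in>T. kern G f \<beta> \<gamma> * \<xi> \<gamma>))\<^sup>2) \<le> c\<^sup>2 * (\<Sum>\<gamma>\<in>{\<gamma>\<in>T. Q \<gamma> = q}. (cmod (\<xi> \<gamma>))\<^sup>2)"
        if q: "q \<in> ?E" for q
      proof -
        obtain \<gamma>0 where \<gamma>0: "\<gamma>0 \<in> src_fibre G u" "q = Q \<gamma>0" using q * by auto
        define \<phi> where "\<phi> = (\<lambda>\<beta>. dv G \<beta> \<gamma>0)"
        define \<psi> where "\<psi> = (\<lambda>\<beta>. mult G \<beta> \<gamma>0)"
        let ?F = "{\<beta>\<in>F. Q \<beta> = q}" and ?T = "{\<gamma>\<in>T. Q \<gamma> = q}"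
        have \<psi>\<phi>: "\<psi> (\<phi> \<beta>) = \<beta>" if "\<beta> \<in> src_fibre G u" for \<beta>
          using that \<gamma>0 by (simp add: \<phi>_def \<psi>_def)
        have inj: "inj_on \<phi> ?F" "inj_on \<phi> ?T"
          using \<gamma>0 * unfolding \<phi>_def by (auto intro!: inj_on_dv)
        have sb: "\<phi> ` ?F \<subseteq> src_fibre H (rng G \<gamma>0)" "\<phi> ` ?T \<subseteq> src_fibre H (rng G \<gamma>0)"
          using \<gamma>0 * Q_iff by (auto simp: fib \<phi>_def)
        have K: "kern G f \<beta> \<gamma> = kern G f (\<phi> \<beta>) (\<phi> \<gamma>)" if "\<beta> \<in> src_fibre G u" "\<gamma> \<in> src_fibre G u" for \<beta> \<gamma>
          using that \<gamma>0 by (simp add: kern_def \<phi>_def dv_dv)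
        have row: "(\<Sum>\<gamma>\<in>T. kern G f \<beta> \<gamma> * \<xi> \<gamma>) = (\<Sum>\<gamma>\<in>\<phi> ` ?T. kern G f (\<phi> \<beta>) \<gamma> * \<xi> (\<psi> \<gamma>))" if "\<beta> \<in> ?F" for \<beta>
        proof -
          \<comment> \<open>Block diagonality: for arrows in different cosets the quotient lies off
            the subgroupoid, where \<open>f\<close> vanishes.\<close>
          have z: "kern G f \<beta> \<gamma> = 0" if "\<gamma> \<in> T" "Q \<gamma> \<noteq> q" for \<gamma>
          proof -
            have "\<beta> \<in> src_fibre G u" "\<gamma> \<in> src_fibre G u" using that \<open>\<beta> \<in> ?F\<close> * by auto
            from Q_iff[OF this] that \<open>\<beta> \<in> ?F\<close> have "dv G \<beta> \<gamma> \<notin> topspace X" by simp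
            then show ?thesis by (simp add: kern_def f)
          qed
          have "(\<Sum>\<gamma>\<in>T. kern G f \<beta> \<gamma> * \<xi> \<gamma>) = (\<Sum>\<gamma>\<in>?T. kern G f \<beta> \<gamma> * \<xi> \<gamma>)"
            using *(3) z by (intro sum.mono_neutral_right) auto
          also have "\<dots> = (\<Sum>\<gamma>\<in>?T. kern G f (\<phi> \<beta>) (\<phi> \<gamma>) * \<xi> (\<psi> (\<phi> \<gamma>)))"
          proof (intro sum.cong refl)
            fix \<gamma> assume "\<gamma> \<in> ?T"
            then have "\<gamma> \<in> src_fibre G u" "\<beta> \<in> src_fibre G u" using * \<open>\<beta> \<in> ?F\<close> by auto
            then show "kern G f \<beta> \<gamma> * \<xi> \<gamma> = kern G f (\<phi> \<beta>) (\<phi> \<gamma>) * \<xi> (\<psi> (\<phi> \<gamma>))"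
              using K[of \<beta> \<gamma>] \<psi>\<phi>[of \<gamma>] by simp
          qed
          also have "\<dots> = (\<Sum>\<gamma>\<in>\<phi> ` ?T. kern G f (\<phi> \<beta>) \<gamma> * \<xi> (\<psi> \<gamma>))"
            by (simp add: sum.reindex[OF inj(2)])
          finally show ?thesis .
        qed
        have "L2_set (\<lambda>\<beta>. cmod (\<Sum>\<gamma>\<in>\<phi> ` ?T. kern G f \<beta> \<gamma> * \<xi> (\<psi> \<gamma>))) (\<phi> ` ?F) \<le> c * L2_set (\<lambda>\<gamma>. cmod (\<xi> (\<psi> \<gamma>))) (\<phi> ` ?T)"
        proof (rule mat_boundedD)
          show "mat_bounded (src_fibre H (rng G \<gamma>0)) (kern G f) c"
            using H \<gamma>0 unfolding red_bounded_def units kern by auto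
        qed (use * sb in auto)
        then have "sqrt (\<Sum>\<beta>\<in>?F. (cmod (\<Sum>\<gamma>\<in>\<phi> ` ?T. kern G f (\<phi> \<beta>) \<gamma> * \<xi> (\<psi> \<gamma>)))\<^sup>2) \<le> c * sqrt (\<Sum>\<gamma>\<in>?T. (cmod (\<xi> (\<psi> (\<phi> \<gamma>))))\<^sup>2)"
          by (simp add: L2_set_def sum.reindex inj)
        also have "(\<Sum>\<gamma>\<in>?T. (cmod (\<xi> (\<psi> (\<phi> \<gamma>))))\<^sup>2) = (\<Sum>\<gamma>\<in>?T. (cmod (\<xi> \<gamma>))\<^sup>2)"
          using * \<psi>\<phi> by (intro sum.cong) auto
        also have "(\<Sum>\<beta>\<in>?F. (cmod (\<Sum>\<gamma>\<in>\<phi> ` ?T. kern G f (\<phi> \<beta>) \<gamma> * \<xi> (\<psi> \<gamma>)))\<^sup>2) = (\<Sum>\<beta>\<in>?F. (cmod (\<Sum>\<gamma>\<in>T. kern G f \<beta> \<gamma> * \<xi> \<gamma>))\<^sup>2)"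
          using row by (intro sum.cong) auto
        also have "c * sqrt (\<Sum>\<gamma>\<in>?T. (cmod (\<xi> \<gamma>))\<^sup>2) = sqrt (c\<^sup>2 * (\<Sum>\<gamma>\<in>?T. (cmod (\<xi> \<gamma>))\<^sup>2))"
          using c by (simp add: real_sqrt_mult)
        finally show ?thesis by (simp only: real_sqrt_le_iff)
      qed
      \<comment> \<open>The squares of the norms over the cosets add up, so the common constant of
        the blocks bounds the whole matrix.\<close>
      have "(\<Sum>\<beta>\<in>F. (cmod (\<Sum>\<gamma>\<in>T. kern G f \<beta> \<gamma> * \<xi> \<gamma>))\<^sup>2) =
            (\<Sum>q\<in>?E. \<Sum>\<beta>\<in>{\<beta>\<in>F. Q \<beta> = q}. (cmod (\<Sum>\<gamma>\<in>T. kern G f \<beta> \<gamma> * \<xi> \<gamma>))\<^sup>2)"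
        by (rule sum.group[symmetric, OF *(1) finE]) auto
      also have "\<dots> \<le> (\<Sum>q\<in>?E. c\<^sup>2 * (\<Sum>\<gamma>\<in>{\<gamma>\<in>T. Q \<gamma> = q}. (cmod (\<xi> \<gamma>))\<^sup>2))"
        by (intro sum_mono block)
      also have "\<dots> = c\<^sup>2 * (\<Sum>\<gamma>\<in>T. (cmod (\<xi> \<gamma>))\<^sup>2)"
        unfolding sum_distrib_left[symmetric]
        by (rule arg_cong[where f="\<lambda>x. c\<^sup>2 * x"], rule sum.group[OF *(3) finE]) auto
      finally have "sqrt (\<Sum>\<beta>\<in>F. (cmod (\<Sum>\<gamma>\<in>T. kern G f \<beta> \<gamma> * \<xi> \<gamma>))\<^sup>2) \<le> sqrt (c\<^sup>2 * (\<Sum>\<gamma>\<in>T. (cmod (\<xi> \<gamma>))\<^sup>2))"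
        by (rule real_sqrt_le_mono)
      then show "L2_set (\<lambda>\<beta>. cmod (\<Sum>\<gamma>\<in>T. kern G f \<beta> \<gamma> * \<xi> \<gamma>)) F \<le> c * L2_set (\<lambda>\<gamma>. cmod (\<xi> \<gamma>)) T"
        using c by (simp add: L2_set_def real_sqrt_mult)
    qed
    then show "red_bounded G f c" using c by (simp add: red_bounded_def)
  qed
qed

end

section \<open>Topological preliminaries\<close>

lemma continuous_map_locallyI:
  assumes "\<And>x. x \<in> topspace X \<Longrightarrow> \<exists>U. openin X U \<and> x \<in> U \<and> continuous_map (subtopology X U) Y f"
  shows "continuous_map X Y f"
  unfolding continuous_map_def
proof (intro conjI allI impI funcsetI)
  fix x assume x: "x \<in> topspace X"
  then obtain U where "x \<in> U" "continuous_map (subtopology X U) Y f" using assms by blast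
  then show "f x \<in> topspace Y" using x by (auto simp: continuous_map_def)
next
  fix V assume V: "openin Y V"
  show "openin X {x \<in> topspace X. f x \<in> V}"
  proof (subst openin_subopen, clarify)
    fix x assume x: "x \<in> topspace X" "f x \<in> V"
    then obtain U where U: "openin X U" "x \<in> U" "continuous_map (subtopology X U) Y f"
      using assms by blast
    have "openin X {y \<in> topspace (subtopology X U). f y \<in> V}"
      by (rule openin_trans_full[OF openin_continuous_map_preimage[OF U(3) V] U(1)])
    then show "\<exists>T. openin X T \<and> x \<in> T \<and> T \<subseteq> {x \<in> topspace X. f x \<in> V}"
      using x U(2) by (intro exI[of _ "{y \<in> topspace (subtopology X U). f y \<in> V}"]) auto
  qed
qed

lemma local_homeomorphism_imp_continuous_map:
  assumes "local_homeomorphism X Y f"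
  shows "continuous_map X Y f"
proof (rule continuous_map_locallyI)
  fix x assume "x \<in> topspace X"
  then obtain U where "openin X U" "x \<in> U" "homeomorphic_map (subtopology X U) (subtopology Y (f ` U)) f"
    using assms unfolding local_homeomorphism_def by blast
  moreover from this(3) have "continuous_map (subtopology X U) Y f"
    by (intro continuous_map_into_fulltopology[OF homeomorphic_imp_continuous_map])
  ultimately show "\<exists>U. openin X U \<and> x \<in> U \<and> continuous_map (subtopology X U) Y f"
    by blast
qed

lemma local_homeomorphism_imp_open_map:
  assumes "local_homeomorphism X Y f"
  shows "open_map X Y f"
  unfolding open_map_def
proof (intro allI impI)
  fix W assume W: "openin X W"
  show "openin Y (f ` W)"
  proof (subst openin_subopen, clarify)
    fix x assume x: "x \<in> W"
    then have "x \<in> topspace X" using W openin_subset by blast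
    then obtain U where U: "openin X U" "x \<in> U" "openin Y (f ` U)"
        "homeomorphic_map (subtopology X U) (subtopology Y (f ` U)) f"
      using assms unfolding local_homeomorphism_def by blast
    have "openin (subtopology X U) (W \<inter> U)" using W by (auto simp: openin_subtopology)
    then have "openin (subtopology Y (f ` U)) (f ` (W \<inter> U))"
      using homeomorphic_imp_open_map[OF U(4)] by (simp add: open_map_def)
    then have "openin Y (f ` (W \<inter> U))" using U(3) openin_trans_full by blast
    then show "\<exists>T. openin Y T \<and> f x \<in> T \<and> T \<subseteq> f ` W"
      using x U(2) by (intro exI[of _ "f ` (W \<inter> U)"]) auto
  qed
qed

lemma local_homeomorphism_imp_locally_inj:
  assumes "local_homeomorphism X Y f" "x \<in> topspace X"
  shows "\<exists>U. openin X U \<and> x \<in> U \<and> inj_on f U"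
proof -
  obtain U where U: "openin X U" "x \<in> U" "homeomorphic_map (subtopology X U) (subtopology Y (f ` U)) f"
    using assms unfolding local_homeomorphism_def by blast
  then have "topspace X \<inter> U = U" using openin_subset by blast
  then have "inj_on f U" using U(3) by (simp add: homeomorphic_map_def)
  with U show ?thesis by blast
qed

text \<open>\<open>K\<close> is covered by finitely many open sets on which \<open>h\<close> is
  injective, and each of them meets a fibre at most once. The number of these sets is the
  bound.\<close>

lemma compactin_fibres_bounded:
  assumes K: "compactin X K"
    and inj: "\<And>x. x \<in> topspace X \<Longrightarrow> \<exists>U. openin X U \<and> x \<in> U \<and> inj_on h U"
  shows "\<exists>N. \<forall>v. finite {x \<in> K. h x = v} \<and> card {x \<in> K. h x = v} \<le> N"
proof -
  have "\<forall>U\<in>{U. openin X U \<and> inj_on h U}. openin X U" "K \<subseteq> \<Union>{U. openin X U \<and> inj_on h U}"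
    using inj compactin_subset_topspace[OF K] by blast+
  then obtain \<F> where \<F>: "finite \<F>" "\<F> \<subseteq> {U. openin X U \<and> inj_on h U}" "K \<subseteq> \<Union>\<F>"
    using K unfolding compactin_def by meson
  have "finite {x \<in> K. h x = v} \<and> card {x \<in> K. h x = v} \<le> card \<F>" for v
  proof -
    have one: "finite {x \<in> U. h x = v} \<and> card {x \<in> U. h x = v} \<le> 1" if U: "U \<in> \<F>" for U
    proof (cases "{x \<in> U. h x = v} = {}")
      case False
      then obtain y where "y \<in> U" "h y = v" by blast
      moreover have "inj_on h U" using U \<F> by blast
      ultimately have "{x \<in> U. h x = v} = {y}" by (auto dest: inj_onD)
      then show ?thesis by simp
    qed (metis card.empty finite.emptyI zero_le)
    have sub: "{x \<in> K. h x = v} \<subseteq> (\<Union>U\<in>\<F>. {x \<in> U. h x = v})" using \<F>(3) by blast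
    have fin: "finite (\<Union>U\<in>\<F>. {x \<in> U. h x = v})" using \<F>(1) one by blast
    have "card {x \<in> K. h x = v} \<le> card (\<Union>U\<in>\<F>. {x \<in> U. h x = v})"
      by (rule card_mono[OF fin sub])
    also have "\<dots> \<le> (\<Sum>U\<in>\<F>. card {x \<in> U. h x = v})" by (rule card_UN_le[OF \<F>(1)])
    also have "\<dots> \<le> (\<Sum>U\<in>\<F>. 1)" using one by (intro sum_mono) blast
    finally show ?thesis using finite_subset[OF sub fin] by simp
  qed
  then show ?thesis by blast
qed

lemma Hausdorff_finite_disjoint_nbds:
  assumes X: "Hausdorff_space X" and B: "finite B" "B \<subseteq> topspace X"
  obtains Q where "\<And>x. x \<in> B \<Longrightarrow> openin X (Q x)" "\<And>x. x \<in> B \<Longrightarrow> x \<in> Q x"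
    "\<And>x y. x \<in> B \<Longrightarrow> y \<in> B \<Longrightarrow> x \<noteq> y \<Longrightarrow> Q x \<inter> Q y = {}"
proof -
  have "\<forall>x\<in>B. \<forall>y\<in>B. \<exists>U V. x \<noteq> y \<longrightarrow> openin X U \<and> openin X V \<and> x \<in> U \<and> y \<in> V \<and> U \<inter> V = {}"
  proof (intro ballI)
    fix x y assume "x \<in> B" "y \<in> B"
    then have "x \<in> topspace X" "y \<in> topspace X" using B by auto
    then show "\<exists>U V. x \<noteq> y \<longrightarrow> openin X U \<and> openin X V \<and> x \<in> U \<and> y \<in> V \<and> U \<inter> V = {}"
      using X unfolding Hausdorff_space_def disjnt_def by meson
  qed
  then obtain U V where UV: "\<And>x y. x \<in> B \<Longrightarrow> y \<in> B \<Longrightarrow> x \<noteq> y \<Longrightarrow>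
      openin X (U x y) \<and> openin X (V x y) \<and> x \<in> U x y \<and> y \<in> V x y \<and> U x y \<inter> V x y = {}"
    by metis
  \<comment> \<open>The sets chosen for \<open>(x, y)\<close> and for \<open>(y, x)\<close> are
    unrelated, so \<open>Q x\<close> is placed in \<open>U x y\<close> and in \<open>V y x\<close>.
    Intersecting with the space matters for a one-point \<open>B\<close>, where the intersection
    over \<open>y\<close> is the whole type.\<close>
  define Q where "Q = (\<lambda>x. (\<Inter>y\<in>B - {x}. U x y \<inter> V y x) \<inter> topspace X)"
  show thesis
  proof (rule that[of Q])
    show "openin X (Q x)" if "x \<in> B" for x
      unfolding Q_def using B that UV by (intro openin_INT openin_Int) auto
    show "x \<in> Q x" if "x \<in> B" for x
      using that B UV by (auto simp: Q_def)
    show "Q x \<inter> Q y = {}" if xy: "x \<in> B" "y \<in> B" "x \<noteq> y" for x y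
    proof -
      have "Q x \<subseteq> U x y" "Q y \<subseteq> V x y" using xy by (auto simp: Q_def)
      then show ?thesis using UV[OF xy] by blast
    qed
  qed
qed

lemma continuous_map_mult:
  fixes f g :: "'a \<Rightarrow> 'b::real_normed_algebra"
  shows "continuous_map X euclidean f \<Longrightarrow> continuous_map X euclidean g \<Longrightarrow> continuous_map X euclidean (\<lambda>x. f x * g x)"
  by (simp add: continuous_map_atin tendsto_mult)

lemma locally_compact_bump:
  assumes "locally_compact_space X" "Hausdorff_space X" "openin X W" "x \<in> W"
  obtains f :: "'a \<Rightarrow> real" and K where "continuous_map X euclidean f" "f x = 1"
    "compactin X K" "K \<subseteq> W" "\<And>y. y \<in> topspace X \<Longrightarrow> y \<notin> K \<Longrightarrow> f y = 0"
proof -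
  have "neighbourhood_base_of (compactin X) X"
    using locally_compact_space_neighbourhood_base assms by blast
  then obtain U K where UK: "openin X U" "compactin X K" "x \<in> U" "U \<subseteq> K" "K \<subseteq> W"
    using assms(3,4) unfolding neighbourhood_base_of by metis
  have "completely_regular_space X"
    using locally_compact_regular_imp_completely_regular_space assms by blast
  moreover have "closedin X (topspace X - U)" "x \<in> topspace X - (topspace X - U)"
    using UK openin_subset by blast+
  ultimately obtain f :: "'a \<Rightarrow> real" where f: "continuous_map X (top_of_set {0..1}) f" "f x = 0" "f ` (topspace X - U) \<subseteq> {1}"
    unfolding completely_regular_space_def by meson
  show thesis
  \<comment> \<open>Complete regularity gives a function that is 0 at \<open>x\<close> and 1 off
    \<open>U\<close>; the bump is its complement.\<close>
  proof (rule that[of "\<lambda>y. 1 - f y" K])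
    show "continuous_map X euclidean (\<lambda>y. 1 - f y)"
      using continuous_map_into_fulltopology[OF f(1)] by (intro continuous_intros)
  qed (use f UK in auto)
qed

text \<open>In a Hausdorff space a compact set containing the nonzero points also contains their
  closure. So it suffices to exhibit some compact set, such as a product of two supports, without
  computing closures.\<close>

lemma Cc_iff:
  assumes "Hausdorff_space (gtop H)"
  shows "f \<in> Cc H \<longleftrightarrow> continuous_map (gtop H) euclidean f \<and> (\<forall>\<gamma>. \<gamma> \<notin> arrows H \<longrightarrow> f \<gamma> = 0) \<and>
    (\<exists>K. compactin (gtop H) K \<and> (\<forall>\<gamma>. f \<gamma> \<noteq> 0 \<longrightarrow> \<gamma> \<in> K))" (is "_ \<longleftrightarrow> ?cont \<and> ?zero \<and> ?supp")
proof (cases "?cont \<and> ?zero")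
  case True
  let ?S = "{\<gamma> \<in> arrows H. f \<gamma> \<noteq> 0}"
  have S: "?S \<subseteq> gtop H closure_of ?S"
    by (rule closure_of_subset) (auto simp: arrows_def)
  have "compactin (gtop H) (gtop H closure_of ?S)" if K: "compactin (gtop H) K" "\<forall>\<gamma>. f \<gamma> \<noteq> 0 \<longrightarrow> \<gamma> \<in> K" for K
  proof (rule closed_compactin[OF K(1)])
    show "gtop H closure_of ?S \<subseteq> K"
      using K compactin_imp_closedin[OF assms K(1)] by (intro closure_of_minimal) auto
  qed simp
  then show ?thesis using True S unfolding Cc_def by blast
qed (auto simp: Cc_def)

section \<open>Etale groupoids\<close>

locale lch_etale_groupoid =
  fixes G :: "'g top_groupoid"
  assumes etale: "etale_groupoid G"
    and lc: "locally_compact_space (gtop G)"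
    and Haus: "Hausdorff_space (gtop G)"

sublocale lch_etale_groupoid \<subseteq> alg_groupoid
  using etale by unfold_locales (simp add: etale_groupoid_def topological_groupoid_def)

context lch_etale_groupoid
begin

lemma local_homeo_src: "local_homeomorphism (gtop G) (subtopology (gtop G) (units G)) (src G)"
  and local_homeo_rng: "local_homeomorphism (gtop G) (subtopology (gtop G) (units G)) (rng G)"
  and cont_ginv: "continuous_map (gtop G) (gtop G) (ginv G)"
  and cont_mult: "continuous_map (subtopology (prod_topology (gtop G) (gtop G)) (composable G)) (gtop G)
       (\<lambda>(\<alpha>, \<beta>). mult G \<alpha> \<beta>)"
  using etale by (auto simp: etale_groupoid_def topological_groupoid_def)

section \<open>Continuity of the structure maps, the unit space and local sections\<close>

lemma cont_src: "continuous_map (gtop G) (gtop G) (src G)"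
  by (rule continuous_map_into_fulltopology[OF local_homeomorphism_imp_continuous_map[OF local_homeo_src]])

lemma cont_rng: "continuous_map (gtop G) (gtop G) (rng G)"
  by (rule continuous_map_into_fulltopology[OF local_homeomorphism_imp_continuous_map[OF local_homeo_rng]])

lemma openin_arrows: "openin (gtop G) U \<Longrightarrow> x \<in> U \<Longrightarrow> x \<in> arrows G"
  unfolding arrows_def using openin_subset by blast

text \<open>If \<gamma> and \<open>src G \<gamma>\<close> both lie in an open set on which the
  source map is injective, then they coincide, because they have the same source. By continuity this
  happens for all \<gamma> near a unit.\<close>

lemma openin_units: "openin (gtop G) (units G)"
proof (subst openin_subopen, intro ballI)
  fix u assume u: "u \<in> units G"
  then have "u \<in> topspace (gtop G)" using units_arrows by (simp add: arrows_def)
  then obtain U where U: "openin (gtop G) U" "u \<in> U" "inj_on (src G) U"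
    using local_homeomorphism_imp_locally_inj[OF local_homeo_src] by blast
  define V where "V = U \<inter> {\<gamma> \<in> topspace (gtop G). src G \<gamma> \<in> U}"
  have "openin (gtop G) V"
    unfolding V_def using U(1) openin_continuous_map_preimage[OF cont_src U(1)] by blast
  moreover have "u \<in> V" using U u \<open>u \<in> topspace (gtop G)\<close> by (simp add: V_def src_unit)
  moreover have "V \<subseteq> units G"
  proof
    fix \<gamma> assume "\<gamma> \<in> V"
    then have \<gamma>: "\<gamma> \<in> arrows G" "\<gamma> \<in> U" "src G \<gamma> \<in> U" by (auto simp: V_def arrows_def)
    then have "\<gamma> = src G \<gamma>" using inj_onD[OF U(3), of \<gamma> "src G \<gamma>"] by simp
    then show "\<gamma> \<in> units G" using \<gamma> src_in_units by metis
  qed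
  ultimately show "\<exists>T. openin (gtop G) T \<and> u \<in> T \<and> T \<subseteq> units G" by blast
qed

lemma openin_src_image: "openin (gtop G) U \<Longrightarrow> openin (gtop G) (src G ` U)"
  using local_homeomorphism_imp_open_map[OF local_homeo_src] openin_units openin_trans_full
  unfolding open_map_def by blast

lemma local_section:
  assumes "\<gamma> \<in> arrows G"
  obtains U \<sigma> where "openin (gtop G) U" "\<gamma> \<in> U"
    "continuous_map (subtopology (gtop G) (src G ` U)) (gtop G) \<sigma>" "\<And>x. x \<in> U \<Longrightarrow> \<sigma> (src G x) = x"
proof -
  obtain U where U: "openin (gtop G) U" "\<gamma> \<in> U"
    "homeomorphic_map (subtopology (gtop G) U) (subtopology (subtopology (gtop G) (units G)) (src G ` U)) (src G)"
    using assms local_homeo_src unfolding local_homeomorphism_def arrows_def by blast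
  have sub: "units G \<inter> src G ` U = src G ` U" using openin_arrows[OF U(1)] by auto
  from U(3) obtain \<sigma> where \<sigma>: "homeomorphic_maps (subtopology (gtop G) U) (subtopology (gtop G) (src G ` U)) (src G) \<sigma>"
    unfolding subtopology_subtopology sub homeomorphic_map_maps by blast
  then have "continuous_map (subtopology (gtop G) (src G ` U)) (subtopology (gtop G) U) \<sigma>"
    by (simp add: homeomorphic_maps_def)
  then have "continuous_map (subtopology (gtop G) (src G ` U)) (gtop G) \<sigma>"
    by (rule continuous_map_into_fulltopology)
  moreover have "\<sigma> (src G x) = x" if "x \<in> U" for x
    using \<sigma> that openin_arrows[OF U(1)] unfolding homeomorphic_maps_def by (auto simp: arrows_def)
  ultimately show thesis using that U by blast
qed

lemma continuous_dv:
  assumes a: "continuous_map Z (gtop G) a" and b: "continuous_map Z (gtop G) b"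
    and eq: "\<And>z. z \<in> topspace Z \<Longrightarrow> src G (a z) = src G (b z)"
  shows "continuous_map Z (gtop G) (\<lambda>z. dv G (a z) (b z))"
proof -
  have arr: "a z \<in> arrows G" "b z \<in> arrows G" if "z \<in> topspace Z" for z
    using that a b by (auto simp: continuous_map_def arrows_def)
  have "continuous_map Z (gtop G) (\<lambda>z. ginv G (b z))"
    using continuous_map_compose[OF b cont_ginv] by (simp add: o_def)
  with a have "continuous_map Z (subtopology (prod_topology (gtop G) (gtop G)) (composable G)) (\<lambda>z. (a z, ginv G (b z)))"
    unfolding continuous_map_in_subtopology
    by (intro conjI continuous_map_pairedI) (auto simp: composable_def arr eq)
  from continuous_map_compose[OF this cont_mult] show ?thesis by (simp add: o_def)
qed

text \<open>Used to make the composable part of a product of compact sets compact.\<close>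

lemma closedin_composable: "closedin (prod_topology (gtop G) (gtop G)) (composable G)"
proof -
  let ?P = "prod_topology (gtop G) (gtop G)"
  have "closedin ?P {z \<in> topspace ?P. (src G \<circ> fst) z = (rng G \<circ> snd) z}"
    by (rule closedin_continuous_maps_eq[OF Haus])
      (intro continuous_map_compose[OF continuous_map_fst cont_src]
        continuous_map_compose[OF continuous_map_snd cont_rng])+
  also have "{z \<in> topspace ?P. (src G \<circ> fst) z = (rng G \<circ> snd) z} = composable G"
    by (auto simp: composable_def arrows_def)
  finally show ?thesis .
qed

section \<open>Compactly supported functions: finiteness on fibres and algebra operations\<close>

definition set_mult :: "'g set \<Rightarrow> 'g set \<Rightarrow> 'g set" where
  "set_mult K L = (\<lambda>(\<alpha>, \<beta>). mult G \<alpha> \<beta>) ` (composable G \<inter> K \<times> L)"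

lemma compactin_set_mult:
  assumes "compactin (gtop G) K" "compactin (gtop G) L"
  shows "compactin (gtop G) (set_mult K L)"
  unfolding set_mult_def
proof (rule image_compactin[OF _ cont_mult])
  have "compactin (prod_topology (gtop G) (gtop G)) (K \<times> L)"
    using assms by (simp add: compactin_Times)
  then show "compactin (subtopology (prod_topology (gtop G) (gtop G)) (composable G)) (composable G \<inter> K \<times> L)"
    unfolding compactin_subtopology using closed_Int_compactin[OF closedin_composable] by blast
qed

lemma conv_support:
  assumes "\<And>\<gamma>. f \<gamma> \<noteq> 0 \<Longrightarrow> \<gamma> \<in> K" "\<And>\<gamma>. g \<gamma> \<noteq> 0 \<Longrightarrow> \<gamma> \<in> L" "conv G f g \<gamma> \<noteq> 0"
  shows "\<gamma> \<in> set_mult K L"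
proof (rule ccontr)
  assume *: "\<gamma> \<notin> set_mult K L"
  have "f (dv G \<gamma> \<beta>) * g \<beta> = 0" if "\<gamma> \<in> arrows G" "\<beta> \<in> src_fibre G (src G \<gamma>)" for \<beta>
  proof (rule ccontr)
    assume "f (dv G \<gamma> \<beta>) * g \<beta> \<noteq> 0"
    then have "(dv G \<gamma> \<beta>, \<beta>) \<in> composable G \<inter> K \<times> L"
      using assms that by (auto simp: composable_def)
    then have "mult G (dv G \<gamma> \<beta>) \<beta> \<in> set_mult K L"
      unfolding set_mult_def by (metis (no_types, lifting) case_prod_conv image_eqI)
    then show False using * that by simp
  qed
  then have "conv G f g \<gamma> = 0" by (auto simp: conv_eq_infsum intro!: infsum_0)
  then show False using assms(3) by simp
qed

lemma Cc_cont: "f \<in> Cc G \<Longrightarrow> continuous_map (gtop G) euclidean f"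
  and Cc_zero: "f \<in> Cc G \<Longrightarrow> \<gamma> \<notin> arrows G \<Longrightarrow> f \<gamma> = 0"
  by (auto simp: Cc_def)

lemma Cc_support:
  assumes "f \<in> Cc G"
  obtains K where "compactin (gtop G) K" "\<And>\<gamma>. f \<gamma> \<noteq> 0 \<Longrightarrow> \<gamma> \<in> K"
  using assms unfolding Cc_iff[OF Haus] by blast

text \<open>The source and range maps are locally injective, so
  \<open>compactin_fibres_bounded\<close> applies to both on a compact set containing the
  support.\<close>

lemma Cc_fibre_finite:
  assumes f: "f \<in> Cc G"
  shows "fibre_finite G f"
proof -
  obtain K where K: "compactin (gtop G) K" "\<And>\<gamma>. f \<gamma> \<noteq> 0 \<Longrightarrow> \<gamma> \<in> K"
    using f by (rule Cc_support) blast
  have "compactin euclidean (f ` K)" by (rule image_compactin[OF K(1) Cc_cont[OF f]])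
  then have "bounded (f ` K)" by (simp add: compact_imp_bounded)
  then obtain M where M: "\<And>\<gamma>. \<gamma> \<in> K \<Longrightarrow> cmod (f \<gamma>) \<le> M" unfolding bounded_iff by blast
  \<comment> \<open>\<open>M\<close> bounds \<open>f\<close> on \<open>K\<close> only, and could be
    negative if \<open>K\<close> is empty.\<close>
  have "cmod (f \<gamma>) \<le> max M 0" for \<gamma>
    using M[of \<gamma>] K(2)[of \<gamma>] by (cases "f \<gamma> = 0") auto
  moreover obtain N1 where N1: "\<And>v. finite {x \<in> K. src G x = v} \<and> card {x \<in> K. src G x = v} \<le> N1"
    using compactin_fibres_bounded[OF K(1) local_homeomorphism_imp_locally_inj[OF local_homeo_src]] by blast
  obtain N2 where N2: "\<And>v. finite {x \<in> K. rng G x = v} \<and> card {x \<in> K. rng G x = v} \<le> N2"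
    using compactin_fibres_bounded[OF K(1) local_homeomorphism_imp_locally_inj[OF local_homeo_rng]] by blast
  have "finite {\<gamma> \<in> arrows G. src G \<gamma> = u \<and> f \<gamma> \<noteq> 0} \<and> card {\<gamma> \<in> arrows G. src G \<gamma> = u \<and> f \<gamma> \<noteq> 0} \<le> max N1 N2 \<and>
             finite {\<gamma> \<in> arrows G. rng G \<gamma> = u \<and> f \<gamma> \<noteq> 0} \<and> card {\<gamma> \<in> arrows G. rng G \<gamma> = u \<and> f \<gamma> \<noteq> 0} \<le> max N1 N2" for u
  proof -
    have "{\<gamma> \<in> arrows G. src G \<gamma> = u \<and> f \<gamma> \<noteq> 0} \<subseteq> {x \<in> K. src G x = u}"
      "{\<gamma> \<in> arrows G. rng G \<gamma> = u \<and> f \<gamma> \<noteq> 0} \<subseteq> {x \<in> K. rng G x = u}"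
      using K(2) by auto
    then show ?thesis using N1[of u] N2[of u]
      by (meson card_mono finite_subset max.coboundedI1 max.coboundedI2 order_trans)
  qed
  ultimately show ?thesis unfolding fibre_finite_def using Cc_zero[OF f] by blast
qed

lemma Cc_zero_fun: "(\<lambda>_. 0) \<in> Cc G"
  unfolding Cc_iff[OF Haus] by (auto intro!: exI[of _ "{}"])

lemma Cc_add:
  assumes "f \<in> Cc G" "g \<in> Cc G"
  shows "(\<lambda>\<gamma>. f \<gamma> + g \<gamma>) \<in> Cc G"
proof -
  obtain K where K: "compactin (gtop G) K" "\<And>\<gamma>. f \<gamma> \<noteq> 0 \<Longrightarrow> \<gamma> \<in> K"
    using assms(1) by (rule Cc_support) blast
  obtain L where L: "compactin (gtop G) L" "\<And>\<gamma>. g \<gamma> \<noteq> 0 \<Longrightarrow> \<gamma> \<in> L"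
    using assms(2) by (rule Cc_support) blast
  have "\<gamma> \<in> K \<union> L" if "f \<gamma> + g \<gamma> \<noteq> 0" for \<gamma> using that K(2)[of \<gamma>] L(2)[of \<gamma>] by force
  then have "\<exists>K. compactin (gtop G) K \<and> (\<forall>\<gamma>. f \<gamma> + g \<gamma> \<noteq> 0 \<longrightarrow> \<gamma> \<in> K)"
    using compactin_Un[OF K(1) L(1)] by blast
  moreover have "continuous_map (gtop G) euclidean (\<lambda>\<gamma>. f \<gamma> + g \<gamma>)"
    by (intro continuous_map_add Cc_cont assms)
  ultimately show ?thesis unfolding Cc_iff[OF Haus] by (simp add: Cc_zero[OF assms(1)] Cc_zero[OF assms(2)])
qed

lemma Cc_scale:
  assumes "f \<in> Cc G"
  shows "(\<lambda>\<gamma>. c * f \<gamma>) \<in> Cc G"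
proof -
  obtain K where K: "compactin (gtop G) K" "\<And>\<gamma>. f \<gamma> \<noteq> 0 \<Longrightarrow> \<gamma> \<in> K"
    using assms(1) by (rule Cc_support) blast
  then have "\<exists>K. compactin (gtop G) K \<and> (\<forall>\<gamma>. c * f \<gamma> \<noteq> 0 \<longrightarrow> \<gamma> \<in> K)"
    by auto
  moreover have "continuous_map (gtop G) euclidean (\<lambda>\<gamma>. c * f \<gamma>)"
    by (intro continuous_map_mult continuous_map_canonical_const Cc_cont assms)
  ultimately show ?thesis unfolding Cc_iff[OF Haus] by (simp add: Cc_zero[OF assms])
qed

lemma Cc_diff: "f \<in> Cc G \<Longrightarrow> g \<in> Cc G \<Longrightarrow> (\<lambda>\<gamma>. f \<gamma> - g \<gamma>) \<in> Cc G"
  using Cc_add[OF _ Cc_scale[of g "-1"], of f] by simp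

lemma Cc_invol:
  assumes "f \<in> Cc G"
  shows "invol G f \<in> Cc G"
proof -
  obtain K where K: "compactin (gtop G) K" "\<And>\<gamma>. f \<gamma> \<noteq> 0 \<Longrightarrow> \<gamma> \<in> K"
    using assms(1) by (rule Cc_support) blast
  have "continuous_map (gtop G) euclidean (cnj \<circ> (f \<circ> ginv G))"
    by (intro continuous_map_compose[OF continuous_map_compose[OF cont_ginv Cc_cont[OF assms]]])
      (simp add: continuous_on_cnj)
  then have "continuous_map (gtop G) euclidean (invol G f)"
    by (rule continuous_map_eq) (auto simp: invol_def arrows_def)
  moreover have "compactin (gtop G) (ginv G ` K)" by (rule image_compactin[OF K(1) cont_ginv])
  moreover have "\<gamma> \<in> ginv G ` K" if "invol G f \<gamma> \<noteq> 0" for \<gamma>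
    using that K(2)[of "ginv G \<gamma>"] by (intro image_eqI[of _ _ "ginv G \<gamma>"]) (auto simp: invol_def split: if_splits)
  ultimately show ?thesis unfolding Cc_iff[OF Haus] by (auto simp: invol_def)
qed

text \<open>Near \<open>\<gamma>\<^sub>0\<close>, the fibre of the support of \<open>g\<close> over \<open>src \<gamma>\<close> is contained in the values at \<open>src \<gamma>\<close> of
  finitely many local sections of the source map, so the convolution is locally a finite sum of
  continuous functions.\<close>

lemma continuous_map_conv:
  assumes f: "f \<in> Cc G" and g: "g \<in> Cc G"
  shows "continuous_map (gtop G) euclidean (conv G f g)"
proof (rule continuous_map_locallyI)
  let ?X = "gtop G"
  fix \<gamma>0 assume \<gamma>0: "\<gamma>0 \<in> topspace ?X"
  then have a0: "\<gamma>0 \<in> arrows G" by (simp add: arrows_def)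
  obtain K where K: "compactin ?X K" "\<And>\<gamma>. g \<gamma> \<noteq> 0 \<Longrightarrow> \<gamma> \<in> K"
    using g by (rule Cc_support) blast
  define B where "B = {\<beta> \<in> K. src G \<beta> = src G \<gamma>0}"
  have finB: "finite B"
    using compactin_fibres_bounded[OF K(1) local_homeomorphism_imp_locally_inj[OF local_homeo_src]]
    unfolding B_def by blast
  have B_sub: "B \<subseteq> topspace ?X" "B \<subseteq> arrows G"
    using compactin_subset_topspace[OF K(1)] by (auto simp: B_def arrows_def)
  have "\<forall>\<beta>\<in>B. \<exists>U \<sigma>. openin ?X U \<and> \<beta> \<in> U \<and>
      continuous_map (subtopology ?X (src G ` U)) ?X \<sigma> \<and> (\<forall>x\<in>U. \<sigma> (src G x) = x)"
  proof
    fix \<beta> assume "\<beta> \<in> B"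
    then have "\<beta> \<in> arrows G" using B_sub by blast
    then obtain U \<sigma> where "openin ?X U" "\<beta> \<in> U"
      "continuous_map (subtopology ?X (src G ` U)) ?X \<sigma>" "\<And>x. x \<in> U \<Longrightarrow> \<sigma> (src G x) = x"
      by (rule local_section) blast
    then show "\<exists>U \<sigma>. openin ?X U \<and> \<beta> \<in> U \<and>
      continuous_map (subtopology ?X (src G ` U)) ?X \<sigma> \<and> (\<forall>x\<in>U. \<sigma> (src G x) = x)" by blast
  qed
  then obtain U \<sigma> where U: "\<And>\<beta>. \<beta> \<in> B \<Longrightarrow> openin ?X (U \<beta>)" "\<And>\<beta>. \<beta> \<in> B \<Longrightarrow> \<beta> \<in> U \<beta>"
    and \<sigma>: "\<And>\<beta>. \<beta> \<in> B \<Longrightarrow> continuous_map (subtopology ?X (src G ` U \<beta>)) ?X (\<sigma> \<beta>)"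
      "\<And>\<beta> x. \<beta> \<in> B \<Longrightarrow> x \<in> U \<beta> \<Longrightarrow> \<sigma> \<beta> (src G x) = x"
    by metis
  obtain Q where Q: "\<And>x. x \<in> B \<Longrightarrow> openin ?X (Q x)" "\<And>x. x \<in> B \<Longrightarrow> x \<in> Q x"
    "\<And>x y. x \<in> B \<Longrightarrow> y \<in> B \<Longrightarrow> x \<noteq> y \<Longrightarrow> Q x \<inter> Q y = {}"
    using Hausdorff_finite_disjoint_nbds[OF Haus finB B_sub(1)] by blast
  define W where "W = (\<lambda>\<beta>. U \<beta> \<inter> Q \<beta>)"
  have W: "openin ?X (W \<beta>)" "\<beta> \<in> W \<beta>" if "\<beta> \<in> B" for \<beta>
    using that U Q by (auto simp: W_def)
  \<comment> \<open>The part of \<open>K\<close> missed by the chosen sets. It is compact and has no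
    point over \<open>src G \<gamma>0\<close>, so its image under the source map can be removed from
    a neighbourhood of \<open>src G \<gamma>0\<close>.\<close>
  define L where "L = K - (\<Union>\<beta>\<in>B. W \<beta>)"
  have "openin ?X (\<Union>\<beta>\<in>B. W \<beta>)" using W by blast
  then have "closedin ?X L"
    unfolding L_def by (rule closedin_diff[OF compactin_imp_closedin[OF Haus K(1)]])
  then have "compactin ?X L" by (rule closed_compactin[OF K(1), rotated]) (auto simp: L_def)
  then have "closedin ?X (src G ` L)"
    by (intro compactin_imp_closedin[OF Haus] image_compactin[OF _ cont_src])
  moreover have "openin ?X ((\<Inter>\<beta>\<in>B. src G ` W \<beta>) \<inter> topspace ?X)"
    using finB W openin_src_image by (intro openin_INT) auto
  ultimately have openV: "openin ?X (((\<Inter>\<beta>\<in>B. src G ` W \<beta>) \<inter> topspace ?X) - src G ` L)" (is "openin _ ?V")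
    by blast
  \<comment> \<open>For \<gamma> in \<open>N\<close> each section has a value over
    \<open>src G \<gamma>\<close>, and every arrow of \<open>K\<close> over
    \<open>src G \<gamma>\<close> lies in some \<open>W \<beta>\<close>.\<close>
  define N where "N = {\<gamma> \<in> topspace ?X. src G \<gamma> \<in> ?V}"
  have openN: "openin ?X N" unfolding N_def by (rule openin_continuous_map_preimage[OF cont_src openV])
  have "src G \<gamma>0 \<in> src G ` W \<beta>" if "\<beta> \<in> B" for \<beta>
    using W(2)[OF that] that by (auto simp: B_def intro!: image_eqI[of _ _ \<beta>])
  moreover have "src G \<gamma>0 \<notin> src G ` L"
  proof
    assume "src G \<gamma>0 \<in> src G ` L"
    then obtain x where "x \<in> L" "src G x = src G \<gamma>0" by auto
    then have "x \<in> B" "x \<notin> (\<Union>\<beta>\<in>B. W \<beta>)" by (auto simp: L_def B_def)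
    then show False using W(2) by blast
  qed
  moreover have "src G \<gamma>0 \<in> topspace ?X" using a0 src_arrow[of \<gamma>0] by (simp add: arrows_def)
  ultimately have "\<gamma>0 \<in> N" unfolding N_def using \<gamma>0 by blast
  have topN: "topspace (subtopology ?X N) = N" using openin_subset[OF openN] by auto
  define t where "t = (\<lambda>\<beta> \<gamma>. \<sigma> \<beta> (src G \<gamma>))"
  have t: "t \<beta> \<gamma> \<in> W \<beta>" "src G (t \<beta> \<gamma>) = src G \<gamma>" "t \<beta> \<gamma> \<in> arrows G" if "\<beta> \<in> B" "\<gamma> \<in> N" for \<beta> \<gamma>
  proof -
    have "src G \<gamma> \<in> src G ` W \<beta>" using that by (auto simp: N_def)
    then obtain x where x: "x \<in> W \<beta>" "src G \<gamma> = src G x" by auto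
    then have "t \<beta> \<gamma> = x" using \<sigma>(2) that by (auto simp: t_def W_def)
    then show "t \<beta> \<gamma> \<in> W \<beta>" "src G (t \<beta> \<gamma>) = src G \<gamma>" "t \<beta> \<gamma> \<in> arrows G"
      using x openin_arrows[OF W(1)[OF that(1)]] by auto
  qed
  have contt: "continuous_map (subtopology ?X N) ?X (t \<beta>)" if "\<beta> \<in> B" for \<beta>
  proof -
    have "src G ` N \<subseteq> src G ` U \<beta>" using that by (auto simp: N_def W_def)
    then have "continuous_map (subtopology ?X N) (subtopology ?X (src G ` U \<beta>)) (src G)"
      using continuous_map_from_subtopology[OF cont_src] by (auto simp: continuous_map_in_subtopology topN)
    from continuous_map_compose[OF this \<sigma>(1)[OF that]] show ?thesis by (simp add: t_def o_def)
  qed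
  have eq: "conv G f g \<gamma> = (\<Sum>\<beta>\<in>B. f (dv G \<gamma> (t \<beta> \<gamma>)) * g (t \<beta> \<gamma>))" if \<gamma>: "\<gamma> \<in> N" for \<gamma>
  proof -
    \<comment> \<open>The disjoint sets \<open>Q\<close> keep the sections apart, so no arrow is
      counted twice when the sum is indexed by \<open>B\<close>.\<close>
    have inj: "inj_on (\<lambda>\<beta>. t \<beta> \<gamma>) B"
    proof (rule inj_onI)
      fix \<beta> \<beta>' assume "\<beta> \<in> B" "\<beta>' \<in> B" "t \<beta> \<gamma> = t \<beta>' \<gamma>"
      then have "t \<beta> \<gamma> \<in> Q \<beta> \<inter> Q \<beta>'" using t(1)[OF _ \<gamma>] by (metis IntD2 IntI W_def)
      then show "\<beta> = \<beta>'" using Q(3) \<open>\<beta> \<in> B\<close> \<open>\<beta>' \<in> B\<close> by blast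
    qed
    have "conv G f g \<gamma> = (\<Sum>\<delta>\<in>(\<lambda>\<beta>. t \<beta> \<gamma>) ` B. f (dv G \<gamma> \<delta>) * g \<delta>)"
    proof (rule conv_eq_sum)
      show "\<gamma> \<in> arrows G" using \<gamma> by (simp add: N_def arrows_def)
      show "finite ((\<lambda>\<beta>. t \<beta> \<gamma>) ` B)" using finB by simp
      show "(\<lambda>\<beta>. t \<beta> \<gamma>) ` B \<subseteq> src_fibre G (src G \<gamma>)" using t[OF _ \<gamma>] by auto
      fix \<delta> assume \<delta>: "\<delta> \<in> src_fibre G (src G \<gamma>) - (\<lambda>\<beta>. t \<beta> \<gamma>) ` B"
      have "g \<delta> = 0"
      proof (rule ccontr)
        assume "g \<delta> \<noteq> 0"
        then have "\<delta> \<in> K" by (rule K(2))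
        moreover have "src G \<gamma> \<notin> src G ` L" using \<gamma> by (auto simp: N_def)
        then have "\<delta> \<notin> L" using \<delta> by (metis DiffD1 imageI in_src_fibre)
        ultimately obtain \<beta> where "\<beta> \<in> B" "\<delta> \<in> W \<beta>" by (auto simp: L_def)
        then have "\<sigma> \<beta> (src G \<delta>) = \<delta>" using \<sigma>(2) by (simp add: W_def)
        then have "\<delta> = t \<beta> \<gamma>" using \<delta> by (simp add: t_def)
        then show False using \<delta> \<open>\<beta> \<in> B\<close> by blast
      qed
      then show "f (dv G \<gamma> \<delta>) * g \<delta> = 0" by simp
    qed
    then show ?thesis by (simp add: sum.reindex[OF inj])
  qed
  have "continuous_map (subtopology ?X N) euclidean (\<lambda>\<gamma>. \<Sum>\<beta>\<in>B. f (dv G \<gamma> (t \<beta> \<gamma>)) * g (t \<beta> \<gamma>))"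
  proof (intro continuous_map_sum finB continuous_map_mult)
    fix \<beta> assume \<beta>: "\<beta> \<in> B"
    have "continuous_map (subtopology ?X N) ?X (\<lambda>\<gamma>. dv G \<gamma> (t \<beta> \<gamma>))"
      by (intro continuous_dv contt \<beta> continuous_map_from_subtopology)
        (use t \<beta> topN in auto)
    from continuous_map_compose[OF this Cc_cont[OF f]]
    show "continuous_map (subtopology ?X N) euclidean (\<lambda>\<gamma>. f (dv G \<gamma> (t \<beta> \<gamma>)))" by (simp add: o_def)
    from continuous_map_compose[OF contt[OF \<beta>] Cc_cont[OF g]]
    show "continuous_map (subtopology ?X N) euclidean (\<lambda>\<gamma>. g (t \<beta> \<gamma>))" by (simp add: o_def)
  qed
  then have "continuous_map (subtopology ?X N) euclidean (conv G f g)"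
    by (rule continuous_map_eq) (use eq topN in auto)
  then show "\<exists>U. openin ?X U \<and> \<gamma>0 \<in> U \<and> continuous_map (subtopology ?X U) euclidean (conv G f g)"
    using openN \<open>\<gamma>0 \<in> N\<close> by blast
qed

lemma Cc_conv:
  assumes "f \<in> Cc G" "g \<in> Cc G"
  shows "conv G f g \<in> Cc G"
proof -
  obtain K where K: "compactin (gtop G) K" "\<And>\<gamma>. f \<gamma> \<noteq> 0 \<Longrightarrow> \<gamma> \<in> K"
    using assms(1) by (rule Cc_support) blast
  obtain L where L: "compactin (gtop G) L" "\<And>\<gamma>. g \<gamma> \<noteq> 0 \<Longrightarrow> \<gamma> \<in> L"
    using assms(2) by (rule Cc_support) blast
  have "\<forall>\<gamma>. conv G f g \<gamma> \<noteq> 0 \<longrightarrow> \<gamma> \<in> set_mult K L"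
    using conv_support[of f K g L] K(2) L(2) by blast
  then show ?thesis unfolding Cc_iff[OF Haus]
    using continuous_map_conv[OF assms] compactin_set_mult[OF K(1) L(1)] by (auto simp: conv_eq_infsum)
qed

subsection \<open>The interior of the isotropy\<close>

abbreviation "Iso0 \<equiv> iso_interior G"

lemma openin_Iso0: "openin (gtop G) Iso0"
  by (simp add: iso_interior_def)

lemma Iso0_isotropy: "\<gamma> \<in> Iso0 \<Longrightarrow> \<gamma> \<in> isotropy G"
  using interior_of_subset[of "gtop G" "isotropy G"] by (auto simp: iso_interior_def)

lemma Iso0_arrows: "\<gamma> \<in> Iso0 \<Longrightarrow> \<gamma> \<in> arrows G"
  and Iso0_rng: "\<gamma> \<in> Iso0 \<Longrightarrow> rng G \<gamma> = src G \<gamma>"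
  using Iso0_isotropy by (auto simp: isotropy_def)

lemma openin_imp_Iso0:
  assumes "openin (gtop G) U" "U \<subseteq> isotropy G" "\<gamma> \<in> U"
  shows "\<gamma> \<in> Iso0"
  using assms interior_of_maximal unfolding iso_interior_def by blast

lemma units_Iso0: "units G \<subseteq> Iso0"
proof -
  have "units G \<subseteq> isotropy G" by (auto simp: isotropy_def units_arrows src_unit rng_unit)
  then show ?thesis using openin_imp_Iso0[OF openin_units] by blast
qed

lemma ginv_Iso0:
  assumes "\<gamma> \<in> Iso0"
  shows "ginv G \<gamma> \<in> Iso0"
proof (rule openin_imp_Iso0)
  show "openin (gtop G) {x \<in> topspace (gtop G). ginv G x \<in> Iso0}"
    by (rule openin_continuous_map_preimage[OF cont_ginv openin_Iso0])
  show "{x \<in> topspace (gtop G). ginv G x \<in> Iso0} \<subseteq> isotropy G"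
    using Iso0_rng by (fastforce simp: isotropy_def arrows_def[symmetric])
  show "ginv G \<gamma> \<in> {x \<in> topspace (gtop G). ginv G x \<in> Iso0}"
    using assms Iso0_arrows[OF assms] by (simp flip: arrows_def)
qed

text \<open>Take a local section through \<beta> with values in \<open>Iso0\<close> and divide by it
  on the right. The arrows whose quotient lies in \<open>Iso0\<close> form an open set, by
  continuity; it consists of isotropy and contains the product, whose quotient is \<alpha>.\<close>

lemma mult_Iso0:
  assumes \<alpha>: "\<alpha> \<in> Iso0" and \<beta>: "\<beta> \<in> Iso0" and eq: "src G \<alpha> = rng G \<beta>"
  shows "mult G \<alpha> \<beta> \<in> Iso0"
proof -
  note arr = Iso0_arrows[OF \<alpha>] Iso0_arrows[OF \<beta>]
  obtain U \<sigma> where U: "openin (gtop G) U" "\<beta> \<in> U"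
    and \<sigma>: "continuous_map (subtopology (gtop G) (src G ` U)) (gtop G) \<sigma>" "\<And>x. x \<in> U \<Longrightarrow> \<sigma> (src G x) = x"
    using arr(2) by (rule local_section) blast
  define N where "N = {\<gamma> \<in> topspace (gtop G). src G \<gamma> \<in> src G ` (U \<inter> Iso0)}"
  have openN: "openin (gtop G) N"
    unfolding N_def using U(1) openin_Iso0
    by (intro openin_continuous_map_preimage[OF cont_src] openin_src_image openin_Int)
  have topN: "topspace (subtopology (gtop G) N) = N" using openin_subset[OF openN] by auto
  define t where "t = (\<lambda>\<gamma>. \<sigma> (src G \<gamma>))"
  have t: "t \<gamma> \<in> Iso0 \<and> src G (t \<gamma>) = src G \<gamma>" if "\<gamma> \<in> N" for \<gamma>
    using that \<sigma>(2) by (auto simp: N_def t_def)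
  have "src G ` N \<subseteq> src G ` U" by (auto simp: N_def)
  then have "continuous_map (subtopology (gtop G) N) (subtopology (gtop G) (src G ` U)) (src G)"
    using continuous_map_from_subtopology[OF cont_src] by (auto simp: continuous_map_in_subtopology topN)
  from continuous_map_compose[OF this \<sigma>(1)]
  have contt: "continuous_map (subtopology (gtop G) N) (gtop G) t" by (simp add: t_def o_def)
  have "continuous_map (subtopology (gtop G) N) (gtop G) (\<lambda>\<gamma>. dv G \<gamma> (t \<gamma>))"
    by (intro continuous_dv contt continuous_map_from_subtopology) (use t topN in auto)
  from openin_continuous_map_preimage[OF this openin_Iso0] openN
  have "openin (gtop G) {\<gamma> \<in> N. dv G \<gamma> (t \<gamma>) \<in> Iso0}" unfolding topN by (rule openin_trans_full)
  moreover have "{\<gamma> \<in> N. dv G \<gamma> (t \<gamma>) \<in> Iso0} \<subseteq> isotropy G"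
  proof clarify
    fix \<gamma> assume \<gamma>: "\<gamma> \<in> N" "dv G \<gamma> (t \<gamma>) \<in> Iso0"
    have a: "\<gamma> \<in> arrows G" "t \<gamma> \<in> arrows G" "src G (t \<gamma>) = src G \<gamma>"
      using \<gamma> t Iso0_arrows by (auto simp: N_def arrows_def)
    have "rng G \<gamma> = rng G (dv G \<gamma> (t \<gamma>))" using a by simp
    also have "\<dots> = src G (dv G \<gamma> (t \<gamma>))" by (rule Iso0_rng[OF \<gamma>(2)])
    also have "\<dots> = rng G (t \<gamma>)" using a by simp
    also have "\<dots> = src G (t \<gamma>)" using t[OF \<gamma>(1)] Iso0_rng by blast
    finally show "\<gamma> \<in> isotropy G" using a by (simp add: isotropy_def)
  qed
  moreover have "mult G \<alpha> \<beta> \<in> {\<gamma> \<in> N. dv G \<gamma> (t \<gamma>) \<in> Iso0}"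
  proof -
    have "t (mult G \<alpha> \<beta>) = \<beta>" using U(2) \<sigma>(2) arr eq by (simp add: t_def)
    then show ?thesis using arr eq \<alpha> \<beta> U(2) by (auto simp: N_def simp flip: arrows_def)
  qed
  ultimately show ?thesis by (rule openin_imp_Iso0)
qed

lemma dv_Iso0: "\<alpha> \<in> Iso0 \<Longrightarrow> \<beta> \<in> Iso0 \<Longrightarrow> src G \<alpha> = src G \<beta> \<Longrightarrow> dv G \<alpha> \<beta> \<in> Iso0"
  by (simp add: mult_Iso0 ginv_Iso0 Iso0_arrows)

text \<open>The set where \<open>f\<close> is nonzero is open and contained in the isotropy, hence
  in its interior.\<close>

lemma continuous_zero_off_isotropy:
  fixes f :: "'g \<Rightarrow> complex"
  assumes "continuous_map (gtop G) euclidean f" "\<And>\<gamma>. \<gamma> \<notin> isotropy G \<Longrightarrow> f \<gamma> = 0" "\<gamma> \<notin> Iso0"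
  shows "f \<gamma> = 0"
proof (rule ccontr)
  assume "f \<gamma> \<noteq> 0"
  have "openin (gtop G) {x \<in> topspace (gtop G). f x \<in> - {0}}"
    by (rule openin_continuous_map_preimage[OF assms(1)]) auto
  moreover have "{x \<in> topspace (gtop G). f x \<in> - {0}} \<subseteq> isotropy G" using assms(2) by auto
  moreover have "\<gamma> \<in> {x \<in> topspace (gtop G). f x \<in> - {0}}"
    using \<open>f \<gamma> \<noteq> 0\<close> assms(2)[of \<gamma>] by (auto simp: isotropy_def arrows_def)
  ultimately show False using assms(3) openin_imp_Iso0 by blast
qed

section \<open>The interior of the isotropy as a groupoid and its function space\<close>

abbreviation "Iso_gpd \<equiv> iso_groupoid G"

lemma topspace_Iso: "topspace (subtopology (gtop G) Iso0) = Iso0"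
  using openin_subset[OF openin_Iso0] by auto

lemma arrows_Iso: "arrows Iso_gpd = Iso0"
  using topspace_Iso by (simp add: arrows_def iso_groupoid_def)

lemma Iso_alg: "alg_groupoid Iso_gpd"
proof
  show "algebraic_groupoid Iso_gpd"
    unfolding iso_groupoid_def
    by (rule algebraic_subgroupoid) (auto simp: topspace_Iso Iso0_arrows mult_Iso0 ginv_Iso0 units_Iso0[THEN subsetD] simp del: topspace_subtopology)
qed

lemma Iso_red_bounded_iff:
  assumes "\<And>\<gamma>. \<gamma> \<notin> Iso0 \<Longrightarrow> f \<gamma> = 0"
  shows "red_bounded Iso_gpd f c \<longleftrightarrow> red_bounded G f c"
  unfolding iso_groupoid_def
  by (rule red_bounded_subgroupoid_iff) (auto simp: topspace_Iso Iso0_arrows mult_Iso0 ginv_Iso0 units_Iso0[THEN subsetD] assms simp del: topspace_subtopology)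

text \<open>Functions are represented by zero off their arrows, so extension by zero leaves the
  representative unchanged. The point is that continuity on the open subgroupoid plus compact
  support there gives continuity on \<open>G\<close>.\<close>

lemma Cc_Iso_iff:
  "f \<in> Cc Iso_gpd \<longleftrightarrow> f \<in> Cc G \<and> (\<exists>K. compactin (gtop G) K \<and> K \<subseteq> Iso0 \<and> (\<forall>\<gamma>. f \<gamma> \<noteq> 0 \<longrightarrow> \<gamma> \<in> K))"
proof -
  have top: "gtop Iso_gpd = subtopology (gtop G) Iso0" by (simp add: iso_groupoid_def)
  have "Hausdorff_space (gtop Iso_gpd)" unfolding top by (rule Hausdorff_space_subtopology[OF Haus])
  note iff = Cc_iff[OF this, unfolded arrows_Iso top compactin_subtopology]
  show ?thesis
  proof
    assume f: "f \<in> Cc Iso_gpd"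
    then obtain K where K: "compactin (gtop G) K" "K \<subseteq> Iso0" "\<forall>\<gamma>. f \<gamma> \<noteq> 0 \<longrightarrow> \<gamma> \<in> K"
      and cont: "continuous_map (subtopology (gtop G) Iso0) euclidean f" and z: "\<And>\<gamma>. \<gamma> \<notin> Iso0 \<Longrightarrow> f \<gamma> = 0"
      unfolding iff by blast
    have "continuous_map (gtop G) euclidean f"
    proof (rule continuous_map_locallyI)
      fix x assume x: "x \<in> topspace (gtop G)"
      show "\<exists>U. openin (gtop G) U \<and> x \<in> U \<and> continuous_map (subtopology (gtop G) U) euclidean f"
      proof (cases "x \<in> Iso0")
        case True
        then show ?thesis using cont openin_Iso0 by blast
      next
        case False
        \<comment> \<open>\<open>K\<close> is closed in \<open>G\<close>, so a point off
          \<open>Iso0\<close> has a neighbourhood disjoint from \<open>K\<close>, and there the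
          function is zero.\<close>
        have "openin (gtop G) (topspace (gtop G) - K)"
          using compactin_imp_closedin[OF Haus K(1)] by blast
        moreover have "continuous_map (subtopology (gtop G) (topspace (gtop G) - K)) euclidean f"
          by (rule continuous_map_eq[of _ _ "\<lambda>_. 0"]) (use K(3) in auto)
        ultimately show ?thesis using x False K(2) by blast
      qed
    qed
    then show "f \<in> Cc G \<and> (\<exists>K. compactin (gtop G) K \<and> K \<subseteq> Iso0 \<and> (\<forall>\<gamma>. f \<gamma> \<noteq> 0 \<longrightarrow> \<gamma> \<in> K))"
      using K z Iso0_arrows unfolding Cc_iff[OF Haus] by blast
  next
    assume "f \<in> Cc G \<and> (\<exists>K. compactin (gtop G) K \<and> K \<subseteq> Iso0 \<and> (\<forall>\<gamma>. f \<gamma> \<noteq> 0 \<longrightarrow> \<gamma> \<in> K))"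
    then show "f \<in> Cc Iso_gpd"
      unfolding iff using Cc_cont continuous_map_from_subtopology by blast
  qed
qed

lemma Cc_Iso_Cc: "f \<in> Cc Iso_gpd \<Longrightarrow> f \<in> Cc G"
  by (simp add: Cc_Iso_iff)

lemma Cc_Iso_zero: "f \<in> Cc Iso_gpd \<Longrightarrow> \<gamma> \<notin> Iso0 \<Longrightarrow> f \<gamma> = 0"
  by (auto simp: Cc_Iso_iff)

lemma Cc_IsoE:
  assumes "f \<in> Cc Iso_gpd"
  obtains K where "compactin (gtop G) K" "K \<subseteq> Iso0" "\<And>\<gamma>. f \<gamma> \<noteq> 0 \<Longrightarrow> \<gamma> \<in> K"
  using assms unfolding Cc_Iso_iff by blast

text \<open>Extension by zero is isometric: each norm is the least constant in
  \<open>red_bounded\<close>, and the coset decomposition shows that the two groupoids admit the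
  same constants.\<close>

lemma reduced_norm_Iso:
  assumes f: "f \<in> Cc Iso_gpd"
  shows "reduced_norm Iso_gpd f = reduced_norm G f"
proof -
  have ff: "fibre_finite G f" using Cc_fibre_finite Cc_Iso_Cc f by blast
  have "fibre_finite Iso_gpd f"
    unfolding fibre_finite_def
  proof (intro conjI)
    show "\<forall>\<gamma>. \<gamma> \<notin> arrows Iso_gpd \<longrightarrow> f \<gamma> = 0" using Cc_Iso_zero[OF f] by (simp add: arrows_Iso)
    show "\<exists>M. \<forall>\<gamma>. cmod (f \<gamma>) \<le> M" using ff by (simp add: fibre_finite_def)
    \<comment> \<open>\<open>h\<close> stands for \<open>src\<close> or \<open>rng\<close>, so one
      identity handles both kinds of fibre.\<close>
    have eq: "{\<gamma> \<in> arrows Iso_gpd. h Iso_gpd \<gamma> = u \<and> f \<gamma> \<noteq> 0} = {\<gamma> \<in> arrows G. h G \<gamma> = u \<and> f \<gamma> \<noteq> 0}"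
      if "h Iso_gpd = h G" for h :: "'g top_groupoid \<Rightarrow> 'g \<Rightarrow> 'g" and u
      using Cc_Iso_zero[OF f] Iso0_arrows that by (auto simp: arrows_Iso)
    have "src Iso_gpd = src G" "rng Iso_gpd = rng G" by (simp_all add: iso_groupoid_def)
    from eq[of src, OF this(1)] eq[of rng, OF this(2)]
    show "\<exists>N. \<forall>u. finite {\<gamma> \<in> arrows Iso_gpd. src Iso_gpd \<gamma> = u \<and> f \<gamma> \<noteq> 0} \<and>
        card {\<gamma> \<in> arrows Iso_gpd. src Iso_gpd \<gamma> = u \<and> f \<gamma> \<noteq> 0} \<le> N \<and>
        finite {\<gamma> \<in> arrows Iso_gpd. rng Iso_gpd \<gamma> = u \<and> f \<gamma> \<noteq> 0} \<and>
        card {\<gamma> \<in> arrows Iso_gpd. rng Iso_gpd \<gamma> = u \<and> f \<gamma> \<noteq> 0} \<le> N"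
      using ff unfolding fibre_finite_def by simp
  qed
  then have "reduced_norm Iso_gpd f \<le> c \<longleftrightarrow> reduced_norm G f \<le> c" for c
    using alg_groupoid.reduced_norm_le_iff[OF Iso_alg] reduced_norm_le_iff[OF ff]
      Iso_red_bounded_iff[of f] Cc_Iso_zero[OF f] by simp
  then show ?thesis by (meson order_antisym order_refl)
qed

lemma Cc_Iso_add:
  assumes "f \<in> Cc Iso_gpd" "g \<in> Cc Iso_gpd"
  shows "(\<lambda>\<gamma>. f \<gamma> + g \<gamma>) \<in> Cc Iso_gpd"
proof -
  obtain K where K: "compactin (gtop G) K" "K \<subseteq> Iso0" "\<And>\<gamma>. f \<gamma> \<noteq> 0 \<Longrightarrow> \<gamma> \<in> K"
    using assms(1) by (rule Cc_IsoE) blast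
  obtain L where L: "compactin (gtop G) L" "L \<subseteq> Iso0" "\<And>\<gamma>. g \<gamma> \<noteq> 0 \<Longrightarrow> \<gamma> \<in> L"
    using assms(2) by (rule Cc_IsoE) blast
  have "\<gamma> \<in> K \<union> L" if "f \<gamma> + g \<gamma> \<noteq> 0" for \<gamma> using that K(3)[of \<gamma>] L(3)[of \<gamma>] by force
  then have "\<exists>K. compactin (gtop G) K \<and> K \<subseteq> Iso0 \<and> (\<forall>\<gamma>. f \<gamma> + g \<gamma> \<noteq> 0 \<longrightarrow> \<gamma> \<in> K)"
    using compactin_Un[OF K(1) L(1)] K(2) L(2) by blast
  then show ?thesis unfolding Cc_Iso_iff
    using assms by (auto simp: Cc_Iso_iff intro: Cc_add)
qed

lemma Cc_Iso_scale: "f \<in> Cc Iso_gpd \<Longrightarrow> (\<lambda>\<gamma>. c * f \<gamma>) \<in> Cc Iso_gpd"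
  unfolding Cc_Iso_iff using Cc_scale by auto

lemma Cc_Iso_invol:
  assumes f: "f \<in> Cc Iso_gpd"
  shows "invol G f \<in> Cc Iso_gpd"
proof -
  obtain K where K: "compactin (gtop G) K" "K \<subseteq> Iso0" "\<And>\<gamma>. f \<gamma> \<noteq> 0 \<Longrightarrow> \<gamma> \<in> K"
    using f by (rule Cc_IsoE) blast
  have "compactin (gtop G) (ginv G ` K)" by (rule image_compactin[OF K(1) cont_ginv])
  moreover have "\<gamma> \<in> ginv G ` K" if "invol G f \<gamma> \<noteq> 0" for \<gamma>
    using that K(3)[of "ginv G \<gamma>"] by (intro image_eqI[of _ _ "ginv G \<gamma>"]) (auto simp: invol_def split: if_splits)
  moreover have "ginv G ` K \<subseteq> Iso0" using K(2) ginv_Iso0 by auto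
  ultimately show ?thesis unfolding Cc_Iso_iff using Cc_invol[OF Cc_Iso_Cc[OF f]] by blast
qed

lemma Cc_Iso_conv:
  assumes "f \<in> Cc Iso_gpd" "g \<in> Cc Iso_gpd"
  shows "conv G f g \<in> Cc Iso_gpd"
proof -
  obtain K where K: "compactin (gtop G) K" "K \<subseteq> Iso0" "\<And>\<gamma>. f \<gamma> \<noteq> 0 \<Longrightarrow> \<gamma> \<in> K"
    using assms(1) by (rule Cc_IsoE) blast
  obtain L where L: "compactin (gtop G) L" "L \<subseteq> Iso0" "\<And>\<gamma>. g \<gamma> \<noteq> 0 \<Longrightarrow> \<gamma> \<in> L"
    using assms(2) by (rule Cc_IsoE) blast
  have "set_mult K L \<subseteq> Iso0"
    using K(2) L(2) by (auto simp: set_mult_def composable_def intro!: mult_Iso0)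
  moreover have "\<gamma> \<in> set_mult K L" if "conv G f g \<gamma> \<noteq> 0" for \<gamma>
    using conv_support[of f K g L] K(3) L(3) that by blast
  ultimately show ?thesis
    unfolding Cc_Iso_iff using Cc_conv assms Cc_Iso_Cc compactin_set_mult[OF K(1) L(1)] by blast
qed

text \<open>Applied to open sets of units, where the last conclusion makes the function an element
  of the subalgebra to commute with.\<close>

lemma Cc_units_bump:
  assumes "openin (gtop G) W" "x \<in> W"
  obtains f where "f \<in> Cc G" "f x = 1" "\<And>y. y \<notin> W \<Longrightarrow> f y = 0"
    "W \<subseteq> Iso0 \<Longrightarrow> f \<in> Cc Iso_gpd"
proof -
  obtain h :: "'g \<Rightarrow> real" and K where h: "continuous_map (gtop G) euclidean h" "h x = 1"
    "compactin (gtop G) K" "K \<subseteq> W" "\<And>y. y \<in> topspace (gtop G) \<Longrightarrow> y \<notin> K \<Longrightarrow> h y = 0"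
    using locally_compact_bump[OF lc Haus assms] by blast
  \<comment> \<open>\<open>h\<close> is arbitrary off the space, while members of
    \<open>Cc G\<close> must vanish there.\<close>
  define f where "f = (\<lambda>y. if y \<in> arrows G then complex_of_real (h y) else 0)"
  have "continuous_map (gtop G) euclidean (complex_of_real \<circ> h)"
    by (rule continuous_map_compose[OF h(1)]) (simp add: continuous_on_of_real)
  then have cont: "continuous_map (gtop G) euclidean f"
    by (rule continuous_map_eq) (auto simp: f_def arrows_def)
  have supp: "\<forall>\<gamma>. f \<gamma> \<noteq> 0 \<longrightarrow> \<gamma> \<in> K" using h(5) by (auto simp: f_def arrows_def)
  have "\<forall>\<gamma>. \<gamma> \<notin> arrows G \<longrightarrow> f \<gamma> = 0" by (simp add: f_def)
  with cont supp h(3) have Cc: "f \<in> Cc G" unfolding Cc_iff[OF Haus] by blast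
  show thesis
  proof (rule that[OF Cc])
    show "f x = 1" using h(2) openin_arrows[OF assms] by (simp add: f_def)
    show "f y = 0" if "y \<notin> W" for y using supp h(4) that by blast
    show "f \<in> Cc Iso_gpd" if "W \<subseteq> Iso0"
      unfolding Cc_Iso_iff using Cc h(3,4) supp that by blast
  qed
qed

end

section \<open>The reduced C*-algebra\<close>

context lch_etale_groupoid
begin

abbreviation "nrm \<equiv> reduced_norm G"
abbreviation "CS \<equiv> cauchy_seqs G"
abbreviation "cls \<equiv> Cred_class G"

section \<open>The reduced norm as a submultiplicative seminorm on compactly supported
  functions\<close>

lemma nrm_nonneg: "f \<in> Cc G \<Longrightarrow> 0 \<le> nrm f"
  by (simp add: reduced_norm_nonneg Cc_fibre_finite)

lemma nrm_leI: "f \<in> Cc G \<Longrightarrow> red_bounded G f c \<Longrightarrow> nrm f \<le> c"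
  using reduced_norm_le_iff Cc_fibre_finite by blast

lemma nrm_bounded: "f \<in> Cc G \<Longrightarrow> red_bounded G f (nrm f)"
  by (simp add: red_bounded_reduced_norm Cc_fibre_finite)

lemma nrm_add: "f \<in> Cc G \<Longrightarrow> g \<in> Cc G \<Longrightarrow> nrm (\<lambda>\<gamma>. f \<gamma> + g \<gamma>) \<le> nrm f + nrm g"
  by (intro nrm_leI Cc_add red_bounded_add nrm_bounded)

lemma nrm_scale_le: "f \<in> Cc G \<Longrightarrow> nrm (\<lambda>\<gamma>. c * f \<gamma>) \<le> cmod c * nrm f"
  by (intro nrm_leI Cc_scale red_bounded_scale nrm_bounded)

lemma nrm_conv: "f \<in> Cc G \<Longrightarrow> g \<in> Cc G \<Longrightarrow> nrm (conv G f g) \<le> nrm f * nrm g"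
  by (intro nrm_leI Cc_conv red_bounded_conv nrm_bounded Cc_fibre_finite)

lemma nrm_invol_le: "f \<in> Cc G \<Longrightarrow> nrm (invol G f) \<le> nrm f"
  by (intro nrm_leI Cc_invol red_bounded_invol nrm_bounded)

lemma nrm_zero: "nrm (\<lambda>_. 0) = 0"
  using nrm_scale_le[OF Cc_zero_fun, of 0] nrm_nonneg[OF Cc_zero_fun] by simp

lemma nrm_diff_commute:
  assumes "f \<in> Cc G" "g \<in> Cc G"
  shows "nrm (\<lambda>\<gamma>. f \<gamma> - g \<gamma>) = nrm (\<lambda>\<gamma>. g \<gamma> - f \<gamma>)"
  using nrm_scale_le[OF Cc_diff[OF assms], of "-1"] nrm_scale_le[OF Cc_diff[OF assms(2,1)], of "-1"] by simp

lemma nrm_diff_triangle: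
  assumes "f \<in> Cc G" "g \<in> Cc G" "h \<in> Cc G"
  shows "nrm (\<lambda>\<gamma>. f \<gamma> - h \<gamma>) \<le> nrm (\<lambda>\<gamma>. f \<gamma> - g \<gamma>) + nrm (\<lambda>\<gamma>. g \<gamma> - h \<gamma>)"
  using nrm_add[OF Cc_diff[OF assms(1,2)] Cc_diff[OF assms(2,3)]] by simp

lemma nrm_le_diff:
  assumes "f \<in> Cc G" "g \<in> Cc G"
  shows "nrm f \<le> nrm g + nrm (\<lambda>\<gamma>. f \<gamma> - g \<gamma>)"
  using nrm_add[OF assms(2) Cc_diff[OF assms]] by simp

lemma abs_nrm_diff_le:
  assumes "f \<in> Cc G" "g \<in> Cc G"
  shows "\<bar>nrm f - nrm g\<bar> \<le> nrm (\<lambda>\<gamma>. f \<gamma> - g \<gamma>)"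
  using nrm_le_diff[OF assms] nrm_le_diff[OF assms(2,1)] nrm_diff_commute[OF assms] by linarith

subsection \<open>Cauchy sequences\<close>

lemma CS_Cc: "X \<in> CS \<Longrightarrow> X n \<in> Cc G"
  by (simp add: cauchy_seqs_def)

lemma CS_diff_nonneg: "X \<in> CS \<Longrightarrow> Y \<in> CS \<Longrightarrow> 0 \<le> nrm (\<lambda>\<gamma>. X n \<gamma> - Y m \<gamma>)"
  by (intro nrm_nonneg Cc_diff) (simp_all add: CS_Cc)

lemma CS_eps:
  assumes "X \<in> CS" "\<epsilon> > 0"
  obtains N where "\<And>m n. m \<ge> N \<Longrightarrow> n \<ge> N \<Longrightarrow> nrm (\<lambda>\<gamma>. X m \<gamma> - X n \<gamma>) < \<epsilon>"
  using assms unfolding cauchy_seqs_def by blast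

lemma CS_const: "f \<in> Cc G \<Longrightarrow> (\<lambda>n. f) \<in> CS"
  by (simp add: cauchy_seqs_def nrm_zero)

lemma CS_bounded:
  assumes X: "X \<in> CS"
  obtains C where "C > 0" "\<And>n. nrm (X n) \<le> C"
proof -
  obtain N where N: "\<And>m n. m \<ge> N \<Longrightarrow> n \<ge> N \<Longrightarrow> nrm (\<lambda>\<gamma>. X m \<gamma> - X n \<gamma>) < 1"
    using CS_eps[OF X, of 1] by auto
  define C where "C = Max ((\<lambda>n. nrm (X n)) ` {..N}) + 1"
  have C: "nrm (X n) + 1 \<le> C" if "n \<le> N" for n
    using that by (simp add: C_def)
  have "nrm (X n) \<le> C" for n
  proof (cases "n \<le> N")
    case False
    then show ?thesis
      using nrm_le_diff[OF CS_Cc[OF X, of n] CS_Cc[OF X, of N]] N[of n N] C[of N] by simp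
  qed (use C[of n] in auto)
  moreover have "C > 0" using C[of N] nrm_nonneg[OF CS_Cc[OF X, of N]] by linarith
  ultimately show thesis using that by blast
qed

text \<open>One Cauchy criterion for all four operations; the unary ones take the same sequence for
  \<open>X\<close> and \<open>Y\<close>.\<close>

lemma CS_dominated:
  assumes X: "X \<in> CS" and Y: "Y \<in> CS" and Z: "\<And>n. Z n \<in> Cc G" and C: "0 < C"
    and le: "\<And>m n. nrm (\<lambda>\<gamma>. Z m \<gamma> - Z n \<gamma>) \<le> C * (nrm (\<lambda>\<gamma>. X m \<gamma> - X n \<gamma>) + nrm (\<lambda>\<gamma>. Y m \<gamma> - Y n \<gamma>))"
  shows "Z \<in> CS"
  unfolding cauchy_seqs_def
proof (intro CollectI conjI allI impI Z)
  fix \<epsilon> :: real assume "\<epsilon> > 0"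
  then have e: "\<epsilon> / (2 * C) > 0" using C by simp
  obtain N where N: "\<And>m n. m \<ge> N \<Longrightarrow> n \<ge> N \<Longrightarrow> nrm (\<lambda>\<gamma>. X m \<gamma> - X n \<gamma>) < \<epsilon> / (2 * C)"
    using CS_eps[OF X e] by blast
  obtain M where M: "\<And>m n. m \<ge> M \<Longrightarrow> n \<ge> M \<Longrightarrow> nrm (\<lambda>\<gamma>. Y m \<gamma> - Y n \<gamma>) < \<epsilon> / (2 * C)"
    using CS_eps[OF Y e] by blast
  have "nrm (\<lambda>\<gamma>. Z m \<gamma> - Z n \<gamma>) < \<epsilon>" if "m \<ge> max N M" "n \<ge> max N M" for m n
  proof -
    have "nrm (\<lambda>\<gamma>. X m \<gamma> - X n \<gamma>) + nrm (\<lambda>\<gamma>. Y m \<gamma> - Y n \<gamma>) < \<epsilon> / (2 * C) + \<epsilon> / (2 * C)"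
      using N[of m n] M[of m n] that by (intro add_strict_mono) auto
    also have "\<dots> = \<epsilon> / C" by (simp add: field_simps)
    finally have "C * (nrm (\<lambda>\<gamma>. X m \<gamma> - X n \<gamma>) + nrm (\<lambda>\<gamma>. Y m \<gamma> - Y n \<gamma>)) < \<epsilon>"
      using C by (simp add: pos_less_divide_eq mult.commute)
    then show ?thesis using le[of m n] by linarith
  qed
  then show "\<exists>N. \<forall>m\<ge>N. \<forall>n\<ge>N. nrm (\<lambda>\<gamma>. Z m \<gamma> - Z n \<gamma>) < \<epsilon>" by blast
qed

lemma CS_add:
  assumes "X \<in> CS" "Y \<in> CS"
  shows "(\<lambda>n \<gamma>. X n \<gamma> + Y n \<gamma>) \<in> CS"
proof (rule CS_dominated[OF assms, of _ 1])
  fix m n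
  have "(\<lambda>\<gamma>. X m \<gamma> + Y m \<gamma> - (X n \<gamma> + Y n \<gamma>)) = (\<lambda>\<gamma>. (X m \<gamma> - X n \<gamma>) + (Y m \<gamma> - Y n \<gamma>))"
    by (simp add: fun_eq_iff)
  then show "nrm (\<lambda>\<gamma>. X m \<gamma> + Y m \<gamma> - (X n \<gamma> + Y n \<gamma>)) \<le> 1 * (nrm (\<lambda>\<gamma>. X m \<gamma> - X n \<gamma>) + nrm (\<lambda>\<gamma>. Y m \<gamma> - Y n \<gamma>))"
    using nrm_add[OF Cc_diff[OF CS_Cc CS_Cc] Cc_diff[OF CS_Cc CS_Cc]] assms by simp
qed (use assms CS_Cc Cc_add in auto)

text \<open>The \<open>+ 1\<close> keeps the constant positive when \<open>c = 0\<close>, and the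
  slack \<open>b\<close> gives the shape that \<open>CS_dominated\<close> asks for.\<close>

lemma scale_le_dominated:
  assumes "f \<in> Cc G" "g \<in> Cc G" "0 \<le> b"
  shows "nrm (\<lambda>\<gamma>. c * f \<gamma> - c * g \<gamma>) \<le> (cmod c + 1) * (nrm (\<lambda>\<gamma>. f \<gamma> - g \<gamma>) + b)"
proof -
  have "nrm (\<lambda>\<gamma>. c * f \<gamma> - c * g \<gamma>) \<le> cmod c * nrm (\<lambda>\<gamma>. f \<gamma> - g \<gamma>)"
    using nrm_scale_le[OF Cc_diff[OF assms(1,2)], of c] by (simp add: right_diff_distrib)
  also have "\<dots> \<le> (cmod c + 1) * (nrm (\<lambda>\<gamma>. f \<gamma> - g \<gamma>) + b)"
    using nrm_nonneg[OF Cc_diff[OF assms(1,2)]] assms(3) by (intro mult_mono) auto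
  finally show ?thesis .
qed

lemma CS_scale:
  assumes X: "X \<in> CS"
  shows "(\<lambda>n \<gamma>. c * X n \<gamma>) \<in> CS"
proof (rule CS_dominated[OF X X, of _ "cmod c + 1"])
  show "0 < cmod c + 1" using norm_ge_zero[of c] by linarith
  show "nrm (\<lambda>\<gamma>. c * X m \<gamma> - c * X n \<gamma>) \<le> (cmod c + 1) * (nrm (\<lambda>\<gamma>. X m \<gamma> - X n \<gamma>) + nrm (\<lambda>\<gamma>. X m \<gamma> - X n \<gamma>))" for m n
    using X by (intro scale_le_dominated CS_Cc nrm_nonneg Cc_diff)
qed (use X CS_Cc Cc_scale in auto)

text \<open>Insert the mixed term \<open>conv G f g'\<close>: the difference is \<open>f\<close>
  convolved with \<open>g - g'\<close> plus \<open>f - f'\<close> convolved with \<open>g'\<close>.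
  Hence only \<open>f\<close> and \<open>g'\<close> need a bound.\<close>

lemma conv_diff_le:
  assumes f: "f \<in> Cc G" "f' \<in> Cc G" "nrm f \<le> C" and g: "g \<in> Cc G" "g' \<in> Cc G" "nrm g' \<le> C"
  shows "nrm (\<lambda>\<gamma>. conv G f g \<gamma> - conv G f' g' \<gamma>) \<le> C * (nrm (\<lambda>\<gamma>. f \<gamma> - f' \<gamma>) + nrm (\<lambda>\<gamma>. g \<gamma> - g' \<gamma>))"
proof -
  have ff: "fibre_finite G f" "fibre_finite G g'" using f g Cc_fibre_finite by auto
  have 1: "conv G f (\<lambda>\<gamma>. g \<gamma> - g' \<gamma>) = (\<lambda>\<gamma>. conv G f g \<gamma> - conv G f g' \<gamma>)"
    using conv_add_right[OF ff(1), of g "\<lambda>\<gamma>. - 1 * g' \<gamma>"] unfolding conv_scale_right by simp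
  have 2: "conv G (\<lambda>\<gamma>. f \<gamma> - f' \<gamma>) g' = (\<lambda>\<gamma>. conv G f g' \<gamma> - conv G f' g' \<gamma>)"
    using conv_add_left[OF ff(2), of f "\<lambda>\<gamma>. - 1 * f' \<gamma>"] unfolding conv_scale_left by simp
  have "nrm (\<lambda>\<gamma>. conv G f g \<gamma> - conv G f' g' \<gamma>) \<le>
      nrm (\<lambda>\<gamma>. conv G f g \<gamma> - conv G f g' \<gamma>) + nrm (\<lambda>\<gamma>. conv G f g' \<gamma> - conv G f' g' \<gamma>)"
    using f g by (intro nrm_diff_triangle Cc_conv)
  also have "\<dots> \<le> nrm f * nrm (\<lambda>\<gamma>. g \<gamma> - g' \<gamma>) + nrm (\<lambda>\<gamma>. f \<gamma> - f' \<gamma>) * nrm g'"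
    unfolding 1[symmetric] 2[symmetric] using f g by (intro add_mono nrm_conv Cc_diff)
  also have "\<dots> \<le> C * nrm (\<lambda>\<gamma>. g \<gamma> - g' \<gamma>) + nrm (\<lambda>\<gamma>. f \<gamma> - f' \<gamma>) * C"
    using f g by (intro add_mono mult_right_mono mult_left_mono nrm_nonneg Cc_diff)
  finally show ?thesis by (simp add: algebra_simps)
qed

lemma CS_conv:
  assumes X: "X \<in> CS" and Y: "Y \<in> CS"
  shows "(\<lambda>n. conv G (X n) (Y n)) \<in> CS"
proof -
  obtain C where C: "C > 0" "\<And>n. nrm (X n) \<le> C" using CS_bounded[OF X] by blast
  obtain D where D: "D > 0" "\<And>n. nrm (Y n) \<le> D" using CS_bounded[OF Y] by blast
  show ?thesis
  proof (rule CS_dominated[OF X Y, of _ "max C D"])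
    show "0 < max C D" using C by simp
    show "nrm (\<lambda>\<gamma>. conv G (X m) (Y m) \<gamma> - conv G (X n) (Y n) \<gamma>)
         \<le> max C D * (nrm (\<lambda>\<gamma>. X m \<gamma> - X n \<gamma>) + nrm (\<lambda>\<gamma>. Y m \<gamma> - Y n \<gamma>))" for m n
      using C(2)[of m] D(2)[of n] X Y by (intro conv_diff_le CS_Cc) auto
  qed (use X Y CS_Cc Cc_conv in auto)
qed

lemma invol_diff_le:
  assumes "f \<in> Cc G" "g \<in> Cc G"
  shows "nrm (\<lambda>\<gamma>. invol G f \<gamma> - invol G g \<gamma>) \<le> nrm (\<lambda>\<gamma>. f \<gamma> - g \<gamma>)"
proof -
  have "(\<lambda>\<gamma>. invol G f \<gamma> - invol G g \<gamma>) = invol G (\<lambda>\<gamma>. f \<gamma> - g \<gamma>)"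
    by (auto simp: invol_def)
  then show ?thesis using nrm_invol_le[OF Cc_diff[OF assms]] by simp
qed

lemma CS_invol:
  assumes X: "X \<in> CS"
  shows "(\<lambda>n. invol G (X n)) \<in> CS"
proof (rule CS_dominated[OF X X, of _ 1])
  show "nrm (\<lambda>\<gamma>. invol G (X m) \<gamma> - invol G (X n) \<gamma>)
         \<le> 1 * (nrm (\<lambda>\<gamma>. X m \<gamma> - X n \<gamma>) + nrm (\<lambda>\<gamma>. X m \<gamma> - X n \<gamma>))" for m n
    using invol_diff_le[OF CS_Cc[OF X] CS_Cc[OF X], of m n] nrm_nonneg[OF Cc_diff[OF CS_Cc[OF X] CS_Cc[OF X]], of m n]
    by simp
qed (use X CS_Cc Cc_invol in auto)

lemma convergent_nrm:
  assumes X: "X \<in> CS"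
  shows "convergent (\<lambda>n. nrm (X n))"
proof -
  have "Cauchy (\<lambda>n. nrm (X n))"
  proof (rule metric_CauchyI)
    fix \<epsilon> :: real assume "\<epsilon> > 0"
    then obtain N where N: "\<And>m n. m \<ge> N \<Longrightarrow> n \<ge> N \<Longrightarrow> nrm (\<lambda>\<gamma>. X m \<gamma> - X n \<gamma>) < \<epsilon>"
      using CS_eps[OF X] by blast
    have "dist (nrm (X m)) (nrm (X n)) < \<epsilon>" if "m \<ge> N" "n \<ge> N" for m n
      using abs_nrm_diff_le[OF CS_Cc[OF X] CS_Cc[OF X], of m n] N[OF that] by (simp add: dist_real_def)
    then show "\<exists>M. \<forall>m\<ge>M. \<forall>n\<ge>M. dist (nrm (X m)) (nrm (X n)) < \<epsilon>" by blast
  qed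
  then show ?thesis by (simp add: Cauchy_convergent_iff)
qed

subsection \<open>The quotient\<close>

lemma null_rel_iff: "(X, Y) \<in> null_rel G \<longleftrightarrow> X \<in> CS \<and> Y \<in> CS \<and> (\<lambda>n. nrm (\<lambda>\<gamma>. X n \<gamma> - Y n \<gamma>)) \<longlonglongrightarrow> 0"
  by (simp add: null_rel_def)

lemma equiv_null_rel: "equiv CS (null_rel G)"
proof (rule equivI)
  show "null_rel G \<subseteq> CS \<times> CS" by (auto simp: null_rel_def)
  show "refl_on CS (null_rel G)"
    by (auto simp: refl_on_def null_rel_iff nrm_zero)
  show "sym (null_rel G)"
  proof (rule symI)
    fix X Y assume "(X, Y) \<in> null_rel G"
    then show "(Y, X) \<in> null_rel G"
      unfolding null_rel_iff using nrm_diff_commute[OF CS_Cc CS_Cc] by auto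
  qed
  show "trans (null_rel G)"
  proof (rule transI)
    fix X Y Z assume *: "(X, Y) \<in> null_rel G" "(Y, Z) \<in> null_rel G"
    then have cs: "X \<in> CS" "Y \<in> CS" "Z \<in> CS" by (auto simp: null_rel_iff)
    have lim: "(\<lambda>n. nrm (\<lambda>\<gamma>. X n \<gamma> - Y n \<gamma>) + nrm (\<lambda>\<gamma>. Y n \<gamma> - Z n \<gamma>)) \<longlonglongrightarrow> 0"
      using * by (auto simp: null_rel_iff intro!: tendsto_eq_intros)
    have "(\<lambda>n. nrm (\<lambda>\<gamma>. X n \<gamma> - Z n \<gamma>)) \<longlonglongrightarrow> 0"
    proof (rule tendsto_sandwich[OF _ _ tendsto_const lim])
      show "\<forall>\<^sub>F n in sequentially. 0 \<le> nrm (\<lambda>\<gamma>. X n \<gamma> - Z n \<gamma>)"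
        using CS_diff_nonneg[OF cs(1,3)] by simp
      show "\<forall>\<^sub>F n in sequentially. nrm (\<lambda>\<gamma>. X n \<gamma> - Z n \<gamma>) \<le> nrm (\<lambda>\<gamma>. X n \<gamma> - Y n \<gamma>) + nrm (\<lambda>\<gamma>. Y n \<gamma> - Z n \<gamma>)"
        using nrm_diff_triangle[OF CS_Cc[OF cs(1)] CS_Cc[OF cs(2)] CS_Cc[OF cs(3)]] by simp
    qed
    then show "(X, Z) \<in> null_rel G" using cs by (auto simp: null_rel_iff)
  qed
qed

lemma cls_eq_iff: "X \<in> CS \<Longrightarrow> Y \<in> CS \<Longrightarrow> cls X = cls Y \<longleftrightarrow> (\<lambda>n. nrm (\<lambda>\<gamma>. X n \<gamma> - Y n \<gamma>)) \<longlonglongrightarrow> 0"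
  unfolding Cred_class_def using eq_equiv_class_iff[OF equiv_null_rel] by (simp add: null_rel_iff)

lemma cls_eqI:
  assumes "X \<in> CS" "Y \<in> CS" "l \<longlonglongrightarrow> 0" "\<And>n. nrm (\<lambda>\<gamma>. X n \<gamma> - Y n \<gamma>) \<le> l n"
  shows "cls X = cls Y"
proof -
  have "(\<lambda>n. nrm (\<lambda>\<gamma>. X n \<gamma> - Y n \<gamma>)) \<longlonglongrightarrow> 0"
    by (rule tendsto_sandwich[OF _ _ tendsto_const assms(3)])
      (use assms in \<open>auto intro!: always_eventually CS_diff_nonneg\<close>)
  then show ?thesis using assms by (simp add: cls_eq_iff)
qed

lemma cls_Cred: "X \<in> CS \<Longrightarrow> cls X \<in> Cred G"
  by (simp add: Cred_class_def Cred_def quotientI)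

lemma CredE:
  assumes "a \<in> Cred G"
  obtains X where "X \<in> CS" "a = cls X"
  using assms unfolding Cred_def Cred_class_def by (rule quotientE)

text \<open>The operation is a union over all representatives. Once the resulting class is known to
  be independent of them, the union collapses to that single class. The same holds for the product,
  scalar multiples and the star.\<close>

lemma Cred_add_cls:
  assumes "X \<in> CS" "Y \<in> CS"
  shows "Cred_add G (cls X) (cls Y) = cls (\<lambda>n \<gamma>. X n \<gamma> + Y n \<gamma>)"
proof -
  have "congruent2 (null_rel G) (null_rel G) (\<lambda>X Y. cls (\<lambda>n \<gamma>. X n \<gamma> + Y n \<gamma>))"
    unfolding congruent2_def
  proof (clarify)
    fix X X' Y Y' assume *: "(X, X') \<in> null_rel G" "(Y, Y') \<in> null_rel G"
    then have cs: "X \<in> CS" "X' \<in> CS" "Y \<in> CS" "Y' \<in> CS" by (auto simp: null_rel_iff)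
    have "(\<lambda>n. nrm (\<lambda>\<gamma>. X n \<gamma> - X' n \<gamma>) + nrm (\<lambda>\<gamma>. Y n \<gamma> - Y' n \<gamma>)) \<longlonglongrightarrow> 0"
      using * by (auto simp: null_rel_iff intro!: tendsto_eq_intros)
    moreover have "nrm (\<lambda>\<gamma>. X n \<gamma> + Y n \<gamma> - (X' n \<gamma> + Y' n \<gamma>)) \<le> nrm (\<lambda>\<gamma>. X n \<gamma> - X' n \<gamma>) + nrm (\<lambda>\<gamma>. Y n \<gamma> - Y' n \<gamma>)" for n
    proof -
      have "(\<lambda>\<gamma>. X n \<gamma> + Y n \<gamma> - (X' n \<gamma> + Y' n \<gamma>)) = (\<lambda>\<gamma>. (X n \<gamma> - X' n \<gamma>) + (Y n \<gamma> - Y' n \<gamma>))"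
        by (simp add: fun_eq_iff)
      then show ?thesis using nrm_add[OF Cc_diff[OF CS_Cc CS_Cc] Cc_diff[OF CS_Cc CS_Cc]] cs by simp
    qed
    ultimately show "cls (\<lambda>n \<gamma>. X n \<gamma> + Y n \<gamma>) = cls (\<lambda>n \<gamma>. X' n \<gamma> + Y' n \<gamma>)"
      using cs by (intro cls_eqI CS_add)
  qed
  from UN_equiv_class2[OF equiv_null_rel equiv_null_rel this assms]
  show ?thesis by (simp add: Cred_add_def Cred_class_def)
qed

lemma Cred_mult_cls:
  assumes "X \<in> CS" "Y \<in> CS"
  shows "Cred_mult G (cls X) (cls Y) = cls (\<lambda>n. conv G (X n) (Y n))"
proof -
  have "congruent2 (null_rel G) (null_rel G) (\<lambda>X Y. cls (\<lambda>n. conv G (X n) (Y n)))"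
    unfolding congruent2_def
  proof (clarify)
    fix X X' Y Y' assume *: "(X, X') \<in> null_rel G" "(Y, Y') \<in> null_rel G"
    then have cs: "X \<in> CS" "X' \<in> CS" "Y \<in> CS" "Y' \<in> CS" by (auto simp: null_rel_iff)
    obtain C where C: "C > 0" "\<And>n. nrm (X n) \<le> C" using CS_bounded[OF cs(1)] by blast
    obtain D where D: "D > 0" "\<And>n. nrm (Y' n) \<le> D" using CS_bounded[OF cs(4)] by blast
    have "(\<lambda>n. max C D * (nrm (\<lambda>\<gamma>. X n \<gamma> - X' n \<gamma>) + nrm (\<lambda>\<gamma>. Y n \<gamma> - Y' n \<gamma>))) \<longlonglongrightarrow> 0"
      using * by (auto simp: null_rel_iff intro!: tendsto_eq_intros)
    moreover have "nrm (\<lambda>\<gamma>. conv G (X n) (Y n) \<gamma> - conv G (X' n) (Y' n) \<gamma>)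
        \<le> max C D * (nrm (\<lambda>\<gamma>. X n \<gamma> - X' n \<gamma>) + nrm (\<lambda>\<gamma>. Y n \<gamma> - Y' n \<gamma>))" for n
      using C(2)[of n] D(2)[of n] cs by (intro conv_diff_le CS_Cc) auto
    ultimately show "cls (\<lambda>n. conv G (X n) (Y n)) = cls (\<lambda>n. conv G (X' n) (Y' n))"
      using cs by (intro cls_eqI CS_conv)
  qed
  from UN_equiv_class2[OF equiv_null_rel equiv_null_rel this assms]
  show ?thesis by (simp add: Cred_mult_def Cred_class_def)
qed

lemma Cred_scale_cls:
  assumes "X \<in> CS"
  shows "Cred_scale G c (cls X) = cls (\<lambda>n \<gamma>. c * X n \<gamma>)"
proof -
  have "congruent (null_rel G) (\<lambda>X. cls (\<lambda>n \<gamma>. c * X n \<gamma>))"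
    unfolding congruent_def
  proof (clarify)
    fix X X' assume *: "(X, X') \<in> null_rel G"
    then have cs: "X \<in> CS" "X' \<in> CS" by (auto simp: null_rel_iff)
    have "(\<lambda>n. (cmod c + 1) * (nrm (\<lambda>\<gamma>. X n \<gamma> - X' n \<gamma>) + 0)) \<longlonglongrightarrow> 0"
      using * by (auto simp: null_rel_iff intro!: tendsto_eq_intros)
    moreover have "nrm (\<lambda>\<gamma>. c * X n \<gamma> - c * X' n \<gamma>) \<le> (cmod c + 1) * (nrm (\<lambda>\<gamma>. X n \<gamma> - X' n \<gamma>) + 0)" for n
      using cs by (intro scale_le_dominated CS_Cc) auto
    ultimately show "cls (\<lambda>n \<gamma>. c * X n \<gamma>) = cls (\<lambda>n \<gamma>. c * X' n \<gamma>)"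
      using cs by (intro cls_eqI CS_scale)
  qed
  from UN_equiv_class[OF equiv_null_rel this assms]
  show ?thesis by (simp add: Cred_scale_def Cred_class_def)
qed

lemma Cred_star_cls:
  assumes "X \<in> CS"
  shows "Cred_star G (cls X) = cls (\<lambda>n. invol G (X n))"
proof -
  have "congruent (null_rel G) (\<lambda>X. cls (\<lambda>n. invol G (X n)))"
    unfolding congruent_def
  proof (clarify)
    fix X X' assume *: "(X, X') \<in> null_rel G"
    then have cs: "X \<in> CS" "X' \<in> CS" by (auto simp: null_rel_iff)
    show "cls (\<lambda>n. invol G (X n)) = cls (\<lambda>n. invol G (X' n))"
      using cs * invol_diff_le[OF CS_Cc CS_Cc]
      by (intro cls_eqI[of _ _ "\<lambda>n. nrm (\<lambda>\<gamma>. X n \<gamma> - X' n \<gamma>)"] CS_invol) (auto simp: null_rel_iff)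
  qed
  from UN_equiv_class[OF equiv_null_rel this assms]
  show ?thesis by (simp add: Cred_star_def Cred_class_def)
qed

lemma Cred_zero_cls: "Cred_zero G = cls (\<lambda>_ _. 0)"
  by (simp add: Cred_zero_def Cred_incl_def)

text \<open>The definite description ranges over all representatives, so the limit must be shown to
  be common to them and not merely unique for one sequence.\<close>

lemma Cred_norm_cls:
  assumes X: "X \<in> CS"
  shows "(\<lambda>n. nrm (X n)) \<longlonglongrightarrow> Cred_norm G (cls X)"
proof -
  obtain l where l: "(\<lambda>n. nrm (X n)) \<longlonglongrightarrow> l" using convergent_nrm[OF X] by (auto simp: convergent_def)
  have self: "X \<in> cls X" using X by (simp add: Cred_class_def null_rel_iff nrm_zero)
  have "Cred_norm G (cls X) = l"
    unfolding Cred_norm_def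
  proof (rule the_equality)
    show "\<exists>X'\<in>cls X. (\<lambda>n. nrm (X' n)) \<longlonglongrightarrow> l" using self l by blast
    fix l' assume "\<exists>X'\<in>cls X. (\<lambda>n. nrm (X' n)) \<longlonglongrightarrow> l'"
    then obtain Y where Y: "(X, Y) \<in> null_rel G" "(\<lambda>n. nrm (Y n)) \<longlonglongrightarrow> l'" by (auto simp: Cred_class_def)
    then have cs: "Y \<in> CS" by (simp add: null_rel_iff)
    have "(\<lambda>n. nrm (X n) - nrm (Y n)) \<longlonglongrightarrow> 0"
    proof (rule tendsto_rabs_zero_cancel, rule tendsto_sandwich[OF _ _ tendsto_const])
      show "(\<lambda>n. nrm (\<lambda>\<gamma>. X n \<gamma> - Y n \<gamma>)) \<longlonglongrightarrow> 0" using Y by (simp add: null_rel_iff)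
      show "\<forall>\<^sub>F n in sequentially. \<bar>nrm (X n) - nrm (Y n)\<bar> \<le> nrm (\<lambda>\<gamma>. X n \<gamma> - Y n \<gamma>)"
        using abs_nrm_diff_le CS_Cc X cs by (intro always_eventually allI) blast
    qed auto
    moreover have "(\<lambda>n. nrm (X n) - nrm (Y n)) \<longlonglongrightarrow> l - l'" by (intro tendsto_diff l Y(2))
    ultimately show "l' = l" using LIMSEQ_unique by fastforce
  qed
  then show ?thesis using l by simp
qed

lemma Cred_dist_cls:
  assumes "X \<in> CS" "Y \<in> CS"
  shows "(\<lambda>n. nrm (\<lambda>\<gamma>. X n \<gamma> - Y n \<gamma>)) \<longlonglongrightarrow> Cred_dist G (cls X) (cls Y)"
  using Cred_norm_cls[OF CS_add[OF assms(1) CS_scale[OF assms(2), of "-1"]]]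
  unfolding Cred_dist_def Cred_scale_cls[OF assms(2)] Cred_add_cls[OF assms(1) CS_scale[OF assms(2)]]
  by simp

lemma Cred_dist_lessE:
  assumes "X \<in> CS" "Y \<in> CS" "Cred_dist G (cls X) (cls Y) < \<epsilon>"
  obtains N where "\<And>n. n \<ge> N \<Longrightarrow> nrm (\<lambda>\<gamma>. X n \<gamma> - Y n \<gamma>) < \<epsilon>"
  using order_tendstoD(2)[OF Cred_dist_cls[OF assms(1,2)] assms(3)]
  unfolding eventually_sequentially by blast

subsection \<open>The subalgebra of the interior of the isotropy\<close>

lemma Cc_Iso_diff: "f \<in> Cc Iso_gpd \<Longrightarrow> g \<in> Cc Iso_gpd \<Longrightarrow> (\<lambda>\<gamma>. f \<gamma> - g \<gamma>) \<in> Cc Iso_gpd"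
  using Cc_Iso_add[OF _ Cc_Iso_scale[of g "-1"], of f] by simp

lemma cauchy_seqs_Iso: "cauchy_seqs Iso_gpd = {X \<in> CS. \<forall>n. X n \<in> Cc Iso_gpd}"
proof -
  have eq: "reduced_norm Iso_gpd (\<lambda>\<gamma>. X m \<gamma> - X n \<gamma>) = nrm (\<lambda>\<gamma>. X m \<gamma> - X n \<gamma>)" if "\<forall>n. X n \<in> Cc Iso_gpd" for X m n
    using that by (intro reduced_norm_Iso Cc_Iso_diff) auto
  have "X \<in> cauchy_seqs Iso_gpd \<longleftrightarrow> X \<in> CS" if "\<forall>n. X n \<in> Cc Iso_gpd" for X
    using that Cc_Iso_Cc by (simp add: cauchy_seqs_def eq[OF that])
  moreover have "\<forall>n. X n \<in> Cc Iso_gpd" if "X \<in> cauchy_seqs Iso_gpd" for X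
    using that by (simp add: cauchy_seqs_def)
  ultimately show ?thesis by blast
qed

text \<open>Extension by zero fixes every representative, and by \<open>reduced_norm_Iso\<close>
  equivalent sequences over the subgroupoid remain equivalent over \<open>G\<close>.\<close>

lemma iota_r_cls:
  assumes X: "X \<in> cauchy_seqs Iso_gpd"
  shows "iota_r G (Cred_class Iso_gpd X) = cls X"
proof -
  have ext: "(\<lambda>n. extend_by_zero Iso0 (Y n)) = Y" if "Y \<in> cauchy_seqs Iso_gpd" for Y
    using that Cc_Iso_zero by (auto simp: cauchy_seqs_Iso extend_by_zero_def fun_eq_iff)
  have rel: "(X, Y) \<in> null_rel Iso_gpd \<longleftrightarrow> (X, Y) \<in> null_rel G" if "Y \<in> cauchy_seqs Iso_gpd" for Y
  proof -
    have "reduced_norm Iso_gpd (\<lambda>\<gamma>. X n \<gamma> - Y n \<gamma>) = nrm (\<lambda>\<gamma>. X n \<gamma> - Y n \<gamma>)" for n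
      using that X by (intro reduced_norm_Iso Cc_Iso_diff) (auto simp: cauchy_seqs_Iso)
    then show ?thesis using that X by (simp add: null_rel_def cauchy_seqs_Iso)
  qed
  have "(X, X) \<in> null_rel G" using X by (simp add: null_rel_iff nrm_zero cauchy_seqs_Iso)
  then have "X \<in> Cred_class Iso_gpd X" using rel[OF X] by (simp add: Cred_class_def)
  moreover have "cls (\<lambda>n. extend_by_zero Iso0 (Y n)) = cls X" if "Y \<in> Cred_class Iso_gpd X" for Y
  proof -
    have Y: "Y \<in> cauchy_seqs Iso_gpd" "(X, Y) \<in> null_rel Iso_gpd"
      using that by (auto simp: Cred_class_def null_rel_def)
    then have "(X, Y) \<in> null_rel G" using rel by blast
    then have "cls X = cls Y" unfolding Cred_class_def by (rule equiv_class_eq[OF equiv_null_rel])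
    then show ?thesis using ext[OF Y(1)] by simp
  qed
  ultimately show ?thesis unfolding iota_r_def by blast
qed

lemma M_r_eq: "M_r G = {cls X | X. X \<in> CS \<and> (\<forall>n. X n \<in> Cc Iso_gpd)}"
proof -
  have "M_r G = (\<lambda>X. iota_r G (Cred_class Iso_gpd X)) ` cauchy_seqs Iso_gpd"
    unfolding M_r_def Cred_def quotient_def Cred_class_def by blast
  also have "\<dots> = cls ` cauchy_seqs Iso_gpd" using iota_r_cls by (intro image_cong) auto
  finally show ?thesis by (auto simp: cauchy_seqs_Iso)
qed

lemma M_rI: "X \<in> CS \<Longrightarrow> (\<And>n. X n \<in> Cc Iso_gpd) \<Longrightarrow> cls X \<in> M_r G"
  unfolding M_r_eq by blast

lemma M_rE:
  assumes "a \<in> M_r G"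
  obtains X where "X \<in> CS" "\<And>n. X n \<in> Cc Iso_gpd" "a = cls X"
  using assms unfolding M_r_eq by blast

text \<open>Membership in \<open>M_r G\<close> asks for a representative with all terms in
  \<open>Cc Iso_gpd\<close>. Choose \<open>f n\<close> there, within \<open>1 / (n + 1)\<close> of a
  whole tail of \<open>X\<close>; then \<open>f\<close> is Cauchy and equivalent to
  \<open>X\<close>.\<close>

lemma M_r_closed:
  assumes a: "a \<in> Cred G" and near: "\<And>\<epsilon>. \<epsilon> > 0 \<Longrightarrow> \<exists>b\<in>M_r G. Cred_dist G a b < \<epsilon>"
  shows "a \<in> M_r G"
proof -
  obtain X where X: "X \<in> CS" "a = cls X" using a by (rule CredE)
  have "\<exists>f k. f \<in> Cc Iso_gpd \<and> (\<forall>m\<ge>k. nrm (\<lambda>\<gamma>. X m \<gamma> - f \<gamma>) < 1 / real (Suc n))" for n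
  proof -
    \<comment> \<open>One half for the distance from \<open>X\<close> to \<open>Y\<close>, one half
      for moving along the tail of \<open>Y\<close>.\<close>
    define \<epsilon> where "\<epsilon> = 1 / real (Suc n) / 2"
    have \<epsilon>: "\<epsilon> > 0" by (simp add: \<epsilon>_def)
    obtain b where b: "b \<in> M_r G" "Cred_dist G a b < \<epsilon>" using near[OF \<epsilon>] by blast
    obtain Y where Y: "Y \<in> CS" "\<And>n. Y n \<in> Cc Iso_gpd" "b = cls Y" using b(1) by (rule M_rE) blast
    obtain N where N: "\<And>n. n \<ge> N \<Longrightarrow> nrm (\<lambda>\<gamma>. X n \<gamma> - Y n \<gamma>) < \<epsilon>"
      using Cred_dist_lessE[OF X(1) Y(1)] b(2) X(2) Y(3) by blast
    obtain M where M: "\<And>m n. m \<ge> M \<Longrightarrow> n \<ge> M \<Longrightarrow> nrm (\<lambda>\<gamma>. Y m \<gamma> - Y n \<gamma>) < \<epsilon>"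
      using CS_eps[OF Y(1) \<epsilon>] by blast
    have "nrm (\<lambda>\<gamma>. X m \<gamma> - Y (max N M) \<gamma>) < 1 / real (Suc n)" if "m \<ge> max N M" for m
    proof -
      have "nrm (\<lambda>\<gamma>. X m \<gamma> - Y (max N M) \<gamma>) \<le> nrm (\<lambda>\<gamma>. X m \<gamma> - Y m \<gamma>) + nrm (\<lambda>\<gamma>. Y m \<gamma> - Y (max N M) \<gamma>)"
        by (intro nrm_diff_triangle CS_Cc X Y)
      also have "\<dots> < \<epsilon> + \<epsilon>" using N[of m] M[of m "max N M"] that by (intro add_strict_mono) auto
      also have "\<epsilon> + \<epsilon> = 1 / real (Suc n)" unfolding \<epsilon>_def by (rule field_sum_of_halves)
      finally show ?thesis .
    qed
    then show ?thesis using Y(2) by blast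
  qed
  then obtain f k where f: "\<And>n. f n \<in> Cc Iso_gpd" and k: "\<And>n m. m \<ge> k n \<Longrightarrow> nrm (\<lambda>\<gamma>. X m \<gamma> - f n \<gamma>) < 1 / real (Suc n)"
    by metis
  have fCc: "f n \<in> Cc G" for n using Cc_Iso_Cc f by blast
  have Cauchy: "f \<in> CS"
    unfolding cauchy_seqs_def
  proof (intro CollectI conjI allI impI fCc)
    fix \<epsilon> :: real assume "\<epsilon> > 0"
    then obtain N where "1 / real (Suc N) < \<epsilon> / 2"
      using nat_approx_posE[of "\<epsilon> / 2"] by auto
    then have N: "1 / real (Suc n) < \<epsilon> / 2" if "n \<ge> N" for n
      using that by (smt (verit) frac_le of_nat_Suc of_nat_0_less_iff of_nat_mono zero_less_Suc Suc_le_mono)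
    have "nrm (\<lambda>\<gamma>. f m \<gamma> - f n \<gamma>) < \<epsilon>" if "m \<ge> N" "n \<ge> N" for m n
    proof -
      \<comment> \<open>An index of \<open>X\<close> late enough to be close to both
        \<open>f m\<close> and \<open>f n\<close>.\<close>
      let ?p = "max (k m) (k n)"
      have "nrm (\<lambda>\<gamma>. f m \<gamma> - f n \<gamma>) \<le> nrm (\<lambda>\<gamma>. f m \<gamma> - X ?p \<gamma>) + nrm (\<lambda>\<gamma>. X ?p \<gamma> - f n \<gamma>)"
        by (intro nrm_diff_triangle CS_Cc X fCc)
      also have "nrm (\<lambda>\<gamma>. f m \<gamma> - X ?p \<gamma>) = nrm (\<lambda>\<gamma>. X ?p \<gamma> - f m \<gamma>)"
        by (intro nrm_diff_commute CS_Cc X fCc)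
      also have "\<dots> + nrm (\<lambda>\<gamma>. X ?p \<gamma> - f n \<gamma>) < \<epsilon>"
        using k[of m ?p] k[of n ?p] N[OF that(1)] N[OF that(2)] by linarith
      finally show ?thesis .
    qed
    then show "\<exists>N. \<forall>m\<ge>N. \<forall>n\<ge>N. nrm (\<lambda>\<gamma>. f m \<gamma> - f n \<gamma>) < \<epsilon>" by blast
  qed
  have "(\<lambda>n. nrm (\<lambda>\<gamma>. X n \<gamma> - f n \<gamma>)) \<longlonglongrightarrow> 0"
  proof (rule LIMSEQ_I)
    fix \<epsilon> :: real assume "\<epsilon> > 0"
    then have e: "\<epsilon> / 2 > 0" by simp
    obtain N where N: "1 / real (Suc N) < \<epsilon> / 2" using nat_approx_posE[OF e] by auto
    obtain M where M: "\<And>m n. m \<ge> M \<Longrightarrow> n \<ge> M \<Longrightarrow> nrm (\<lambda>\<gamma>. f m \<gamma> - f n \<gamma>) < \<epsilon> / 2"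
      using CS_eps[OF Cauchy e] by blast
    \<comment> \<open>A fixed approximant \<open>f ?q\<close> is compared both with the tail of
      \<open>X\<close>, from \<open>k ?q\<close> on, and with the tail of \<open>f\<close>. The
      threshold \<open>k n\<close> itself may outgrow \<open>n\<close>.\<close>
    let ?q = "max N M"
    have "norm (nrm (\<lambda>\<gamma>. X n \<gamma> - f n \<gamma>) - 0) < \<epsilon>" if "n \<ge> max ?q (k ?q)" for n
    proof -
      have "nrm (\<lambda>\<gamma>. X n \<gamma> - f n \<gamma>) \<le> nrm (\<lambda>\<gamma>. X n \<gamma> - f ?q \<gamma>) + nrm (\<lambda>\<gamma>. f ?q \<gamma> - f n \<gamma>)"
        by (intro nrm_diff_triangle CS_Cc X fCc)
      moreover have "nrm (\<lambda>\<gamma>. X n \<gamma> - f ?q \<gamma>) < 1 / real (Suc ?q)" using k[of ?q n] that by simp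
      moreover have "1 / real (Suc ?q) \<le> 1 / real (Suc N)" by (simp add: frac_le)
      moreover have "nrm (\<lambda>\<gamma>. f ?q \<gamma> - f n \<gamma>) < \<epsilon> / 2" using M[of ?q n] that by simp
      ultimately have "nrm (\<lambda>\<gamma>. X n \<gamma> - f n \<gamma>) < \<epsilon>" using N by linarith
      then show ?thesis using nrm_nonneg[OF Cc_diff[OF CS_Cc[OF X(1)] fCc]] by simp
    qed
    then show "\<exists>no. \<forall>n\<ge>no. norm (nrm (\<lambda>\<gamma>. X n \<gamma> - f n \<gamma>) - 0) < \<epsilon>" by blast
  qed
  then have "cls X = cls f" using cls_eq_iff X(1) Cauchy by blast
  then show ?thesis using X(2) M_rI[OF Cauchy f] by simp
qed

lemma Cstar_subalgebra_M_r: "Cstar_subalgebra G (M_r G)"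
  unfolding Cstar_subalgebra_def
proof (intro conjI ballI allI impI)
  show "M_r G \<subseteq> Cred G" using cls_Cred M_rE by blast
  have "(\<lambda>_. 0) \<in> Cc Iso_gpd"
    unfolding Cc_Iso_iff using Cc_zero_fun by (auto intro!: exI[of _ "{}"])
  then show "Cred_zero G \<in> M_r G" unfolding Cred_zero_cls by (intro M_rI CS_const Cc_zero_fun)
next
  fix a b assume a: "a \<in> M_r G" and b: "b \<in> M_r G"
  obtain X where X: "X \<in> CS" "\<And>n. X n \<in> Cc Iso_gpd" "a = cls X" using a by (rule M_rE) blast
  obtain Y where Y: "Y \<in> CS" "\<And>n. Y n \<in> Cc Iso_gpd" "b = cls Y" using b by (rule M_rE) blast
  show "Cred_add G a b \<in> M_r G"
    unfolding X(3) Y(3) Cred_add_cls[OF X(1) Y(1)] by (intro M_rI CS_add Cc_Iso_add X Y)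
  show "Cred_mult G a b \<in> M_r G"
    unfolding X(3) Y(3) Cred_mult_cls[OF X(1) Y(1)] by (intro M_rI CS_conv Cc_Iso_conv X Y)
next
  fix a c assume a: "a \<in> M_r G"
  obtain X where X: "X \<in> CS" "\<And>n. X n \<in> Cc Iso_gpd" "a = cls X" using a by (rule M_rE) blast
  show "Cred_star G a \<in> M_r G"
    unfolding X(3) Cred_star_cls[OF X(1)] by (intro M_rI CS_invol Cc_Iso_invol X)
  show "Cred_scale G c a \<in> M_r G"
    unfolding X(3) Cred_scale_cls[OF X(1)] by (intro M_rI CS_scale Cc_Iso_scale X)
qed (use M_r_closed in blast)

end

section \<open>Mass off the interior of the isotropy\<close>

context lch_etale_groupoid
begin

text \<open>Dividing by a unit changes nothing, so the column indexed by the unit \<open>u\<close>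
  is \<open>f\<close> itself on the source fibre.\<close>

lemma column_L2_le_nrm:
  assumes f: "f \<in> Cc G" and u: "u \<in> units G" and F: "finite F" "F \<subseteq> src_fibre G u"
  shows "L2_set (\<lambda>\<beta>. cmod (f \<beta>)) F \<le> nrm f"
proof -
  have "L2_set (\<lambda>\<beta>. cmod (f \<beta>)) F = L2_set (\<lambda>\<beta>. cmod (kern G f \<beta> u)) F"
    using F by (intro L2_set_cong) (auto simp: kern_def dest!: subsetD[of F])
  also have "\<dots> \<le> nrm f"
    using nrm_bounded[OF f] u F units_arrows[OF u] src_unit[OF u]
    by (intro mat_bounded_column[of "src_fibre G u"]) (auto simp: red_bounded_def)
  finally show ?thesis .
qed

lemma row_L2_le_nrm:
  assumes f: "f \<in> Cc G" and \<gamma>: "\<gamma> \<in> arrows G" and F: "finite F" "F \<subseteq> src_fibre G (src G \<gamma>)"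
  shows "L2_set (\<lambda>\<beta>. cmod (f (dv G \<gamma> \<beta>))) F \<le> nrm f"
  using mat_bounded_row[of "src_fibre G (src G \<gamma>)" "kern G f" "nrm f" \<gamma> F] nrm_bounded[OF f] \<gamma> F
  by (simp add: red_bounded_def kern_def)

text \<open>Let \<open>m\<close> tend to infinity in the bound for \<open>X n - X m\<close>. The
  index \<open>N\<close> comes from the Cauchy condition alone, so the estimate is uniform in
  \<open>F\<close> although the convergence on \<open>F\<close> is only pointwise. \<open>h\<close>
  is the identity for columns and a quotient map for rows.\<close>

lemma CS_L2_tail:
  assumes X: "X \<in> CS" and F: "finite F"
    and le: "\<And>f. f \<in> Cc G \<Longrightarrow> L2_set (\<lambda>\<beta>. cmod (f (h \<beta>))) F \<le> nrm f"
    and lim: "\<And>\<beta>. \<beta> \<in> F \<Longrightarrow> (\<lambda>n. X n (h \<beta>)) \<longlonglongrightarrow> 0"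
    and N: "\<And>m n. m \<ge> N \<Longrightarrow> n \<ge> N \<Longrightarrow> nrm (\<lambda>\<gamma>. X m \<gamma> - X n \<gamma>) < \<epsilon>" and n: "n \<ge> N"
  shows "L2_set (\<lambda>\<beta>. cmod (X n (h \<beta>))) F \<le> \<epsilon>"
proof (rule LIMSEQ_le_const2)
  have "(\<lambda>m. L2_set (\<lambda>\<beta>. cmod (X n (h \<beta>) - X m (h \<beta>))) F) \<longlonglongrightarrow> L2_set (\<lambda>\<beta>. cmod (X n (h \<beta>) - 0)) F"
    unfolding L2_set_def using lim by (intro tendsto_intros) auto
  then show "(\<lambda>m. L2_set (\<lambda>\<beta>. cmod (X n (h \<beta>) - X m (h \<beta>))) F) \<longlonglongrightarrow> L2_set (\<lambda>\<beta>. cmod (X n (h \<beta>))) F"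
    by simp
  have "L2_set (\<lambda>\<beta>. cmod (X n (h \<beta>) - X m (h \<beta>))) F \<le> \<epsilon>" if "m \<ge> N" for m
    using le[OF Cc_diff[OF CS_Cc[OF X] CS_Cc[OF X]], of n m] N[OF n that] by linarith
  then show "\<exists>N. \<forall>m\<ge>N. L2_set (\<lambda>\<beta>. cmod (X n (h \<beta>) - X m (h \<beta>))) F \<le> \<epsilon>" by blast
qed

text \<open>Convolution restricted to factorisations with both factors in \<open>Iso0\<close>. The
  nonzero conditions make the index set finite when \<open>g\<close> has finite support on source
  fibres, and they are symmetric under exchanging the two factors.\<close>

definition iso_conv :: "('g \<Rightarrow> complex) \<Rightarrow> ('g \<Rightarrow> complex) \<Rightarrow> 'g \<Rightarrow> complex" where
  "iso_conv f g \<gamma> = (\<Sum>\<beta>\<in>{\<beta> \<in> src_fibre G (src G \<gamma>). \<beta> \<in> Iso0 \<and> dv G \<gamma> \<beta> \<in> Iso0 \<and> f (dv G \<gamma> \<beta>) \<noteq> 0 \<and> g \<beta> \<noteq> 0}.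
     f (dv G \<gamma> \<beta>) * g \<beta>)"

lemma iso_conv_zero:
  assumes "\<gamma> \<in> arrows G" "\<gamma> \<notin> Iso0"
  shows "iso_conv f g \<gamma> = 0"
proof -
  have "\<not> (\<beta> \<in> Iso0 \<and> dv G \<gamma> \<beta> \<in> Iso0)" if "\<beta> \<in> src_fibre G (src G \<gamma>)" for \<beta>
    using mult_Iso0[of "dv G \<gamma> \<beta>" \<beta>] that assms by auto
  then have "{\<beta> \<in> src_fibre G (src G \<gamma>). \<beta> \<in> Iso0 \<and> dv G \<gamma> \<beta> \<in> Iso0 \<and> f (dv G \<gamma> \<beta>) \<noteq> 0 \<and> g \<beta> \<noteq> 0} = {}"
    by blast
  then show ?thesis unfolding iso_conv_def by (simp only: sum.empty)
qed

text \<open>The substitution that replaces \<beta> by \<open>dv G \<gamma> \<beta>\<close> exchanges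
  the two factors. It is an involution because commutativity gives
  \<open>\<gamma> \<beta> \<gamma>\<^sup>-\<^sup>1 = \<beta>\<close>.\<close>

lemma iso_conv_commute:
  assumes ab: "abelian_iso_interior G" and \<gamma>: "\<gamma> \<in> Iso0"
  shows "iso_conv f g \<gamma> = iso_conv g f \<gamma>"
proof -
  have arr: "\<gamma> \<in> arrows G" and rg: "rng G \<gamma> = src G \<gamma>" using \<gamma> Iso0_arrows Iso0_rng by auto
  have inv: "dv G \<gamma> (dv G \<gamma> \<beta>) = \<beta>" "dv G \<gamma> \<beta> \<in> src_fibre G (src G \<gamma>)" "dv G \<gamma> \<beta> \<in> Iso0"
    if \<beta>: "\<beta> \<in> src_fibre G (src G \<gamma>)" "\<beta> \<in> Iso0" for \<beta>
  proof -
    have rb: "rng G \<beta> = src G \<gamma>" using Iso0_rng[OF \<beta>(2)] \<beta> by simp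
    have c: "mult G \<gamma> \<beta> = mult G \<beta> \<gamma>"
      using ab \<gamma> \<beta> arr unfolding abelian_iso_interior_def by (metis IntI in_src_fibre src_in_units)
    have "dv G \<gamma> (dv G \<gamma> \<beta>) = mult G \<gamma> (dv G \<beta> \<gamma>)" using arr \<beta> by (simp add: ginv_dv)
    also have "\<dots> = mult G (mult G \<gamma> \<beta>) (ginv G \<gamma>)"
      using arr \<beta> rb by (intro mult_assoc[symmetric]) auto
    also have "\<dots> = \<beta>" unfolding c using arr \<beta> rg by simp
    finally show "dv G \<gamma> (dv G \<gamma> \<beta>) = \<beta>" .
    show "dv G \<gamma> \<beta> \<in> src_fibre G (src G \<gamma>)" using arr \<beta> rb by simp
    show "dv G \<gamma> \<beta> \<in> Iso0" using dv_Iso0[OF \<gamma> \<beta>(2)] \<beta> by simp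
  qed
  show ?thesis
    unfolding iso_conv_def
    by (rule sum.reindex_bij_witness[where i="\<lambda>\<beta>. dv G \<gamma> \<beta>" and j="\<lambda>\<beta>. dv G \<gamma> \<beta>"])
      (use inv in \<open>auto simp del: in_src_fibre simp: mult.commute\<close>)
qed

text \<open>The omitted terms fall into two disjoint classes: the right factor is off
  \<open>Iso0\<close> (\<open>D2\<close>), or only the left one is (\<open>D3\<close>). In each,
  Cauchy-Schwarz pairs a small factor with one bounded by the norm, and contributes
  \<open>C * \<epsilon>\<close>.\<close>

lemma conv_iso_conv_le:
  assumes f: "f \<in> Cc G" "nrm f \<le> C" and g: "g \<in> Cc G" "nrm g \<le> C" and \<gamma>: "\<gamma> \<in> arrows G"
    and frow: "\<And>F. finite F \<Longrightarrow> F \<subseteq> src_fibre G (src G \<gamma>) \<Longrightarrow> (\<And>\<beta>. \<beta> \<in> F \<Longrightarrow> dv G \<gamma> \<beta> \<notin> Iso0) \<Longrightarrow>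
        L2_set (\<lambda>\<beta>. cmod (f (dv G \<gamma> \<beta>))) F \<le> \<epsilon>"
    and gcol: "\<And>F. finite F \<Longrightarrow> F \<subseteq> src_fibre G (src G \<gamma>) \<Longrightarrow> (\<And>\<beta>. \<beta> \<in> F \<Longrightarrow> \<beta> \<notin> Iso0) \<Longrightarrow>
        L2_set (\<lambda>\<beta>. cmod (g \<beta>)) F \<le> \<epsilon>"
  shows "cmod (conv G f g \<gamma> - iso_conv f g \<gamma>) \<le> 2 * (C * \<epsilon>)"
proof -
  let ?P = "\<lambda>\<beta>. f (dv G \<gamma> \<beta>) * g \<beta>"
  define D where "D = {\<beta> \<in> src_fibre G (src G \<gamma>). f (dv G \<gamma> \<beta>) \<noteq> 0 \<and> g \<beta> \<noteq> 0}"
  define D1 where "D1 = {\<beta> \<in> D. \<beta> \<in> Iso0 \<and> dv G \<gamma> \<beta> \<in> Iso0}"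
  define D2 where "D2 = {\<beta> \<in> D. \<beta> \<notin> Iso0}"
  define D3 where "D3 = {\<beta> \<in> D. \<beta> \<in> Iso0 \<and> dv G \<gamma> \<beta> \<notin> Iso0}"
  have "D \<subseteq> {\<beta> \<in> arrows G. src G \<beta> = src G \<gamma> \<and> g \<beta> \<noteq> 0}" by (auto simp: D_def)
  moreover have "finite {\<beta> \<in> arrows G. src G \<beta> = src G \<gamma> \<and> g \<beta> \<noteq> 0}"
    using Cc_fibre_finite[OF g(1)] unfolding fibre_finite_def by blast
  ultimately have fin: "finite D" by (rule finite_subset)
  have sub: "D2 \<subseteq> src_fibre G (src G \<gamma>)" "D3 \<subseteq> src_fibre G (src G \<gamma>)" by (auto simp: D2_def D3_def D_def)
  have fins: "finite D1" "finite D2" "finite D3" using fin by (simp_all add: D1_def D2_def D3_def)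
  have C: "0 \<le> C" using nrm_nonneg[OF f(1)] f(2) by linarith
  have \<epsilon>: "0 \<le> \<epsilon>" using gcol[of "{}"] by simp
  have "D1 = {\<beta> \<in> src_fibre G (src G \<gamma>). \<beta> \<in> Iso0 \<and> dv G \<gamma> \<beta> \<in> Iso0 \<and> f (dv G \<gamma> \<beta>) \<noteq> 0 \<and> g \<beta> \<noteq> 0}"
    unfolding D1_def D_def by blast
  then have iso: "iso_conv f g \<gamma> = sum ?P D1"
    unfolding iso_conv_def by simp
  have "conv G f g \<gamma> = sum ?P D"
    by (rule conv_eq_sum[OF \<gamma> fin]) (auto simp: D_def)
  also have "D = D1 \<union> (D2 \<union> D3)" by (auto simp: D1_def D2_def D3_def)
  also have "sum ?P \<dots> = sum ?P D1 + sum ?P (D2 \<union> D3)"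
    using fins by (intro sum.union_disjoint) (auto simp: D1_def D2_def D3_def)
  also have "sum ?P (D2 \<union> D3) = sum ?P D2 + sum ?P D3"
    using fins by (intro sum.union_disjoint) (auto simp: D2_def D3_def)
  finally have "conv G f g \<gamma> - iso_conv f g \<gamma> = sum ?P D2 + sum ?P D3"
    by (simp add: iso)
  moreover have "cmod (sum ?P D2) \<le> C * \<epsilon>"
  proof -
    have "cmod (sum ?P D2) \<le> L2_set (\<lambda>\<beta>. cmod (f (dv G \<gamma> \<beta>))) D2 * L2_set (\<lambda>\<beta>. cmod (g \<beta>)) D2"
      by (rule cmod_sum_mult_le_L2)
    also have "\<dots> \<le> C * \<epsilon>"
      using row_L2_le_nrm[OF f(1) \<gamma> fins(2) sub(1)] f(2) gcol[OF fins(2) sub(1)] C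
      by (intro mult_mono) (auto simp: D2_def)
    finally show ?thesis .
  qed
  moreover have "cmod (sum ?P D3) \<le> C * \<epsilon>"
  proof -
    have "cmod (sum ?P D3) \<le> L2_set (\<lambda>\<beta>. cmod (f (dv G \<gamma> \<beta>))) D3 * L2_set (\<lambda>\<beta>. cmod (g \<beta>)) D3"
      by (rule cmod_sum_mult_le_L2)
    also have "\<dots> \<le> \<epsilon> * C"
      using column_L2_le_nrm[OF g(1) src_in_units[OF \<gamma>] fins(3) sub(2)] g(2) frow[OF fins(3) sub(2)] \<epsilon>
      by (intro mult_mono) (auto simp: D3_def)
    finally show ?thesis by (simp add: mult.commute)
  qed
  ultimately show ?thesis using norm_triangle_ineq[of "sum ?P D2" "sum ?P D3"] by simp
qed

lemma conv_iso_conv_tendsto: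
  assumes X: "X \<in> CS" "\<And>\<beta>. \<beta> \<notin> Iso0 \<Longrightarrow> (\<lambda>n. X n \<beta>) \<longlonglongrightarrow> 0"
    and Y: "Y \<in> CS" "\<And>\<beta>. \<beta> \<notin> Iso0 \<Longrightarrow> (\<lambda>n. Y n \<beta>) \<longlonglongrightarrow> 0"
    and \<gamma>: "\<gamma> \<in> arrows G"
  shows "(\<lambda>n. conv G (X n) (Y n) \<gamma> - iso_conv (X n) (Y n) \<gamma>) \<longlonglongrightarrow> 0"
proof (rule LIMSEQ_I)
  fix e :: real assume e: "e > 0"
  obtain CX where CX: "CX > 0" "\<And>n. nrm (X n) \<le> CX" using CS_bounded[OF X(1)] by blast
  obtain CY where CY: "CY > 0" "\<And>n. nrm (Y n) \<le> CY" using CS_bounded[OF Y(1)] by blast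
  define C where "C = max CX CY"
  have C: "C > 0" "nrm (X n) \<le> C" "nrm (Y n) \<le> C" for n
    using CX CY by (auto simp: C_def le_max_iff_disj)
  \<comment> \<open>Chosen so that the bound \<open>2 * (C * \<epsilon>)\<close> equals
    \<open>e / 2\<close>, which leaves room for the strict inequality.\<close>
  define \<epsilon> where "\<epsilon> = e / (4 * C)"
  have \<epsilon>: "\<epsilon> > 0" using e C by (simp add: \<epsilon>_def)
  obtain N where N: "\<And>m n. m \<ge> N \<Longrightarrow> n \<ge> N \<Longrightarrow> nrm (\<lambda>\<gamma>. X m \<gamma> - X n \<gamma>) < \<epsilon>"
    using CS_eps[OF X(1) \<epsilon>] by blast
  obtain M where M: "\<And>m n. m \<ge> M \<Longrightarrow> n \<ge> M \<Longrightarrow> nrm (\<lambda>\<gamma>. Y m \<gamma> - Y n \<gamma>) < \<epsilon>"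
    using CS_eps[OF Y(1) \<epsilon>] by blast
  have "norm (conv G (X n) (Y n) \<gamma> - iso_conv (X n) (Y n) \<gamma> - 0) < e" if n: "n \<ge> max N M" for n
  proof -
    have "cmod (conv G (X n) (Y n) \<gamma> - iso_conv (X n) (Y n) \<gamma>) \<le> 2 * (C * \<epsilon>)"
    proof (rule conv_iso_conv_le[OF CS_Cc[OF X(1)] C(2) CS_Cc[OF Y(1)] C(3) \<gamma>])
      fix F assume F: "finite F" "F \<subseteq> src_fibre G (src G \<gamma>)" "\<And>\<beta>. \<beta> \<in> F \<Longrightarrow> dv G \<gamma> \<beta> \<notin> Iso0"
      show "L2_set (\<lambda>\<beta>. cmod (X n (dv G \<gamma> \<beta>))) F \<le> \<epsilon>"
        by (rule CS_L2_tail[where N=N, OF X(1) F(1) row_L2_le_nrm[OF _ \<gamma> F(1,2)] X(2)[OF F(3)] N])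
          (use n in auto)
    next
      fix F assume F: "finite F" "F \<subseteq> src_fibre G (src G \<gamma>)" "\<And>\<beta>. \<beta> \<in> F \<Longrightarrow> \<beta> \<notin> Iso0"
      show "L2_set (\<lambda>\<beta>. cmod (Y n \<beta>)) F \<le> \<epsilon>"
        by (rule CS_L2_tail[where N=M and h="\<lambda>\<beta>. \<beta>", OF Y(1) F(1) column_L2_le_nrm[OF _ src_in_units[OF \<gamma>] F(1,2)] Y(2)[OF F(3)] M])
          (use n in auto)
    qed
    also have "2 * (C * \<epsilon>) = e / 2" using C(1) by (simp add: \<epsilon>_def)
    finally show ?thesis using e by simp
  qed
  then show "\<exists>no. \<forall>n\<ge>no. norm (conv G (X n) (Y n) \<gamma> - iso_conv (X n) (Y n) \<gamma> - 0) < e" by blast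
qed

text \<open>The source fibre contains only one unit, so one term survives. With its left-hand
  counterpart this shows that functions on the unit space act as multiplication by their values at
  the source or at the range.\<close>

lemma conv_unit_supported_right:
  assumes f: "\<And>\<beta>. \<beta> \<notin> units G \<Longrightarrow> f \<beta> = 0" and \<gamma>: "\<gamma> \<in> arrows G"
  shows "conv G g f \<gamma> = g \<gamma> * f (src G \<gamma>)"
proof -
  have "conv G g f \<gamma> = (\<Sum>\<beta>\<in>{src G \<gamma>}. g (dv G \<gamma> \<beta>) * f \<beta>)"
  proof (rule conv_eq_sum[OF \<gamma>])
    fix \<beta> assume "\<beta> \<in> src_fibre G (src G \<gamma>) - {src G \<gamma>}"
    then have "\<beta> \<notin> units G" using src_unit by fastforce
    then show "g (dv G \<gamma> \<beta>) * f \<beta> = 0" using f by simp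
  qed (use \<gamma> in auto)
  then show ?thesis using \<gamma> by simp
qed

lemma conv_unit_supported_left:
  assumes f: "\<And>\<beta>. \<beta> \<notin> units G \<Longrightarrow> f \<beta> = 0" and \<gamma>: "\<gamma> \<in> arrows G"
  shows "conv G f g \<gamma> = f (rng G \<gamma>) * g \<gamma>"
proof -
  have "conv G f g \<gamma> = (\<Sum>\<beta>\<in>{\<gamma>}. f (dv G \<gamma> \<beta>) * g \<beta>)"
  proof (rule conv_eq_sum[OF \<gamma>])
    fix \<beta> assume \<beta>: "\<beta> \<in> src_fibre G (src G \<gamma>) - {\<gamma>}"
    \<comment> \<open>A unit quotient would have to be \<open>rng G \<beta>\<close>, which forces
      \<beta> and \<gamma> to be equal.\<close>
    have "dv G \<gamma> \<beta> \<notin> units G"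
    proof
      assume u: "dv G \<gamma> \<beta> \<in> units G"
      then have "dv G \<gamma> \<beta> = src G (dv G \<gamma> \<beta>)" using src_unit by simp
      also have "\<dots> = rng G \<beta>" using \<beta> \<gamma> by simp
      finally have "mult G (dv G \<gamma> \<beta>) \<beta> = \<beta>" using \<beta> by simp
      then show False using \<beta> \<gamma> by simp
    qed
    then show "f (dv G \<gamma> \<beta>) * g \<beta> = 0" using f by simp
  qed (use \<gamma> in auto)
  then show ?thesis using \<gamma> by simp
qed

end

section \<open>The characterisation\<close>

locale renault_map = lch_etale_groupoid G for G :: "'g top_groupoid" +
  fixes j :: "'g cstar_elt \<Rightarrow> 'g \<Rightarrow> complex"
  assumes j_C0: "\<And>a. a \<in> Cred G \<Longrightarrow> j a \<in> C0 G"
    and j_add: "\<And>a b. a \<in> Cred G \<Longrightarrow> b \<in> Cred G \<Longrightarrow> j (Cred_add G a b) = (\<lambda>\<gamma>. j a \<gamma> + j b \<gamma>)"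
    and j_scale: "\<And>c a. a \<in> Cred G \<Longrightarrow> j (Cred_scale G c a) = (\<lambda>\<gamma>. c * j a \<gamma>)"
    and j_norm_decreasing: "\<And>a \<gamma>. a \<in> Cred G \<Longrightarrow> \<gamma> \<in> arrows G \<Longrightarrow> cmod (j a \<gamma>) \<le> Cred_norm G a"
    and j_inj: "inj_on j (Cred G)"
    and j_extends: "\<And>f. f \<in> Cc G \<Longrightarrow> j (Cred_incl G f) = f"
begin

lemma j_zero: "a \<in> Cred G \<Longrightarrow> \<gamma> \<notin> arrows G \<Longrightarrow> j a \<gamma> = 0"
  using j_C0 by (simp add: C0_def)

lemma j_dist:
  assumes X: "X \<in> CS" and Y: "Y \<in> CS" and \<gamma>: "\<gamma> \<in> arrows G"
  shows "cmod (j (cls X) \<gamma> - j (cls Y) \<gamma>) \<le> Cred_dist G (cls X) (cls Y)"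
proof -
  have s: "Cred_scale G (- 1) (cls Y) \<in> Cred G"
    unfolding Cred_scale_cls[OF Y] by (rule cls_Cred[OF CS_scale[OF Y]])
  have "Cred_add G (cls X) (Cred_scale G (- 1) (cls Y)) \<in> Cred G"
    unfolding Cred_scale_cls[OF Y] Cred_add_cls[OF X CS_scale[OF Y]]
    by (rule cls_Cred[OF CS_add[OF X CS_scale[OF Y]]])
  from j_norm_decreasing[OF this \<gamma>] show ?thesis
    by (simp add: Cred_dist_def j_add[OF cls_Cred[OF X] s] j_scale[OF cls_Cred[OF Y]])
qed

text \<open>Compare the class of \<open>X\<close> with that of the constant sequence
  \<open>X n\<close>, on which \<open>j\<close> is explicit: their distance is small for large
  \<open>n\<close>, and \<open>j\<close> does not increase it.\<close>

lemma j_lim: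
  assumes X: "X \<in> CS"
  shows "(\<lambda>n. X n \<gamma>) \<longlonglongrightarrow> j (cls X) \<gamma>"
proof (cases "\<gamma> \<in> arrows G")
  case False
  then show ?thesis using j_zero[OF cls_Cred[OF X]] Cc_zero[OF CS_Cc[OF X]] by simp
next
  case True
  show ?thesis
  proof (rule LIMSEQ_I)
    fix e :: real assume "e > 0"
    then have "e / 2 > 0" by simp
    then obtain N where N: "\<And>m n. m \<ge> N \<Longrightarrow> n \<ge> N \<Longrightarrow> nrm (\<lambda>\<gamma>. X m \<gamma> - X n \<gamma>) < e / 2"
      using CS_eps[OF X] by blast
    have "norm (X n \<gamma> - j (cls X) \<gamma>) < e" if n: "n \<ge> N" for n
    proof -
      have c: "(\<lambda>_. X n) \<in> CS" by (rule CS_const[OF CS_Cc[OF X]])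
      have "Cred_dist G (cls X) (cls (\<lambda>_. X n)) \<le> e / 2"
        by (rule LIMSEQ_le_const2[OF Cred_dist_cls[OF X c]]) (use N n less_imp_le in blast)
      moreover have "j (cls (\<lambda>_. X n)) = X n"
        using j_extends[OF CS_Cc[OF X]] by (simp add: Cred_incl_def)
      ultimately show ?thesis using j_dist[OF X c True] \<open>e > 0\<close> by (simp add: norm_minus_commute)
    qed
    then show "\<exists>no. \<forall>n\<ge>no. norm (X n \<gamma> - j (cls X) \<gamma>) < e" by blast
  qed
qed

lemma j_eqI:
  assumes "a \<in> Cred G" "b \<in> Cred G" "\<And>\<gamma>. \<gamma> \<in> arrows G \<Longrightarrow> j a \<gamma> = j b \<gamma>"
  shows "a = b"
proof -
  have "j a = j b" using assms j_zero by (metis ext)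
  then show ?thesis using j_inj assms by (meson inj_onD)
qed

definition iso_elts :: "'g cstar_elt set" where
  "iso_elts = {a \<in> Cred G. j a \<in> C0_on G Iso0}"

text \<open>Turns membership into pointwise convergence of a representative, the form in which
  \<open>conv_iso_conv_tendsto\<close> takes its hypotheses.\<close>

lemma cls_iso_elts:
  assumes "X \<in> CS"
  shows "cls X \<in> iso_elts \<longleftrightarrow> (\<forall>\<gamma>. \<gamma> \<notin> Iso0 \<longrightarrow> (\<lambda>n. X n \<gamma>) \<longlonglongrightarrow> 0)"
proof -
  have "cls X \<in> iso_elts \<longleftrightarrow> (\<forall>\<gamma>. \<gamma> \<notin> Iso0 \<longrightarrow> j (cls X) \<gamma> = 0)"
    using cls_Cred[OF assms] j_C0 by (simp add: iso_elts_def C0_on_def)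
  also have "\<dots> \<longleftrightarrow> (\<forall>\<gamma>. \<gamma> \<notin> Iso0 \<longrightarrow> (\<lambda>n. X n \<gamma>) \<longlonglongrightarrow> 0)"
    using j_lim[OF assms] LIMSEQ_unique by metis
  finally show ?thesis .
qed

lemma iso_eltsE:
  assumes "a \<in> iso_elts"
  obtains X where "X \<in> CS" "a = cls X" "\<And>\<gamma>. \<gamma> \<notin> Iso0 \<Longrightarrow> (\<lambda>n. X n \<gamma>) \<longlonglongrightarrow> 0"
proof -
  have "a \<in> Cred G" using assms by (simp add: iso_elts_def)
  then obtain X where "X \<in> CS" "a = cls X" by (rule CredE)
  then show thesis using that assms cls_iso_elts by blast
qed

lemma M_r_iso_elts: "M_r G \<subseteq> iso_elts"
proof
  fix a assume "a \<in> M_r G"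
  then obtain X where X: "X \<in> CS" "\<And>n. X n \<in> Cc Iso_gpd" "a = cls X" by (rule M_rE) blast
  have "(\<lambda>n. X n \<gamma>) \<longlonglongrightarrow> 0" if "\<gamma> \<notin> Iso0" for \<gamma>
    using Cc_Iso_zero[OF X(2) that] by simp
  then show "a \<in> iso_elts" using cls_iso_elts[OF X(1)] X(3) by simp
qed

text \<open>The two products differ from the same \<open>iso_conv\<close> by sequences that tend to
  zero pointwise, so their images under \<open>j\<close> agree and injectivity finishes.\<close>

lemma iso_elts_mult_commute:
  assumes ab: "abelian_iso_interior G" and a: "a \<in> iso_elts" and b: "b \<in> iso_elts"
  shows "Cred_mult G a b = Cred_mult G b a"
proof -
  obtain X where X: "X \<in> CS" "a = cls X" "\<And>\<gamma>. \<gamma> \<notin> Iso0 \<Longrightarrow> (\<lambda>n. X n \<gamma>) \<longlonglongrightarrow> 0"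
    using a by (rule iso_eltsE) blast
  obtain Y where Y: "Y \<in> CS" "b = cls Y" "\<And>\<gamma>. \<gamma> \<notin> Iso0 \<Longrightarrow> (\<lambda>n. Y n \<gamma>) \<longlonglongrightarrow> 0"
    using b by (rule iso_eltsE) blast
  note XY = CS_conv[OF X(1) Y(1)] and YX = CS_conv[OF Y(1) X(1)]
  have "cls (\<lambda>n. conv G (X n) (Y n)) = cls (\<lambda>n. conv G (Y n) (X n))"
  proof (rule j_eqI[OF cls_Cred[OF XY] cls_Cred[OF YX]])
    fix \<gamma> assume \<gamma>: "\<gamma> \<in> arrows G"
    have "iso_conv (X n) (Y n) \<gamma> = iso_conv (Y n) (X n) \<gamma>" for n
      using iso_conv_commute[OF ab] iso_conv_zero[OF \<gamma>] by (cases "\<gamma> \<in> Iso0") auto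
    then have "(\<lambda>n. conv G (X n) (Y n) \<gamma> - conv G (Y n) (X n) \<gamma>) \<longlonglongrightarrow> 0 - 0"
      using tendsto_diff[OF conv_iso_conv_tendsto[OF X(1,3) Y(1,3) \<gamma>] conv_iso_conv_tendsto[OF Y(1,3) X(1,3) \<gamma>]]
      by simp
    moreover have "(\<lambda>n. conv G (X n) (Y n) \<gamma> - conv G (Y n) (X n) \<gamma>) \<longlonglongrightarrow>
        j (cls (\<lambda>n. conv G (X n) (Y n))) \<gamma> - j (cls (\<lambda>n. conv G (Y n) (X n))) \<gamma>"
      by (intro tendsto_diff j_lim XY YX)
    ultimately show "j (cls (\<lambda>n. conv G (X n) (Y n))) \<gamma> = j (cls (\<lambda>n. conv G (Y n) (X n))) \<gamma>"
      using LIMSEQ_unique by fastforce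
  qed
  then show ?thesis unfolding X(2) Y(2) Cred_mult_cls[OF X(1) Y(1)] Cred_mult_cls[OF Y(1) X(1)] .
qed

lemma Cstar_subalgebra_iso_elts: "Cstar_subalgebra G iso_elts"
  unfolding Cstar_subalgebra_def
proof (intro conjI ballI allI impI)
  show "iso_elts \<subseteq> Cred G" by (auto simp: iso_elts_def)
  show "Cred_zero G \<in> iso_elts"
    using M_r_iso_elts Cstar_subalgebra_M_r unfolding Cstar_subalgebra_def by blast
next
  fix a b assume a: "a \<in> iso_elts" and b: "b \<in> iso_elts"
  obtain X where X: "X \<in> CS" "a = cls X" "\<And>\<gamma>. \<gamma> \<notin> Iso0 \<Longrightarrow> (\<lambda>n. X n \<gamma>) \<longlonglongrightarrow> 0"
    using a by (rule iso_eltsE) blast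
  obtain Y where Y: "Y \<in> CS" "b = cls Y" "\<And>\<gamma>. \<gamma> \<notin> Iso0 \<Longrightarrow> (\<lambda>n. Y n \<gamma>) \<longlonglongrightarrow> 0"
    using b by (rule iso_eltsE) blast
  have "(\<lambda>n. X n \<gamma> + Y n \<gamma>) \<longlonglongrightarrow> 0" if "\<gamma> \<notin> Iso0" for \<gamma>
    using tendsto_add[OF X(3)[OF that] Y(3)[OF that]] by simp
  then show "Cred_add G a b \<in> iso_elts"
    unfolding X(2) Y(2) Cred_add_cls[OF X(1) Y(1)] cls_iso_elts[OF CS_add[OF X(1) Y(1)]] by blast
  \<comment> \<open>Off \<open>Iso0\<close> the sum \<open>iso_conv\<close> is zero, because
    \<open>Iso0\<close> is closed under products; hence the convolution itself tends to
    zero.\<close>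
  have "(\<lambda>n. conv G (X n) (Y n) \<gamma>) \<longlonglongrightarrow> 0" if "\<gamma> \<notin> Iso0" for \<gamma>
  proof (cases "\<gamma> \<in> arrows G")
    case True
    then show ?thesis
      using conv_iso_conv_tendsto[OF X(1,3) Y(1,3) True] iso_conv_zero[OF True that] by simp
  qed (simp add: conv_eq_infsum)
  then show "Cred_mult G a b \<in> iso_elts"
    unfolding X(2) Y(2) Cred_mult_cls[OF X(1) Y(1)] cls_iso_elts[OF CS_conv[OF X(1) Y(1)]] by blast
next
  fix a c assume a: "a \<in> iso_elts"
  obtain X where X: "X \<in> CS" "a = cls X" "\<And>\<gamma>. \<gamma> \<notin> Iso0 \<Longrightarrow> (\<lambda>n. X n \<gamma>) \<longlonglongrightarrow> 0"
    using a by (rule iso_eltsE) blast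
  have "(\<lambda>n. invol G (X n) \<gamma>) \<longlonglongrightarrow> 0" if "\<gamma> \<notin> Iso0" for \<gamma>
  proof (cases "\<gamma> \<in> arrows G")
    case True
    \<comment> \<open>\<open>Iso0\<close> is closed under inversion, so its complement in the arrows
      is too.\<close>
    then have "ginv G \<gamma> \<notin> Iso0" using that ginv_Iso0[of "ginv G \<gamma>"] by auto
    then show ?thesis using True tendsto_cnj[OF X(3)] by (fastforce simp: invol_def)
  qed (simp add: invol_def)
  then show "Cred_star G a \<in> iso_elts"
    unfolding X(2) Cred_star_cls[OF X(1)] cls_iso_elts[OF CS_invol[OF X(1)]] by blast
  have "(\<lambda>n. c * X n \<gamma>) \<longlonglongrightarrow> 0" if "\<gamma> \<notin> Iso0" for \<gamma>
    using tendsto_mult_left[OF X(3)[OF that], of c] by simp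
  then show "Cred_scale G c a \<in> iso_elts"
    unfolding X(2) Cred_scale_cls[OF X(1)] cls_iso_elts[OF CS_scale[OF X(1)]] by blast
next
  fix a assume a: "a \<in> Cred G" and near: "\<forall>\<epsilon>>0. \<exists>b\<in>iso_elts. Cred_dist G a b < \<epsilon>"
  obtain X where X: "X \<in> CS" "a = cls X" using a by (rule CredE)
  have "j a \<gamma> = 0" if \<gamma>: "\<gamma> \<notin> Iso0" for \<gamma>
  proof (cases "\<gamma> \<in> arrows G")
    case True
    have "cmod (j a \<gamma>) \<le> \<epsilon>" if \<epsilon>: "\<epsilon> > 0" for \<epsilon>
    proof -
      obtain b where b: "b \<in> iso_elts" "Cred_dist G a b < \<epsilon>" using near \<epsilon> by blast
      obtain Y where Y: "Y \<in> CS" "b = cls Y" "\<And>\<gamma>. \<gamma> \<notin> Iso0 \<Longrightarrow> (\<lambda>n. Y n \<gamma>) \<longlonglongrightarrow> 0"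
        using b(1) by (rule iso_eltsE) blast
      have "j b \<gamma> = 0" using b(1) \<gamma> by (simp add: iso_elts_def C0_on_def)
      then show ?thesis using j_dist[OF X(1) Y(1) True] b(2) X(2) Y(2) by simp
    qed
    then have "cmod (j a \<gamma>) \<le> 0" by (rule field_le_epsilon[of _ 0, simplified])
    then show ?thesis by simp
  qed (use j_zero[OF a] in auto)
  then show "a \<in> iso_elts" using a j_C0 by (simp add: iso_elts_def C0_on_def)
qed

lemma commuting_imp_iso_elts:
  assumes a: "a \<in> Cred G" and comm: "\<And>b. b \<in> M_r G \<Longrightarrow> Cred_mult G a b = Cred_mult G b a"
  shows "a \<in> iso_elts"
proof -
  obtain X where X: "X \<in> CS" "a = cls X" using a by (rule CredE)
  have off: "j a \<gamma> = 0" if "\<gamma> \<notin> isotropy G" for \<gamma>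
  proof (cases "\<gamma> \<in> arrows G")
    case True
    then have ne: "rng G \<gamma> \<noteq> src G \<gamma>" using that by (simp add: isotropy_def)
    \<comment> \<open>Deleting the source of \<gamma> from the unit space leaves an open set that
      contains the range of \<gamma>. For a bump \<open>f\<close> supported there,
      \<open>conv G (X n) f\<close> vanishes at \<gamma>, while \<open>conv G f (X n)\<close> has
      the value of \<open>X n\<close> there.\<close>
    have "closedin (gtop G) {src G \<gamma>}"
      using Haus True src_arrow[OF True] by (simp add: closedin_Hausdorff_sing_eq arrows_def)
    then have W: "openin (gtop G) (units G - {src G \<gamma>})" using openin_units by blast
    have "rng G \<gamma> \<in> units G - {src G \<gamma>}" using ne True by simp
    then obtain f where f: "f \<in> Cc G" "f (rng G \<gamma>) = 1" "\<And>y. y \<notin> units G - {src G \<gamma>} \<Longrightarrow> f y = 0"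
      "units G - {src G \<gamma>} \<subseteq> Iso0 \<Longrightarrow> f \<in> Cc Iso_gpd"
      using Cc_units_bump[OF W] by blast
    have fI: "f \<in> Cc Iso_gpd" using f(4) units_Iso0 by blast
    have cf: "(\<lambda>_. f) \<in> CS" by (rule CS_const[OF f(1)])
    have "cls (\<lambda>_. f) \<in> M_r G" by (rule M_rI[OF cf fI])
    from comm[OF this]
    have eq: "cls (\<lambda>n. conv G (X n) f) = cls (\<lambda>n. conv G f (X n))"
      unfolding X(2) Cred_mult_cls[OF X(1) cf] Cred_mult_cls[OF cf X(1)] .
    have "conv G (X n) f \<gamma> = 0" for n
      using conv_unit_supported_right[of f \<gamma> "X n"] f(3) True by simp
    then have "(\<lambda>n. conv G (X n) f \<gamma>) \<longlonglongrightarrow> 0" by simp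
    then have "j (cls (\<lambda>n. conv G (X n) f)) \<gamma> = 0"
      using j_lim[OF CS_conv[OF X(1) cf]] LIMSEQ_unique by blast
    moreover have "conv G f (X n) \<gamma> = X n \<gamma>" for n
      using conv_unit_supported_left[of f \<gamma> "X n"] f(2,3) True by simp
    then have "(\<lambda>n. X n \<gamma>) \<longlonglongrightarrow> j (cls (\<lambda>n. conv G f (X n))) \<gamma>"
      using j_lim[OF CS_conv[OF cf X(1)], of \<gamma>] by simp
    ultimately show ?thesis using eq j_lim[OF X(1), of \<gamma>] X(2) LIMSEQ_unique by metis
  qed (use j_zero[OF a] in auto)
  have "continuous_map (gtop G) euclidean (j a)" using j_C0[OF a] by (simp add: C0_def)
  then have "j a \<gamma> = 0" if "\<gamma> \<notin> Iso0" for \<gamma>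
    using continuous_zero_off_isotropy off that by blast
  then show ?thesis using a j_C0 by (simp add: iso_elts_def C0_on_def)
qed

lemma maximal_abelian_M_r_iff:
  assumes ab: "abelian_iso_interior G"
  shows "maximal_abelian G (M_r G) \<longleftrightarrow> iso_elts \<subseteq> M_r G"
proof
  assume "maximal_abelian G (M_r G)"
  moreover have "abelian_Cstar_subalgebra G iso_elts"
    unfolding abelian_Cstar_subalgebra_def
    using Cstar_subalgebra_iso_elts iso_elts_mult_commute[OF ab] by blast
  ultimately show "iso_elts \<subseteq> M_r G"
    using M_r_iso_elts unfolding maximal_abelian_def by blast
next
  assume sub: "iso_elts \<subseteq> M_r G"
  show "maximal_abelian G (M_r G)"
    unfolding maximal_abelian_def
  proof (intro conjI allI impI)
    show "abelian_Cstar_subalgebra G (M_r G)"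
      unfolding abelian_Cstar_subalgebra_def
      using Cstar_subalgebra_M_r iso_elts_mult_commute[OF ab] M_r_iso_elts by blast
    \<comment> \<open>Since \<open>B\<close> is commutative and contains \<open>M_r G\<close>, each
      of its elements commutes with \<open>M_r G\<close>.\<close>
    fix B assume B: "abelian_Cstar_subalgebra G B \<and> M_r G \<subseteq> B"
    have "B \<subseteq> iso_elts"
    proof
      fix a assume a: "a \<in> B"
      show "a \<in> iso_elts"
      proof (rule commuting_imp_iso_elts)
        show "a \<in> Cred G"
          using a B unfolding abelian_Cstar_subalgebra_def Cstar_subalgebra_def by blast
        show "Cred_mult G a b = Cred_mult G b a" if "b \<in> M_r G" for b
          using a B that unfolding abelian_Cstar_subalgebra_def by blast
      qed
    qed
    then show "B = M_r G" using B sub by blast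
  qed
qed

end

theorem lemma4p4:
  fixes G :: "'g top_groupoid"
    and j :: "'g cstar_elt \<Rightarrow> 'g \<Rightarrow> complex"
  assumes etale: "etale_groupoid G"
    and second_countable: "second_countable (gtop G)"
    and locally_compact: "locally_compact_space (gtop G)"
    and Hausdorff: "Hausdorff_space (gtop G)"
    and abelian: "abelian_iso_interior G"
    and j_C0: "\<And>a. a \<in> Cred G \<Longrightarrow> j a \<in> C0 G"
    and j_add: "\<And>a b. a \<in> Cred G \<Longrightarrow> b \<in> Cred G \<Longrightarrow> j (Cred_add G a b) = (\<lambda>\<gamma>. j a \<gamma> + j b \<gamma>)"
    and j_scale: "\<And>c a. a \<in> Cred G \<Longrightarrow> j (Cred_scale G c a) = (\<lambda>\<gamma>. c * j a \<gamma>)"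
    and j_norm_decreasing: "\<And>a \<gamma>. a \<in> Cred G \<Longrightarrow> \<gamma> \<in> arrows G \<Longrightarrow> cmod (j a \<gamma>) \<le> Cred_norm G a"
    and j_inj: "inj_on j (Cred G)"
    and j_extends: "\<And>f. f \<in> Cc G \<Longrightarrow> j (Cred_incl G f) = f"
  shows "maximal_abelian G (M_r G) \<longleftrightarrow>
         {a \<in> Cred G. j a \<in> C0_on G (iso_interior G)} \<subseteq> M_r G"
proof -
  interpret renault_map G j
    by unfold_locales (fact etale locally_compact Hausdorff j_C0 j_add j_scale j_norm_decreasing j_inj j_extends)+
  show ?thesis using maximal_abelian_M_r_iff[OF abelian] by (simp add: iso_elts_def)
qed

end
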